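(* Let $\mathrm{d}\sigma^2$ be a conformal hyperbolic metric (i.e. a $C^\infty$ conformal metric of constant curvature $-1$) on the punctured disk $\mathbb{D}^{*}=\{w\in\mathbb{C} : 0<|w|<1\}$. Then $0$ is either a conical singularity or a cusp singularity of $\mathrm{d}\sigma^2$. Moreover: (a) If $\mathrm{d}\sigma^2$ has a conical singularity at $w=0$ with cone angle $2\pi\alpha>0$, then there exist $\varepsilon>0$ and a complex coordinate $z$ on $\Delta_\varepsilon=\{w\in\mathbb{C} : |w|<\varepsilon\}$ with $z(0)=0$ such that on $\Delta_\varepsilon\setminus\{0\}$ $$\mathrm{d}\sigma^2=\frac{4\alpha^2|z|^{2\alpha-2}}{\big(1-|z|^{2\alpha}\big)^2}\,|\mathrm{d}z|^2 .$$ Such a coordinate $z$ is unique (near $0$) up to replacement by $\lambda z$ with $\lambda\in\mathbb{C}$, $|\lambda|=1$. (b) If $\mathrm{d}\sigma^2$ has a cusp singularity at $w=0$, then there exist $\varepsilon>0$ and a complex coordinate $z$ on $\Delta_\varepsilon=\{w\in\mathbb{C} : |w|<\varepsilon\}$ with $z(0)=0$ such that on $\Delta_\varepsilon\setminus\{0\}$ $$\mathrm{d}\sigma^2=|z|^{-2}\big(\ln|z|\big)^{-2}\,|\mathrm{d}z|^2 .$$ Such a coordinate $z$ is unique (near $0$) up to replacement by $\lambda z$ with $\lambda\in\mathbb{C}$, $|\lambda|=1$.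
   Context: A conformal metric on a Riemann surface is one which in any local complex coordinate $w$ has the form $e^{2u}|\mathrm{d}w|^2$ with $u$ a real-valued function. A complex coordinate on an open set of a Riemann surface is an injective holomorphic function on it. Let $\mathrm{d}\sigma^2$ be a $C^\infty$ conformal metric of curvature $-1$ on a punctured neighborhood of a point $p$ of a Riemann surface. - $\mathrm{d}\sigma^2$ has a conical singularity at $p$ with cone angle $2\pi\theta>0$ if in a neighborhood $U$ of $p$ with complex coordinate $z$, $z(p)=0$, one has $\mathrm{d}\sigma^2=e^{2u}|\mathrm{d}z|^2$ on $U\setminus\{p\}$, where $u-(\theta-1)\ln|z|$ extends to a continuous function on $U$. The value $\theta=1$ is allowed here. - $\mathrm{d}\sigma^2$ has a cusp singularity at $p$ if in a neighborhood $V$ of $p$ with complex coordinate $z$, $z(p)=0$, one has $\mathrm{d}\sigma^2=e^{2u}|\mathrm{d}z|^2$ on $V\setminus\{p\}$, where $u+\ln|z|+\ln(-\ln|z|)$ extends to a continuous function on $V$. *)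

theory Defs
  imports "HOL-Complex_Analysis.Complex_Analysis"
begin

definition punctured_disk :: "complex set" where
  "punctured_disk = {w. 0 < norm w \<and> norm w < 1}"

primrec Ck_on :: "nat \<Rightarrow> 'a::real_normed_vector set \<Rightarrow> ('a \<Rightarrow> 'b::real_normed_vector) \<Rightarrow> bool" where
  "Ck_on 0 S f \<longleftrightarrow> continuous_on S f"
| "Ck_on (Suc k) S f \<longleftrightarrow>
     (\<forall>x\<in>S. f differentiable (at x)) \<and>
     (\<forall>v. Ck_on k S (\<lambda>x. frechet_derivative f (at x) v))"

text \<open>The derivatives above are unrestricted, so this is meant for open \<open>S\<close>.\<close>

definition Cinf_on :: "'a::real_normed_vector set \<Rightarrow> ('a \<Rightarrow> 'b::real_normed_vector) \<Rightarrow> bool" where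
  "Cinf_on S f \<longleftrightarrow> (\<forall>k. Ck_on k S f)"

definition laplacian :: "('a::euclidean_space \<Rightarrow> real) \<Rightarrow> 'a \<Rightarrow> real" where
  "laplacian f x =
     (\<Sum>b\<in>Basis. frechet_derivative (\<lambda>y. frechet_derivative f (at y) b) (at x) b)"

definition complex_coordinate :: "complex set \<Rightarrow> (complex \<Rightarrow> complex) \<Rightarrow> bool" where
  "complex_coordinate U z \<longleftrightarrow> open U \<and> z holomorphic_on U \<and> inj_on z U"

text \<open>
  A Riemannian metric on an open set \<open>S\<close> of the complex plane is represented by its field of
  quadratic forms: \<open>g w v\<close> is the squared length of the tangent vector \<open>v\<close> at the point \<open>w\<close>.
  Values at points outside \<open>S\<close> carry no meaning; hence the condition \<open>U \<subseteq> S\<close> below.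
\<close>

type_synonym metric = "complex \<Rightarrow> complex \<Rightarrow> real"

text \<open>
  \<open>metric_form S g U z \<rho>\<close> says that the metric \<open>g\<close> on \<open>S\<close> equals \<open>\<rho> |dz|^2\<close> on \<open>U\<close>. Here \<open>\<rho>\<close> is
  a function of the point, not of the value of \<open>z\<close> at that point, and \<open>dz\<close> sends a tangent vector
  \<open>v\<close> at \<open>w\<close> to \<open>deriv z w * v\<close>.
\<close>

definition metric_form ::
    "complex set \<Rightarrow> metric \<Rightarrow> complex set \<Rightarrow> (complex \<Rightarrow> complex) \<Rightarrow> (complex \<Rightarrow> real) \<Rightarrow> bool" where
  "metric_form S g U z \<rho> \<longleftrightarrow>
     U \<subseteq> S \<and> (\<forall>w\<in>U. \<forall>v. g w v = \<rho> w * (norm (deriv z w * v))\<^sup>2)"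

text \<open>
  As \<open>z\<close> is a diffeomorphism onto its image, \<open>u\<close> is smooth as a function of \<open>z\<close> if and only if it is
  smooth as a function of the point.
\<close>

definition smooth_conformal_metric :: "complex set \<Rightarrow> metric \<Rightarrow> bool" where
  "smooth_conformal_metric S g \<longleftrightarrow>
     (\<forall>V z. V \<subseteq> S \<and> complex_coordinate V z \<longrightarrow>
        (\<exists>u. Cinf_on V u \<and> metric_form S g V z (\<lambda>w. exp (2 * u w))))"

text \<open>
  The Gaussian curvature of \<open>e^(2u) |dw|^2\<close> is \<open>- e^(-2u) \<Delta>u\<close>. In the standard coordinate \<open>w\<close> of the
  plane, \<open>e^(2u)\<close> is the squared length of the tangent vector \<open>1\<close>.
\<close>

definition gaussian_curvature :: "metric \<Rightarrow> complex \<Rightarrow> real" where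
  "gaussian_curvature g w = - laplacian (\<lambda>x. ln (g x 1) / 2) w / g w 1"

definition hyperbolic_conformal_metric :: "complex set \<Rightarrow> metric \<Rightarrow> bool" where
  "hyperbolic_conformal_metric S g \<longleftrightarrow>
     smooth_conformal_metric S g \<and> (\<forall>w\<in>S. gaussian_curvature g w = -1)"

text \<open>The cone angle is \<open>2 * pi * \<theta>\<close>.\<close>

definition conical_singularity :: "complex set \<Rightarrow> metric \<Rightarrow> complex \<Rightarrow> real \<Rightarrow> bool" where
  "conical_singularity S g p \<theta> \<longleftrightarrow> \<theta> > 0 \<and>
     (\<exists>U z u h. p \<in> U \<and> complex_coordinate U z \<and> z p = 0 \<and>
        metric_form S g (U - {p}) z (\<lambda>w. exp (2 * u w)) \<and>
        continuous_on U h \<and>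
        (\<forall>w\<in>U - {p}. h w = u w - (\<theta> - 1) * ln (norm (z w))))"

text \<open>
  The bound \<open>norm (z w) < 1\<close> makes \<open>ln (- ln (norm (z w)))\<close> meaningful away from \<open>p\<close>.
\<close>

definition cusp_singularity :: "complex set \<Rightarrow> metric \<Rightarrow> complex \<Rightarrow> bool" where
  "cusp_singularity S g p \<longleftrightarrow>
     (\<exists>V z u h. p \<in> V \<and> complex_coordinate V z \<and> z p = 0 \<and> (\<forall>w\<in>V. norm (z w) < 1) \<and>
        metric_form S g (V - {p}) z (\<lambda>w. exp (2 * u w)) \<and>
        continuous_on V h \<and>
        (\<forall>w\<in>V - {p}. h w = u w + ln (norm (z w)) + ln (- ln (norm (z w)))))"

text \<open>
  In the next two definitions the denominators cannot vanish on \<open>ball 0 \<epsilon> - {0}\<close> when \<open>g\<close> is positive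
  definite: by the convention \<open>x / 0 = 0\<close> the right-hand side would then be the zero form.
\<close>

definition conical_normal_coordinate ::
    "complex set \<Rightarrow> metric \<Rightarrow> real \<Rightarrow> real \<Rightarrow> (complex \<Rightarrow> complex) \<Rightarrow> bool" where
  "conical_normal_coordinate S g \<alpha> \<epsilon> z \<longleftrightarrow>
     \<epsilon> > 0 \<and> complex_coordinate (ball 0 \<epsilon>) z \<and> z 0 = 0 \<and>
     metric_form S g (ball 0 \<epsilon> - {0}) z
       (\<lambda>w. 4 * \<alpha>\<^sup>2 * norm (z w) powr (2 * \<alpha> - 2) / (1 - norm (z w) powr (2 * \<alpha>))\<^sup>2)"

definition cusp_normal_coordinate ::
    "complex set \<Rightarrow> metric \<Rightarrow> real \<Rightarrow> (complex \<Rightarrow> complex) \<Rightarrow> bool" where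
  "cusp_normal_coordinate S g \<epsilon> z \<longleftrightarrow>
     \<epsilon> > 0 \<and> complex_coordinate (ball 0 \<epsilon>) z \<and> z 0 = 0 \<and>
     metric_form S g (ball 0 \<epsilon> - {0}) z
       (\<lambda>w. norm (z w) powi (-2) * ln (norm (z w)) powi (-2))"

end

theory Submission
  imports Defs
begin

text \<open>
  Write the metric as \<open>e^(2u) |dw|^2\<close>, so that \<open>\<Delta>u = e^(2u)\<close>. Then \<open>q = u_zz - u_z^2\<close> is holomorphic and
  \<open>e^(-u)\<close> satisfies \<open>v_zz + q v = 0\<close>. On the universal cover of the punctured disc, realised as the
  left half plane via the exponential function, \<open>e^(-u)\<close> is a constant multiple of
  \<open>|y_2|^2 - |y_1|^2\<close> for two holomorphic solutions of this linear equation, and \<open>f = y_1 / y_2\<close> is a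
  developing map into the unit disc (Liouville). It is unique up to disc automorphisms, so
  \<open>f(\<zeta> + 2 \<pi> i) = M (f \<zeta>)\<close> for such an automorphism \<open>M\<close>. If \<open>M\<close> fixes a point of the open disc, moving
  that point to 0 makes \<open>f\<close> equal to \<open>w^\<beta>\<close> times a nonvanishing function of \<open>w\<close>, and its \<open>\<beta>\<close>-th root is the
  coordinate of a cone. Otherwise \<open>M\<close> fixes a boundary point and is affine in the half plane model: a
  translation gives the cusp coordinate as an exponential of \<open>f\<close>, and a dilation is impossible. No
  growth estimate on \<open>u\<close> is needed, because all functions in question are bounded and extend over
  the puncture.
\<close>

section \<open>The Liouville equation in Wirtinger form\<close>

text \<open>The function \<open>e^(-u)\<close> is annihilated by \<open>d_z^2 + q\<close> and, being
  real, also by the conjugate operator, so it is a Hermitian form in a basis of solutions. Curvature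
  -1 makes the signature (1,1), and the constant Wronskian gives \<open>f' = const / y_2^2\<close>,
  hence \<open>2 |f'| / (1 - |f|^2) = e^u\<close>. The obstacle is that neither the cone angle nor
  the kind of singularity can be fed into this construction. The monodromy alone decides which
  normal coordinate arises, and the given type is matched with it only afterwards, by a limit of the
  metric that separates all cone angles and the cusp. The two uniqueness questions, for developing
  maps up to automorphisms and for normal coordinates up to rotation, are one question: both concern
  coordinates in which the metric has the form \<open>(R(|z|) / |z|)^2 |dz|^2\<close> with a fixed
  increasing \<open>R\<close>. The linear equation is solved by power series, which converge on a
  whole disc; for this the half plane is mapped to the disc.\<close>

lemma second_difference_mean_value:
  fixes f :: "'a::real_normed_vector \<Rightarrow> real"
  assumes t: "t > 0"
    and sub: "\<And>s r. \<lbrakk>0 \<le> s; s \<le> t; 0 \<le> r; r \<le> t\<rbrakk> \<Longrightarrow> x + s *\<^sub>R v + r *\<^sub>R w \<in> S"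
    and f: "\<And>y. y \<in> S \<Longrightarrow> f differentiable (at y)"
    and A: "\<And>y. y \<in> S \<Longrightarrow> (\<lambda>y. frechet_derivative f (at y) v) differentiable (at y)"
  shows "\<exists>s r. 0 < s \<and> s < t \<and> 0 < r \<and> r < t \<and>
    f (x + t *\<^sub>R v + t *\<^sub>R w) - f (x + t *\<^sub>R v) - f (x + t *\<^sub>R w) + f x
      = t * t * frechet_derivative (\<lambda>y. frechet_derivative f (at y) v) (at (x + s *\<^sub>R v + r *\<^sub>R w)) w"
proof -
  let ?A = "\<lambda>y. frechet_derivative f (at y) v"
  have line: "((\<lambda>s. F (y + s *\<^sub>R d)) has_real_derivative frechet_derivative F (at (y + s *\<^sub>R d)) d) (at s)"
    if "F differentiable (at (y + s *\<^sub>R d))" for F :: "'a \<Rightarrow> real" and y d s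
  proof -
    have F: "(F has_derivative frechet_derivative F (at (y + s *\<^sub>R d))) (at (y + s *\<^sub>R d))"
      using that frechet_derivative_works by blast
    have "((\<lambda>s. y + s *\<^sub>R d) has_derivative (\<lambda>h. h *\<^sub>R d)) (at s)"
      by (auto intro!: derivative_eq_intros)
    from has_derivative_compose[OF this F]
    have "((\<lambda>s. F (y + s *\<^sub>R d)) has_derivative (\<lambda>h. frechet_derivative F (at (y + s *\<^sub>R d)) (h *\<^sub>R d))) (at s)" .
    moreover have "linear (frechet_derivative F (at (y + s *\<^sub>R d)))"
      using F has_derivative_linear by blast
    ultimately show ?thesis
      by (simp add: has_field_derivative_def linear_cmul mult_commute_abs)
  qed
  let ?\<phi> = "\<lambda>s. f (x + t *\<^sub>R w + s *\<^sub>R v) - f (x + s *\<^sub>R v)"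
  have "\<exists>s. 0 < s \<and> s < t \<and> ?\<phi> t - ?\<phi> 0 = (t - 0) * (?A (x + t *\<^sub>R w + s *\<^sub>R v) - ?A (x + s *\<^sub>R v))"
  proof (rule MVT2[OF t])
    fix s assume "0 \<le> s" "s \<le> t"
    then have "x + t *\<^sub>R w + s *\<^sub>R v \<in> S" "x + s *\<^sub>R v \<in> S"
      using sub[of s t] sub[of s 0] t by (auto simp: algebra_simps)
    then show "(?\<phi> has_real_derivative (?A (x + t *\<^sub>R w + s *\<^sub>R v) - ?A (x + s *\<^sub>R v))) (at s)"
      by (intro DERIV_diff line f)
  qed
  then obtain s where s: "0 < s" "s < t"
    and e1: "?\<phi> t - ?\<phi> 0 = t * (?A (x + t *\<^sub>R w + s *\<^sub>R v) - ?A (x + s *\<^sub>R v))" by auto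
  let ?\<psi> = "\<lambda>r. ?A (x + s *\<^sub>R v + r *\<^sub>R w)"
  have "\<exists>r. 0 < r \<and> r < t \<and> ?\<psi> t - ?\<psi> 0 = (t - 0) * (frechet_derivative ?A (at (x + s *\<^sub>R v + r *\<^sub>R w)) w)"
  proof (rule MVT2[OF t])
    fix r assume "0 \<le> r" "r \<le> t"
    then show "(?\<psi> has_real_derivative (frechet_derivative ?A (at (x + s *\<^sub>R v + r *\<^sub>R w)) w)) (at r)"
      using s sub[of s r] by (intro line A) auto
  qed
  then obtain r where r: "0 < r" "r < t"
    and e2: "?\<psi> t - ?\<psi> 0 = t * (frechet_derivative ?A (at (x + s *\<^sub>R v + r *\<^sub>R w)) w)" by auto
  show ?thesis
    using s r e1 e2 by (intro exI[of _ s] exI[of _ r]) (simp add: algebra_simps)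
qed

text \<open>The second difference of \<open>f\<close> over a small parallelogram is symmetric in
  \<open>v\<close> and \<open>w\<close>, and two applications of the mean value theorem express it
  by either mixed derivative at some point of the parallelogram. If the two disagreed at
  \<open>x\<close>, continuity would keep them apart near \<open>x\<close>.\<close>

lemma mixed_derivatives_commute:
  fixes f :: "'a::real_normed_vector \<Rightarrow> real"
  assumes S: "open S" "x \<in> S"
    and f: "\<And>y. y \<in> S \<Longrightarrow> f differentiable (at y)"
    and A: "\<And>v y. y \<in> S \<Longrightarrow> (\<lambda>y. frechet_derivative f (at y) v) differentiable (at y)"
    and C: "\<And>v w. continuous_on S (\<lambda>y. frechet_derivative (\<lambda>y. frechet_derivative f (at y) v) (at y) w)"
  shows "frechet_derivative (\<lambda>y. frechet_derivative f (at y) v) (at x) w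
       = frechet_derivative (\<lambda>y. frechet_derivative f (at y) w) (at x) v"
proof (rule ccontr)
  let ?A = "\<lambda>v w y. frechet_derivative (\<lambda>y. frechet_derivative f (at y) v) (at y) w"
  assume ne: "?A v w x \<noteq> ?A w v x"
  define e where "e = \<bar>?A v w x - ?A w v x\<bar> / 2"
  have e: "e > 0" using ne by (simp add: e_def)
  have cont: "isCont (?A v w) x" for v w
    using C[of v w] S continuous_on_eq_continuous_at by blast
  obtain d1 where d1: "d1 > 0" "\<And>y. dist y x < d1 \<Longrightarrow> dist (?A v w y) (?A v w x) < e"
    using cont[of v w] e unfolding continuous_at_eps_delta by (metis dist_norm)
  obtain d2 where d2: "d2 > 0" "\<And>y. dist y x < d2 \<Longrightarrow> dist (?A w v y) (?A w v x) < e"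
    using cont[of w v] e unfolding continuous_at_eps_delta by (metis dist_norm)
  obtain d3 where d3: "d3 > 0" "ball x d3 \<subseteq> S" using S open_contains_ball by blast
  define d where "d = min d1 (min d2 d3)"
  \<comment> \<open>The parallelogram with sides \<open>t v\<close> and \<open>t w\<close> then lies
    within distance \<open>d\<close> of \<open>x\<close>; the summand 1 covers
    \<open>v = w = 0\<close>.\<close>
  define t where "t = d / (2 * (norm v + norm w + 1))"
  have d: "d > 0" using d1 d2 d3 by (simp add: d_def)
  have t: "t > 0" using d by (simp add: t_def add_nonneg_pos)
  have near: "dist (x + s *\<^sub>R v' + r *\<^sub>R w') x < d"
    if "0 \<le> s" "s \<le> t" "0 \<le> r" "r \<le> t" "norm v' + norm w' = norm v + norm w" for s r v' w'
  proof -
    have "dist (x + s *\<^sub>R v' + r *\<^sub>R w') x = norm (s *\<^sub>R v' + r *\<^sub>R w')" by (simp add: dist_norm add.assoc)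
    also have "\<dots> \<le> s * norm v' + r * norm w'" 
      using norm_triangle_ineq[of "s *\<^sub>R v'" "r *\<^sub>R w'"] that by simp
    also have "\<dots> \<le> t * norm v' + t * norm w'"
      using that by (intro add_mono mult_right_mono) auto
    also have "\<dots> = t * (norm v + norm w)" using that(5) by (metis distrib_left)
    also have "\<dots> < t * (2 * (norm v + norm w + 1))"
      using t by (intro mult_strict_left_mono) (auto simp: add_nonneg_pos)
    also have "\<dots> = d"
      using add_nonneg_pos[of "norm v + norm w" 1] by (simp add: t_def field_simps)
    finally show ?thesis .
  qed
  have inS: "x + s *\<^sub>R v' + r *\<^sub>R w' \<in> S"
    if "0 \<le> s" "s \<le> t" "0 \<le> r" "r \<le> t" "norm v' + norm w' = norm v + norm w" for s r v' w'
    using near[OF that] d3 by (auto simp: d_def dist_commute subset_iff)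
  obtain s r where 1: "0 < s" "s < t" "0 < r" "r < t"
    "f (x + t *\<^sub>R v + t *\<^sub>R w) - f (x + t *\<^sub>R v) - f (x + t *\<^sub>R w) + f x = t * t * ?A v w (x + s *\<^sub>R v + r *\<^sub>R w)"
    using second_difference_mean_value[of t x v w S f, OF t inS f A] by auto
  obtain s' r' where 2: "0 < s'" "s' < t" "0 < r'" "r' < t"
    "f (x + t *\<^sub>R w + t *\<^sub>R v) - f (x + t *\<^sub>R w) - f (x + t *\<^sub>R v) + f x = t * t * ?A w v (x + s' *\<^sub>R w + r' *\<^sub>R v)"
    using second_difference_mean_value[of t x w v S f, OF t inS f A] by auto
  have "t * t * ?A v w (x + s *\<^sub>R v + r *\<^sub>R w) = t * t * ?A w v (x + s' *\<^sub>R w + r' *\<^sub>R v)"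
  proof -
    have "x + t *\<^sub>R v + t *\<^sub>R w = x + t *\<^sub>R w + t *\<^sub>R v" by (simp add: add_ac)
    then have "f (x + t *\<^sub>R v + t *\<^sub>R w) = f (x + t *\<^sub>R w + t *\<^sub>R v)" by (rule arg_cong)
    then show ?thesis using 1(5) 2(5) by linarith
  qed
  then have eq: "?A v w (x + s *\<^sub>R v + r *\<^sub>R w) = ?A w v (x + s' *\<^sub>R w + r' *\<^sub>R v)" using t by simp
  have "dist (?A v w (x + s *\<^sub>R v + r *\<^sub>R w)) (?A v w x) < e"
    using near[of s r v w] 1 by (intro d1(2)) (auto simp: d_def)
  moreover have "dist (?A w v (x + s' *\<^sub>R w + r' *\<^sub>R v)) (?A w v x) < e"
    using near[of s' r' w v] 2 by (intro d2(2)) (auto simp: d_def)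
  ultimately show False unfolding eq by (simp add: e_def dist_real_def field_simps abs_if split: if_splits)
qed

section \<open>Smooth functions and Wirtinger derivatives\<close>

lemma Cinf_on_differentiable: "Cinf_on S f \<Longrightarrow> x \<in> S \<Longrightarrow> f differentiable (at x)"
  unfolding Cinf_on_def by (metis Ck_on.simps(2))

lemma Cinf_on_continuous: "Cinf_on S f \<Longrightarrow> continuous_on S f"
  unfolding Cinf_on_def by (metis Ck_on.simps(1))

lemma Cinf_on_derivative: "Cinf_on S f \<Longrightarrow> Cinf_on S (\<lambda>x. frechet_derivative f (at x) v)"
  unfolding Cinf_on_def by (metis Ck_on.simps(2))

lemma Cinf_on_mixed_derivatives_commute:
  fixes f :: "'a::real_normed_vector \<Rightarrow> real"
  assumes "open S" "x \<in> S" "Cinf_on S f"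
  shows "frechet_derivative (\<lambda>y. frechet_derivative f (at y) v) (at x) w
       = frechet_derivative (\<lambda>y. frechet_derivative f (at y) w) (at x) v"
proof (rule mixed_derivatives_commute[OF assms(1,2)])
  show "f differentiable (at y)" if "y \<in> S" for y
    using that assms(3) by (rule Cinf_on_differentiable[rotated])
  show "(\<lambda>y. frechet_derivative f (at y) v) differentiable (at y)" if "y \<in> S" for y v
    using that assms(3) by (blast intro: Cinf_on_differentiable Cinf_on_derivative)
  show "continuous_on S (\<lambda>y. frechet_derivative (\<lambda>y. frechet_derivative f (at y) v) (at y) w)" for v w
    using assms(3) by (intro Cinf_on_continuous Cinf_on_derivative)
qed


lemma has_derivative_partials_complex:
  fixes f :: "complex \<Rightarrow> real"
  assumes "f differentiable (at x)"
  shows "(f has_derivative (\<lambda>v. frechet_derivative f (at x) 1 * Re v + frechet_derivative f (at x) \<i> * Im v)) (at x)"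
proof -
  have d: "(f has_derivative frechet_derivative f (at x)) (at x)"
    using assms frechet_derivative_works by blast
  then have l: "linear (frechet_derivative f (at x))" by (rule has_derivative_linear)
  have "frechet_derivative f (at x) v = frechet_derivative f (at x) 1 * Re v + frechet_derivative f (at x) \<i> * Im v" for v
  proof -
    have "v = Re v *\<^sub>R 1 + Im v *\<^sub>R \<i>" by (simp add: complex_eq_iff)
    then have "frechet_derivative f (at x) v = frechet_derivative f (at x) (Re v *\<^sub>R 1 + Im v *\<^sub>R \<i>)" by simp
    also have "\<dots> = Re v * frechet_derivative f (at x) 1 + Im v * frechet_derivative f (at x) \<i>"
      by (simp only: linear_add[OF l] linear_cmul[OF l] real_scaleR_def)
    finally show ?thesis by (simp add: mult.commute)
  qed
  then show ?thesis using d by (metis (no_types, lifting) has_derivative_eq_rhs ext)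
qed

lemma frechet_derivative_cong_open:
  assumes "open S" "x \<in> S" "\<And>y. y \<in> S \<Longrightarrow> f y = h y"
  shows "frechet_derivative f (at x) = frechet_derivative h (at x)"
proof -
  have "(f has_derivative D) (at x) \<longleftrightarrow> (h has_derivative D) (at x)" for D
    using assms has_derivative_transform_within_open[of f D x UNIV S h]
      has_derivative_transform_within_open[of h D x UNIV S f] by metis
  then show ?thesis by (simp add: frechet_derivative_def)
qed

text \<open>Here \<open>p\<close> is \<open>u_z\<close>, and its antiholomorphic derivative is
  \<open>\<Delta>u / 4 = e^(2u) / 4\<close>. The antiholomorphic derivative of \<open>q\<close> is
  therefore the \<open>z\<close>-derivative of \<open>e^(2u) / 4\<close> minus
  \<open>2 u_z e^(2u) / 4\<close>, and these two terms are equal.\<close>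

lemma liouville_equation_wirtinger:
  fixes u :: "complex \<Rightarrow> real"
  assumes S: "open S" and u: "Cinf_on S u"
    and L: "\<And>w. w \<in> S \<Longrightarrow> laplacian u w = exp (2 * u w)"
  obtains p q where
    "\<And>w. w \<in> S \<Longrightarrow> (u has_derivative (\<lambda>v. 2 * Re (p w * v))) (at w)"
    "\<And>w. w \<in> S \<Longrightarrow> (p has_derivative (\<lambda>v. (q w + (p w)\<^sup>2) * v + of_real (exp (2 * u w)) / 4 * cnj v)) (at w)"
    "q holomorphic_on S"
proof -
  define D where "D = (\<lambda>(f::complex\<Rightarrow>real) v x. frechet_derivative f (at x) v)"
  have D: "(f has_derivative (\<lambda>v. D f 1 w * Re v + D f \<i> w * Im v)) (at w)" if "Cinf_on S f" "w \<in> S" for f w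
    unfolding D_def by (rule has_derivative_partials_complex[OF Cinf_on_differentiable[OF that]])
  have C: "Cinf_on S (D f v)" if "Cinf_on S f" for f v
    using Cinf_on_derivative[OF that] by (simp add: D_def)
  have comm: "D (D f v) v' w = D (D f v') v w" if "Cinf_on S f" "w \<in> S" for f v v' w
    using Cinf_on_mixed_derivatives_commute[OF S that(2,1)] by (simp add: D_def)
  have Deq: "D f v w = D h v w" if "w \<in> S" "\<And>y. y \<in> S \<Longrightarrow> f y = h y" for f h v w
    using frechet_derivative_cong_open[OF S that] by (simp add: D_def)
  define a where "a = D u 1"
  define b where "b = D u \<i>"
  have Ca: "Cinf_on S a" and Cb: "Cinf_on S b" using C u by (auto simp: a_def b_def)
  define p where "p = (\<lambda>w. (complex_of_real (a w) - \<i> * of_real (b w)) / 2)"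
  define q where "q = (\<lambda>w. (of_real (D a 1 w) - of_real (D b \<i> w) - 2 * \<i> * of_real (D a \<i> w)) / 4 - (p w)\<^sup>2)"
  have ba: "D b 1 w = D a \<i> w" if "w \<in> S" for w
    unfolding a_def b_def using comm[OF u that] by simp
  have lap: "D a 1 w + D b \<i> w = exp (2 * u w)" if "w \<in> S" for w
    using L[OF that] unfolding laplacian_def a_def b_def D_def
    by (simp add: Basis_complex_def)
  have du: "(u has_derivative (\<lambda>v. 2 * Re (p w * v))) (at w)" if "w \<in> S" for w
    using D[OF u that] by (simp add: p_def a_def b_def add_divide_distrib)
  have dp0: "(p has_derivative (\<lambda>v. (of_real (D a 1 w * Re v + D a \<i> w * Im v) - \<i> * of_real (D b 1 w * Re v + D b \<i> w * Im v))/2)) (at w)"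
    if "w \<in> S" for w
    unfolding p_def using D[OF Ca that] D[OF Cb that]
    by (auto intro!: derivative_eq_intros)
  have dp: "(p has_derivative (\<lambda>v. (q w + (p w)\<^sup>2) * v + of_real (exp (2 * u w)) / 4 * cnj v)) (at w)" if "w \<in> S" for w
    unfolding lap[OF that, symmetric] by (rule has_derivative_eq_rhs[OF dp0[OF that]])
      (auto simp: fun_eq_iff complex_eq_iff q_def ba[OF that] field_simps)
  have "q field_differentiable (at w)" if w: "w \<in> S" for w
  proof -
    let ?a1 = "D a 1" and ?a2 = "D a \<i>" and ?b2 = "D b \<i>"
    have 1: "D ?a1 \<i> w = D ?a2 1 w" using comm[OF Ca w] by simp
    have "D ?b2 1 w = D (D b 1) \<i> w" using comm[OF Cb w] by simp
    also have "\<dots> = D ?a2 \<i> w" by (rule Deq[OF w]) (rule ba)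
    finally have 2: "D ?b2 1 w = D ?a2 \<i> w" .
    \<comment> \<open>Differentiating the Liouville equation itself and comparing in the directions
      1 and \<open>\<i>\<close> eliminates two third derivatives of \<open>u\<close>; the facts
      \<open>1\<close> and \<open>2\<close> are the symmetry of the others.\<close>
    have E: "((\<lambda>w. D a 1 w + D b \<i> w) has_derivative (\<lambda>v. exp (2 * u w) * (2 * (2 * Re (p w * v))))) (at w)"
      apply (rule has_derivative_transform_within_open[OF _ S w, of "\<lambda>w. exp (2 * u w)"])
      using du[OF w] lap by (auto intro!: derivative_eq_intros)
    moreover have "((\<lambda>w. D a 1 w + D b \<i> w) has_derivative
        (\<lambda>v. (D ?a1 1 w * Re v + D ?a1 \<i> w * Im v) + (D ?b2 1 w * Re v + D ?b2 \<i> w * Im v))) (at w)"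
      by (intro has_derivative_add D C Ca Cb w)
    ultimately have "(\<lambda>v. exp (2 * u w) * (2 * (2 * Re (p w * v)))) =
       (\<lambda>v. (D ?a1 1 w * Re v + D ?a1 \<i> w * Im v) + (D ?b2 1 w * Re v + D ?b2 \<i> w * Im v))"
      by (rule has_derivative_unique)
    from fun_cong[OF this, of 1] fun_cong[OF this, of \<i>]
    have 3: "D ?a1 1 w = 2 * a w * exp (2 * u w) - D ?b2 1 w"
      and 4: "D ?b2 \<i> w = 2 * b w * exp (2 * u w) - D ?a1 \<i> w"
      by (auto simp: p_def algebra_simps)
    define P where "P = q w + (p w)\<^sup>2"
    define X where "X = exp (2 * u w)"
    \<comment> \<open>\<open>c\<close> is the derivative of \<open>q\<close> in the direction 1. The
      relations \<open>1\<close> to \<open>4\<close> say that the direction \<open>\<i>\<close>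
      gives \<open>\<i> * c\<close>, which are the Cauchy-Riemann equations.\<close>
    define c where "c = (of_real (D ?a1 1 w) - of_real (D ?b2 1 w) - 2 * \<i> * of_real (D ?a2 1 w)) / 4 - 2 * p w * (P + of_real X / 4)"
    have "(p has_derivative (\<lambda>v. P * v + of_real X / 4 * cnj v)) (at w)"
      using dp[OF w] by (simp add: P_def X_def)
    then have dpp: "((\<lambda>w. (p w)\<^sup>2) has_derivative (\<lambda>v. 2 * p w * (P * v + of_real X / 4 * cnj v))) (at w)"
      by (auto intro!: derivative_eq_intros simp: mult.commute mult.left_commute)
    have "((\<lambda>w. (of_real (?a1 w) - of_real (?b2 w) - 2 * \<i> * of_real (?a2 w)) / 4) has_derivative
      (\<lambda>v. (of_real (D ?a1 1 w * Re v + D ?a1 \<i> w * Im v) - of_real (D ?b2 1 w * Re v + D ?b2 \<i> w * Im v)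
        - 2 * \<i> * of_real (D ?a2 1 w * Re v + D ?a2 \<i> w * Im v)) / 4)) (at w)"
      by (intro bounded_linear.has_derivative[OF bounded_linear_divide] has_derivative_diff
          has_derivative_mult_right has_derivative_of_real D C Ca Cb w)
    from has_derivative_diff[OF this dpp]
    have "(q has_derivative (\<lambda>v. (of_real (D ?a1 1 w * Re v + D ?a1 \<i> w * Im v) - of_real (D ?b2 1 w * Re v + D ?b2 \<i> w * Im v)
        - 2 * \<i> * of_real (D ?a2 1 w * Re v + D ?a2 \<i> w * Im v)) / 4
        - 2 * p w * (P * v + of_real X / 4 * cnj v))) (at w)"
      by (simp only: q_def)
    then have "(q has_derivative (\<lambda>v. c * v)) (at w)"
      by (rule has_derivative_eq_rhs)
        (auto simp: fun_eq_iff complex_eq_iff c_def 1 2 3[folded X_def] 4[folded X_def] p_def field_simps)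
    then show ?thesis unfolding field_differentiable_def has_field_derivative_def by metis
  qed
  then have "q holomorphic_on S"
    by (simp add: S field_differentiable_at_within holomorphic_on_def)
  with du dp show ?thesis by (rule that)
qed

section \<open>Linear systems with holomorphic coefficients\<close>

text \<open>Taylor coefficients of the pair solving \<open>y' = A s\<close>, \<open>s' = B y\<close>
  with \<open>y 0 = c\<close>, \<open>s 0 = d\<close>; the recursion is the comparison of
  coefficients.\<close>

fun linear_system_coeffs :: "complex fps \<Rightarrow> complex fps \<Rightarrow> complex \<Rightarrow> complex \<Rightarrow> nat \<Rightarrow> complex \<times> complex" where
  "linear_system_coeffs A B c d 0 = (c, d)"
| "linear_system_coeffs A B c d (Suc n) =
     ((\<Sum>k\<le>n. fps_nth A k * snd (linear_system_coeffs A B c d (n - k))) / of_nat (Suc n),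
      (\<Sum>k\<le>n. fps_nth B k * fst (linear_system_coeffs A B c d (n - k))) / of_nat (Suc n))"

text \<open>Convolution with the coefficients of \<open>A\<close> or \<open>B\<close>, weighted by
  \<open>r ^ k\<close>, multiplies a bound by at most \<open>K\<close>, while the recursion divides
  by \<open>n + 1\<close>. Once \<open>n + 1\<close> exceeds \<open>K\<close>, a bound on the
  earlier coefficients is inherited; the finitely many initial ones are absorbed into
  \<open>C\<close>.\<close>

lemma linear_system_coeffs_bound:
  assumes A: "fps_conv_radius A \<ge> 1" and B: "fps_conv_radius B \<ge> 1" and r: "0 < r" "r < 1"
  obtains C where "\<And>n. norm (fst (linear_system_coeffs A B c d n)) * r ^ n \<le> C"
    "\<And>n. norm (snd (linear_system_coeffs A B c d n)) * r ^ n \<le> C"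
proof -
  let ?Y = "linear_system_coeffs A B c d"
  have sm: "summable (\<lambda>n. norm (fps_nth F n) * r ^ n)" if "fps_conv_radius F \<ge> 1" for F :: "complex fps"
  proof -
    have "ereal (norm (of_real r :: complex)) < 1" using r by simp
    with that have "ereal (norm (of_real r :: complex)) < fps_conv_radius F" by (rule less_le_trans[rotated])
    from norm_summable_fps[OF this] show ?thesis
      using r by (simp add: norm_mult norm_power)
  qed
  define K where "K = max (\<Sum>n. norm (fps_nth A n) * r ^ n) (\<Sum>n. norm (fps_nth B n) * r ^ n)"
  have KA: "(\<Sum>k\<le>n. norm (fps_nth A k) * r ^ k) \<le> K" and KB: "(\<Sum>k\<le>n. norm (fps_nth B k) * r ^ k) \<le> K" for n
    using sum_le_suminf[OF sm[OF A], of "{..n}"] sum_le_suminf[OF sm[OF B], of "{..n}"] r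
    by (auto simp: K_def)
  obtain N where N: "K \<le> real N" using real_arch_simple by blast
  define C where "C = (\<Sum>n\<le>N. (norm (fst (?Y n)) + norm (snd (?Y n))) * r ^ n)"
  have C0: "C \<ge> 0" unfolding C_def using r by (intro sum_nonneg) auto
  have step: "norm ((\<Sum>k\<le>n. fps_nth F k * S (n - k)) / of_nat (Suc n)) * r ^ Suc n \<le> C"
    if F: "(\<Sum>k\<le>n. norm (fps_nth F k) * r ^ k) \<le> K" and S: "\<And>k. k \<le> n \<Longrightarrow> norm (S k) * r ^ k \<le> C" and n: "Suc n > N"
    for F :: "complex fps" and S :: "nat \<Rightarrow> complex" and n
  proof -
    have "norm (\<Sum>k\<le>n. fps_nth F k * S (n - k)) * r ^ n \<le> (\<Sum>k\<le>n. norm (fps_nth F k * S (n - k))) * r ^ n"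
      using r by (intro mult_right_mono norm_sum) auto
    also have "\<dots> = (\<Sum>k\<le>n. (norm (fps_nth F k) * r ^ k) * (norm (S (n - k)) * r ^ (n - k)))"
      unfolding sum_distrib_right
    proof (intro sum.cong refl)
      fix k assume "k \<in> {..n}"
      then have "r ^ n = r ^ k * r ^ (n - k)" by (simp flip: power_add)
      then show "norm (fps_nth F k * S (n - k)) * r ^ n = (norm (fps_nth F k) * r ^ k) * (norm (S (n - k)) * r ^ (n - k))"
        by (simp add: norm_mult)
    qed
    also have "\<dots> \<le> (\<Sum>k\<le>n. (norm (fps_nth F k) * r ^ k) * C)"
      using r S by (intro sum_mono mult_left_mono) auto
    also have "\<dots> \<le> K * C"
      unfolding sum_distrib_right[symmetric] using F C0 by (intro mult_right_mono) auto
    also have "\<dots> \<le> real (Suc n) * C" using N n C0 by (intro mult_right_mono) auto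
    finally have 1: "norm (\<Sum>k\<le>n. fps_nth F k * S (n - k)) * r ^ n \<le> real (Suc n) * C" .
    have "norm (\<Sum>k\<le>n. fps_nth F k * S (n - k)) * r ^ Suc n \<le> norm (\<Sum>k\<le>n. fps_nth F k * S (n - k)) * r ^ n"
      using r by (intro mult_left_mono power_decreasing) auto
    with 1 have "norm (\<Sum>k\<le>n. fps_nth F k * S (n - k)) * r ^ Suc n \<le> real (Suc n) * C" by linarith
    then show ?thesis by (simp only: norm_divide norm_of_nat) (simp add: field_simps)
  qed
  have "norm (fst (?Y n)) * r ^ n \<le> C \<and> norm (snd (?Y n)) * r ^ n \<le> C" for n
  proof (induction n rule: less_induct)
    case (less n)
    show ?case
    proof (cases "n \<le> N")
      case True
      then have "(norm (fst (?Y n)) + norm (snd (?Y n))) * r ^ n \<le> C"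
        unfolding C_def using r by (intro member_le_sum) auto
      moreover have "norm (fst (?Y n)) * r ^ n \<ge> 0" "norm (snd (?Y n)) * r ^ n \<ge> 0" using r by auto
      ultimately show ?thesis by (simp add: distrib_right)
    next
      case False
      then obtain m where m: "n = Suc m" by (cases n) auto
      have IH: "norm (fst (?Y k)) * r ^ k \<le> C" "norm (snd (?Y k)) * r ^ k \<le> C" if "k \<le> m" for k
        using less[of k] that m by auto
      show ?thesis
        unfolding m linear_system_coeffs.simps fst_conv snd_conv
        using step[where F = A and n = m and S = "\<lambda>k. snd (?Y k)", OF KA IH(2)]
          step[where F = B and n = m and S = "\<lambda>k. fst (?Y k)", OF KB IH(1)] False m
        by auto
    qed
  qed
  then show ?thesis using that by blast
qed

text \<open>Boundedness at a radius \<open>t\<close> strictly between \<open>r\<close> and 1 gives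
  summability at \<open>r\<close>, by comparison with the geometric series of ratio
  \<open>r / t\<close>.\<close>

lemma fps_conv_radius_ge_1_of_bounded:
  assumes "\<And>r::real. 0 < r \<Longrightarrow> r < 1 \<Longrightarrow> \<exists>C. \<forall>n. norm (fps_nth F n) * r ^ n \<le> C"
  shows "fps_conv_radius (F :: complex fps) \<ge> 1"
  unfolding fps_conv_radius_def
proof (rule conv_radius_geI_ex')
  fix r :: real assume r: "0 < r" "ereal r < 1"
  define t where "t = (r + 1) / 2"
  have t: "r < t" "t < 1" using r by (auto simp: t_def)
  obtain C where C: "\<And>n. norm (fps_nth F n) * t ^ n \<le> C" using assms[of t] r t by auto
  show "summable (\<lambda>n. fps_nth F n * of_real r ^ n)"
  proof (rule summable_comparison_test')
    show "summable (\<lambda>n. C * (r / t) ^ n)" using r t by (intro summable_mult summable_geometric) auto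
    fix n
    have "norm (fps_nth F n * of_real r ^ n) = (norm (fps_nth F n) * t ^ n) * (r / t) ^ n"
      using r t by (simp add: norm_mult norm_power power_divide)
    also have "\<dots> \<le> C * (r / t) ^ n" using C r t by (intro mult_right_mono) auto
    finally show "norm (fps_nth F n * of_real r ^ n) \<le> C * (r / t) ^ n" .
  qed
qed

text \<open>The formal solution converges on the whole disc where the coefficients are holomorphic,
  so a global solution arises at once, without continuation along paths.\<close>

lemma linear_system_on_disc:
  assumes a: "a holomorphic_on ball 0 1" and b: "b holomorphic_on ball 0 1"
  obtains y s where "y 0 = c" "s 0 = d"
    "\<And>z. z \<in> ball 0 1 \<Longrightarrow> (y has_field_derivative a z * s z) (at z)"
    "\<And>z. z \<in> ball 0 1 \<Longrightarrow> (s has_field_derivative b z * y z) (at z)"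
proof -
  define A where "A = fps_expansion a 0"
  define B where "B = fps_expansion b 0"
  have eb: "eball 0 1 = (ball 0 1 :: complex set)" by (auto simp: in_eball_iff one_ereal_def)
  have A: "fps_conv_radius A \<ge> 1" "\<And>z. norm z < 1 \<Longrightarrow> eval_fps A z = a z"
    using conv_radius_fps_expansion[of a 0 1] eval_fps_expansion'[of a 0 1] a unfolding eb A_def by auto
  have B: "fps_conv_radius B \<ge> 1" "\<And>z. norm z < 1 \<Longrightarrow> eval_fps B z = b z"
    using conv_radius_fps_expansion[of b 0 1] eval_fps_expansion'[of b 0 1] b unfolding eb B_def by auto
  let ?c = "linear_system_coeffs A B c d"
  define Y where "Y = Abs_fps (\<lambda>n. fst (?c n))"
  define S where "S = Abs_fps (\<lambda>n. snd (?c n))"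
  have Y: "fps_conv_radius Y \<ge> 1" 
    by (rule fps_conv_radius_ge_1_of_bounded, rule linear_system_coeffs_bound[OF A(1) B(1)]) (auto simp: Y_def)
  have S: "fps_conv_radius S \<ge> 1" 
    by (rule fps_conv_radius_ge_1_of_bounded, rule linear_system_coeffs_bound[OF A(1) B(1)]) (auto simp: S_def)
  have dY: "fps_deriv Y = A * S" and dS: "fps_deriv S = B * Y"
    by (simp_all add: fps_eq_iff Y_def S_def fps_mult_nth atLeast0AtMost del: of_nat_Suc)
  show ?thesis
  proof
    show "eval_fps Y 0 = c" "eval_fps S 0 = d" by (simp_all add: eval_fps_at_0 Y_def S_def)
    fix z :: complex assume z: "z \<in> ball 0 1"
    then have lt: "ereal (norm z) < 1" by simp
    have lts: "ereal (norm z) < fps_conv_radius F" if "fps_conv_radius F \<ge> 1" for F :: "complex fps"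
      using lt that by (rule less_le_trans)
    show "(eval_fps Y has_field_derivative a z * eval_fps S z) (at z)"
      using has_field_derivative_eval_fps[OF lts[OF Y]] A(2) z
      by (simp add: dY eval_fps_mult lts A S)
    show "(eval_fps S has_field_derivative b z * eval_fps Y z) (at z)"
      using has_field_derivative_eval_fps[OF lts[OF S]] B(2) z
      by (simp add: dS eval_fps_mult lts B Y)
  qed
qed

section \<open>Transport from the disc to the half plane\<close>

lemma disc_half_plane_involution:
  assumes "z = (\<zeta> + 1) / (\<zeta> - 1)"
  shows "Re \<zeta> < 0 \<Longrightarrow> norm z < 1" and "\<zeta> \<noteq> 1 \<Longrightarrow> (z + 1) / (z - 1) = \<zeta>"
    and "norm \<zeta> < 1 \<Longrightarrow> Re z < 0"
proof -
  show "norm z < 1" if "Re \<zeta> < 0"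
  proof -
    have "(norm (\<zeta> + 1))\<^sup>2 < (norm (\<zeta> - 1))\<^sup>2" using that
      unfolding cmod_power2 by (simp add: power2_eq_square algebra_simps)
    then have "norm (\<zeta> + 1) < norm (\<zeta> - 1)" by (rule power2_less_imp_less) simp
    moreover have "0 < norm (\<zeta> - 1)" using calculation norm_ge_zero by (rule le_less_trans[rotated])
    ultimately show ?thesis by (simp add: assms norm_divide)
  qed
  show "(z + 1) / (z - 1) = \<zeta>" if "\<zeta> \<noteq> 1"
    using that by (simp add: assms divide_simps)
  show "Re z < 0" if "norm \<zeta> < 1"
  proof -
    have "(Re \<zeta>)\<^sup>2 + (Im \<zeta>)\<^sup>2 < 1" using that by (simp add: cmod_def)
    moreover have "\<zeta> \<noteq> 1" using that by auto
    then have "(Re \<zeta> - 1)\<^sup>2 + (Im \<zeta>)\<^sup>2 > 0"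
      by (simp add: complex_eq_iff sum_power2_gt_zero_iff)
    ultimately show ?thesis
      by (simp add: assms Re_divide divide_less_0_iff power2_eq_square algebra_simps)
  qed
qed

text \<open>The system is pulled back by the Cayley map \<open>\<kappa>\<close>, which takes the
  base point -1 to 0. The chain rule factor is absorbed into the coefficients and cancels on the way
  back because \<open>\<kappa>\<close> is an involution.\<close>

lemma linear_system_on_half_plane:
  assumes a: "a holomorphic_on {\<zeta>. Re \<zeta> < 0}" and b: "b holomorphic_on {\<zeta>. Re \<zeta> < 0}"
  obtains y s where "y (-1) = c" "s (-1) = d"
    "\<And>\<zeta>. Re \<zeta> < 0 \<Longrightarrow> (y has_field_derivative a \<zeta> * s \<zeta>) (at \<zeta>)"
    "\<And>\<zeta>. Re \<zeta> < 0 \<Longrightarrow> (s has_field_derivative b \<zeta> * y \<zeta>) (at \<zeta>)"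
proof -
  define \<kappa> where "\<kappa> = (\<lambda>\<zeta>::complex. (\<zeta> + 1) / (\<zeta> - 1))"
  have \<kappa>: "Re \<zeta> < 0 \<Longrightarrow> norm (\<kappa> \<zeta>) < 1" "\<zeta> \<noteq> 1 \<Longrightarrow> \<kappa> (\<kappa> \<zeta>) = \<zeta>" "norm \<zeta> < 1 \<Longrightarrow> Re (\<kappa> \<zeta>) < 0" for \<zeta>
    using disc_half_plane_involution[of "\<kappa> \<zeta>" \<zeta>] by (auto simp: \<kappa>_def)
  define \<kappa>' where "\<kappa>' = (\<lambda>\<zeta>::complex. - 2 / (\<zeta> - 1)\<^sup>2)"
  have d\<kappa>: "(\<kappa> has_field_derivative \<kappa>' \<zeta>) (at \<zeta>)" if "\<zeta> \<noteq> 1" for \<zeta>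
    unfolding \<kappa>_def \<kappa>'_def using that
    by (auto intro!: derivative_eq_intros simp: power2_eq_square divide_simps)
  have \<kappa>\<kappa>: "\<kappa>' (\<kappa> \<zeta>) * \<kappa>' \<zeta> = 1" if "\<zeta> \<noteq> 1" for \<zeta>
  proof -
    have "\<kappa> \<zeta> - 1 = 2 / (\<zeta> - 1)" using that by (simp add: \<kappa>_def divide_simps)
    then show ?thesis using that by (simp add: \<kappa>'_def power2_eq_square)
  qed
  have hol: "(\<lambda>z. h (\<kappa> z) * \<kappa>' z) holomorphic_on ball 0 1" if "h holomorphic_on {\<zeta>. Re \<zeta> < 0}" for h
  proof -
    have "\<kappa> holomorphic_on ball 0 1" "\<kappa>' holomorphic_on ball 0 1"
      unfolding \<kappa>_def \<kappa>'_def by (auto intro!: holomorphic_intros)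
    moreover have "(h \<circ> \<kappa>) holomorphic_on ball 0 1"
      by (rule holomorphic_on_compose_gen[OF _ that]) (use calculation \<kappa>(3) in auto)
    ultimately show ?thesis by (auto intro!: holomorphic_intros simp: o_def)
  qed
  obtain y s where ys: "y 0 = c" "s 0 = d"
    "\<And>z. z \<in> ball 0 1 \<Longrightarrow> (y has_field_derivative a (\<kappa> z) * \<kappa>' z * s z) (at z)"
    "\<And>z. z \<in> ball 0 1 \<Longrightarrow> (s has_field_derivative b (\<kappa> z) * \<kappa>' z * y z) (at z)"
    using linear_system_on_disc[OF hol[OF a] hol[OF b]] by metis
  show ?thesis
  proof
    show "(y \<circ> \<kappa>) (-1) = c" "(s \<circ> \<kappa>) (-1) = d" using ys by (simp_all add: \<kappa>_def)
    fix \<zeta> :: complex assume \<zeta>: "Re \<zeta> < 0"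
    then have n1: "\<zeta> \<noteq> 1" by auto
    have cancel: "X * \<kappa>' (\<kappa> \<zeta>) * t * \<kappa>' \<zeta> = X * t" for X t
    proof -
      have "X * \<kappa>' (\<kappa> \<zeta>) * t * \<kappa>' \<zeta> = X * t * (\<kappa>' (\<kappa> \<zeta>) * \<kappa>' \<zeta>)" by (simp only: mult_ac)
      then show ?thesis by (simp add: \<kappa>\<kappa>[OF n1])
    qed
    show "(y \<circ> \<kappa> has_field_derivative a \<zeta> * (s \<circ> \<kappa>) \<zeta>) (at \<zeta>)"
      using DERIV_chain[OF ys(3)[of "\<kappa> \<zeta>"] d\<kappa>[OF n1]] \<kappa>(1)[OF \<zeta>]
      by (simp add: \<kappa>(2)[OF n1] cancel)
    show "(s \<circ> \<kappa> has_field_derivative b \<zeta> * (y \<circ> \<kappa>) \<zeta>) (at \<zeta>)"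
      using DERIV_chain[OF ys(4)[of "\<kappa> \<zeta>"] d\<kappa>[OF n1]] \<kappa>(1)[OF \<zeta>]
      by (simp add: \<kappa>(2)[OF n1] cancel)
  qed
qed

section \<open>The developing map\<close>

text \<open>
  If \<open>y\<close> is a holomorphic solution of \<open>y'' + q y = 0\<close>, then the \<open>\<partial>\<close>-Wronskian of \<open>e^(-u)\<close> and \<open>y\<close> is
  antiholomorphic, and its conjugate is again a solution. The equation is written as the first order
  system \<open>y' = s\<close>, \<open>s' = - q y\<close> and pulled back along the exponential function.
\<close>

lemma conjugate_solution:
  fixes u :: "complex \<Rightarrow> real" and p q y s :: "complex \<Rightarrow> complex"
  defines "B \<equiv> \<lambda>\<zeta>. - cnj (of_real (exp (- u (exp \<zeta>))) * (p (exp \<zeta>) * y \<zeta> + s \<zeta>))"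
  defines "C \<equiv> \<lambda>\<zeta>. - p (exp \<zeta>) * B \<zeta> - of_real (exp (u (exp \<zeta>))) / 4 * cnj (y \<zeta>)"
  assumes u: "(u has_derivative (\<lambda>v. 2 * Re (p (exp \<zeta>) * v))) (at (exp \<zeta>))"
    and p: "(p has_derivative (\<lambda>v. (q (exp \<zeta>) + (p (exp \<zeta>))\<^sup>2) * v + of_real (exp (2 * u (exp \<zeta>))) / 4 * cnj v)) (at (exp \<zeta>))"
    and y: "(y has_field_derivative exp \<zeta> * s \<zeta>) (at \<zeta>)"
    and s: "(s has_field_derivative (- q (exp \<zeta>) * exp \<zeta>) * y \<zeta>) (at \<zeta>)"
  shows "(B has_field_derivative exp \<zeta> * C \<zeta>) (at \<zeta>)"
    and "(C has_field_derivative (- q (exp \<zeta>) * exp \<zeta>) * B \<zeta>) (at \<zeta>)"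
proof -
  define T where "T = (\<lambda>\<zeta>. complex_of_real (exp (u (exp \<zeta>))))"
  define P where "P = (\<lambda>\<zeta>. p (exp \<zeta>))"
  define N where "N = (\<lambda>\<zeta>. P \<zeta> * y \<zeta> + s \<zeta>)"
  define e where "e = exp \<zeta>"
  define Q where "Q = q e"
  have T0: "T \<zeta> \<noteq> 0" for \<zeta> by (simp add: T_def)
  have cT: "cnj (T \<zeta>) = T \<zeta>" for \<zeta> by (simp add: T_def)
  have V: "complex_of_real (exp (- u (exp \<zeta>))) = inverse (T \<zeta>)" for \<zeta> by (simp add: T_def exp_minus)
  have X: "complex_of_real (exp (2 * u (exp \<zeta>))) = T \<zeta> * T \<zeta>"
    by (simp add: T_def exp_add[symmetric] flip: of_real_mult)
  have B_eq: "B = (\<lambda>\<zeta>. - cnj (N \<zeta> / T \<zeta>))"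
    by (auto simp: fun_eq_iff B_def V N_def P_def divide_inverse mult.commute)
  have C_eq: "C = (\<lambda>\<zeta>. - P \<zeta> * B \<zeta> - T \<zeta> / 4 * cnj (y \<zeta>))"
    by (simp add: C_def P_def T_def)
  have de: "(exp has_derivative (\<lambda>v. e * v)) (at \<zeta>)"
    using DERIV_exp[of \<zeta>] by (simp add: has_field_derivative_def e_def)
  have dy: "(y has_derivative (\<lambda>v. e * s \<zeta> * v)) (at \<zeta>)"
    and ds: "(s has_derivative (\<lambda>v. (- Q * e) * y \<zeta> * v)) (at \<zeta>)"
    using y s by (simp_all only: has_field_derivative_def e_def Q_def)
  have dU: "((\<lambda>\<zeta>. u (exp \<zeta>)) has_derivative (\<lambda>v. 2 * Re (P \<zeta> * (e * v)))) (at \<zeta>)"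
    using has_derivative_compose[OF de u] by (simp add: P_def)
  have dP: "(P has_derivative (\<lambda>v. (Q + P \<zeta> * P \<zeta>) * (e * v) + T \<zeta> * T \<zeta> / 4 * cnj (e * v))) (at \<zeta>)"
    using has_derivative_compose[OF de p] unfolding X by (simp add: P_def[abs_def] Q_def e_def power2_eq_square)
  have "((\<lambda>\<zeta>. exp (u (exp \<zeta>))) has_derivative (\<lambda>v. exp (u (exp \<zeta>)) * (2 * Re (P \<zeta> * (e * v))))) (at \<zeta>)"
    by (rule has_derivative_eq_rhs[OF has_derivative_exp[OF dU]]) (simp add: mult.commute)
  from has_derivative_of_real[OF this]
  have dT: "(T has_derivative (\<lambda>v. T \<zeta> * (P \<zeta> * (e * v) + cnj (P \<zeta> * (e * v))))) (at \<zeta>)"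
    unfolding T_def by (rule has_derivative_eq_rhs) (simp only: complex_add_cnj of_real_mult)
  \<comment> \<open>The complex linear part of this differential is
    \<open>P \<zeta> * (e * v)\<close> times \<open>N\<close>, with the same factor as in the
    complex linear part of \<open>dT / T\<close>. In \<open>N / T\<close> these parts cancel and
    only \<open>cnj v\<close> is left, so the conjugate \<open>B\<close> is holomorphic.\<close>
  have dN: "(N has_derivative (\<lambda>v. P \<zeta> * (e * v) * N \<zeta> + T \<zeta> * T \<zeta> / 4 * cnj (e * v) * y \<zeta>)) (at \<zeta>)"
    unfolding N_def
    by (rule has_derivative_eq_rhs[OF has_derivative_add[OF has_derivative_mult[OF dP dy] ds]])
      (simp add: fun_eq_iff algebra_simps)
  have dB: "(B has_derivative (\<lambda>v. e * C \<zeta> * v)) (at \<zeta>)"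
    unfolding B_eq
    apply (rule has_derivative_eq_rhs[OF has_derivative_minus[OF has_derivative_cnj[OF has_derivative_divide'[OF dN dT T0]]]])
    using T0[of \<zeta>] by (simp add: fun_eq_iff C_eq B_eq cT divide_simps) (simp add: algebra_simps)
  \<comment> \<open>The antilinear terms cancel because \<open>B\<close> is
    \<open>- cnj (N / T)\<close>.\<close>
  have "(C has_derivative (\<lambda>v. (- Q * e) * B \<zeta> * v)) (at \<zeta>)"
    unfolding C_eq
    apply (rule has_derivative_eq_rhs[OF has_derivative_diff[OF has_derivative_mult[OF has_derivative_minus[OF dP] dB]
          has_derivative_mult[OF bounded_linear.has_derivative[OF bounded_linear_divide dT] has_derivative_cnj[OF dy]]]])
    using T0[of \<zeta>] by (simp add: fun_eq_iff C_eq B_eq N_def cT divide_simps) (simp add: algebra_simps)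
  then show "(C has_field_derivative (- q (exp \<zeta>) * exp \<zeta>) * B \<zeta>) (at \<zeta>)"
    by (simp only: has_field_derivative_def e_def Q_def)
  show "(B has_field_derivative exp \<zeta> * C \<zeta>) (at \<zeta>)"
    using dB by (simp add: has_field_derivative_def e_def)
qed

text \<open>The matrix of the system, with rows \<open>(0, a)\<close> and \<open>(b, 0)\<close>, has
  trace zero, so the determinant formed by two solutions has derivative zero.\<close>

lemma wronskian_constant:
  assumes S: "convex S" "z0 \<in> S" "z \<in> S"
    and "\<And>z. z \<in> S \<Longrightarrow> (y has_field_derivative a z * s z) (at z)"
    and "\<And>z. z \<in> S \<Longrightarrow> (s has_field_derivative b z * y z) (at z)"
    and "\<And>z. z \<in> S \<Longrightarrow> (Y has_field_derivative a z * T z) (at z)"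
    and "\<And>z. z \<in> S \<Longrightarrow> (T has_field_derivative b z * Y z) (at z)"
  shows "y z * T z - s z * Y z = y z0 * T z0 - s z0 * Y (z0::complex)"
proof -
  have "((\<lambda>z. y z * T z - s z * Y z) has_field_derivative 0) (at z within S)" if "z \<in> S" for z
    by (rule has_field_derivative_at_within, rule DERIV_cong,
        rule DERIV_diff[OF DERIV_mult[OF assms(4,7)] DERIV_mult[OF assms(5,6)]])
      (use that in \<open>simp_all add: algebra_simps\<close>)
  then have "\<exists>c. \<forall>z\<in>S. y z * T z - s z * Y z = c"
    by (rule has_field_derivative_zero_constant[OF S(1)])
  then show ?thesis using S by force
qed

text \<open>
  The metric \<open>\<Lambda>^2 |d\<zeta>|^2\<close> on the left half plane is the pullback under \<open>f\<close> of the Poincare metric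
  \<open>4 |dz|^2 / (1 - |z|^2)^2\<close>.
\<close>

definition developing :: "(complex \<Rightarrow> real) \<Rightarrow> (complex \<Rightarrow> complex) \<Rightarrow> bool" where
  "developing \<Lambda> f \<longleftrightarrow> f holomorphic_on {\<zeta>. Re \<zeta> < 0} \<and>
     (\<forall>\<zeta>. Re \<zeta> < 0 \<longrightarrow> norm (f \<zeta>) < 1 \<and> 2 * norm (deriv f \<zeta>) = (1 - (norm (f \<zeta>))\<^sup>2) * \<Lambda> \<zeta>)"

text \<open>The initial values at -1 are chosen so that the conjugation of solutions exchanges
  \<open>y1\<close> and \<open>y2\<close> up to the factor -1/2. Substituted into the constant
  Wronskian of the two, this eliminates \<open>s1\<close> and \<open>s2\<close> and leaves
  \<open>e^u (|y2|^2 - |y1|^2) = 2 W\<close>, which yields both \<open>|y1 / y2| < 1\<close> and the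
  formula for the metric.\<close>

lemma developing_map:
  fixes u :: "complex \<Rightarrow> real"
  assumes u: "\<And>w. w \<in> punctured_disk \<Longrightarrow> (u has_derivative (\<lambda>v. 2 * Re (p w * v))) (at w)"
    and p: "\<And>w. w \<in> punctured_disk \<Longrightarrow>
      (p has_derivative (\<lambda>v. (q w + (p w)\<^sup>2) * v + of_real (exp (2 * u w)) / 4 * cnj v)) (at w)"
    and q: "q holomorphic_on punctured_disk"
  shows "\<exists>f. developing (\<lambda>\<zeta>. exp (u (exp \<zeta>)) * norm (exp \<zeta>)) f"
proof -
  let ?L = "{\<zeta>. Re \<zeta> < 0}"
  let ?b = "\<lambda>\<zeta>. - q (exp \<zeta>) * exp \<zeta>"
  have exp: "exp \<zeta> \<in> punctured_disk" if "Re \<zeta> < 0" for \<zeta> :: complex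
    using that by (simp add: punctured_disk_def)
  have "(q \<circ> exp) holomorphic_on ?L"
    using exp by (intro holomorphic_on_compose_gen[OF _ q]) (auto intro!: holomorphic_intros)
  then have b: "?b holomorphic_on ?L" by (auto intro!: holomorphic_intros simp: o_def)
  have a: "exp holomorphic_on ?L" by (intro holomorphic_intros)
  have L: "convex ?L" "-1 \<in> ?L" by (simp_all add: convex_halfspace_Re_lt)
  define T where "T = (\<lambda>\<zeta>. complex_of_real (exp (u (exp \<zeta>))))"
  \<comment> \<open>Half the value of \<open>e^u\<close> at the base point: with
    \<open>s1 (-1) = W\<close> the conjugate of \<open>y1\<close> starts at -1/2, which is
    \<open>- y2 (-1) / 2\<close>.\<close>
  define W where "W = exp (u (exp (-1))) / 2"
  have W: "W > 0" "T (-1) = 2 * of_real W" by (simp_all add: W_def T_def)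
  have T: "T \<zeta> \<noteq> 0" "cnj (T \<zeta>) = T \<zeta>" "complex_of_real (exp (- u (exp \<zeta>))) = inverse (T \<zeta>)" for \<zeta>
    by (simp_all add: T_def exp_minus)
  define P where "P = (\<lambda>\<zeta>. p (exp \<zeta>))"
  obtain y1 s1 where i1: "y1 (-1) = 0" "s1 (-1) = of_real W"
    and 10: "\<And>\<zeta>. Re \<zeta> < 0 \<Longrightarrow> (y1 has_field_derivative exp \<zeta> * s1 \<zeta>) (at \<zeta>)"
      "\<And>\<zeta>. Re \<zeta> < 0 \<Longrightarrow> (s1 has_field_derivative ?b \<zeta> * y1 \<zeta>) (at \<zeta>)"
  proof (rule linear_system_on_half_plane[OF a b, of 0 "of_real W"], goal_cases)
    case (1 y s)
    show ?case by (rule that[of y s]) (use 1 in auto)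
  qed
  \<comment> \<open>The value \<open>- P (-1)\<close> makes \<open>P y2 + s2\<close> vanish at the
    base point, so the conjugate of \<open>y2\<close> starts at 0, as \<open>y1\<close>
    does.\<close>
  obtain y2 s2 where i2: "y2 (-1) = 1" "s2 (-1) = - P (-1)"
    and 20: "\<And>\<zeta>. Re \<zeta> < 0 \<Longrightarrow> (y2 has_field_derivative exp \<zeta> * s2 \<zeta>) (at \<zeta>)"
      "\<And>\<zeta>. Re \<zeta> < 0 \<Longrightarrow> (s2 has_field_derivative ?b \<zeta> * y2 \<zeta>) (at \<zeta>)"
  proof (rule linear_system_on_half_plane[OF a b, of 1 "- P (-1)"], goal_cases)
    case (1 y s)
    show ?case by (rule that[of y s]) (use 1 in auto)
  qed
  have 1: "(y1 has_field_derivative exp \<zeta> * s1 \<zeta>) (at \<zeta>)" "(s1 has_field_derivative ?b \<zeta> * y1 \<zeta>) (at \<zeta>)"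
    and 2: "(y2 has_field_derivative exp \<zeta> * s2 \<zeta>) (at \<zeta>)" "(s2 has_field_derivative ?b \<zeta> * y2 \<zeta>) (at \<zeta>)"
    if "\<zeta> \<in> ?L" for \<zeta>
    using that 10 20 by auto
  define B where "B = (\<lambda>y s \<zeta>. - cnj (of_real (exp (- u (exp \<zeta>))) * (p (exp \<zeta>) * y \<zeta> + s \<zeta>)))"
  define C where "C = (\<lambda>y s \<zeta>. - p (exp \<zeta>) * B y s \<zeta> - of_real (exp (u (exp \<zeta>))) / 4 * cnj (y \<zeta>))"
  have BC: "(B y s has_field_derivative exp \<zeta> * C y s \<zeta>) (at \<zeta>)"
      "(C y s has_field_derivative ?b \<zeta> * B y s \<zeta>) (at \<zeta>)"
    if "\<zeta> \<in> ?L" "\<And>\<zeta>. \<zeta> \<in> ?L \<Longrightarrow> (y has_field_derivative exp \<zeta> * s \<zeta>) (at \<zeta>)"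
      "\<And>\<zeta>. \<zeta> \<in> ?L \<Longrightarrow> (s has_field_derivative ?b \<zeta> * y \<zeta>) (at \<zeta>)" for y s \<zeta>
    using conjugate_solution[where u = u and p = p and q = q and y = y and s = s and \<zeta> = \<zeta>, OF u[OF exp] p[OF exp] that(2)[OF that(1)] that(3)[OF that(1)]] that(1)
    unfolding B_def C_def by auto
  have B_eq: "B y s \<zeta> = - cnj (P \<zeta> * y \<zeta> + s \<zeta>) / T \<zeta>" for y s \<zeta>
    by (simp add: B_def P_def T divide_inverse algebra_simps)
  have C_eq: "C y s \<zeta> = - P \<zeta> * B y s \<zeta> - T \<zeta> / 4 * cnj (y \<zeta>)" for y s \<zeta>
    by (simp add: C_def P_def T_def)
  note w = wronskian_constant[OF L(1) L(2)]
  have W12: "y1 \<zeta> * s2 \<zeta> - s1 \<zeta> * y2 \<zeta> = - of_real W" if "\<zeta> \<in> ?L" for \<zeta>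
    using w[OF that 1 2] by (simp add: i1 i2)
  have B1: "B y1 s1 \<zeta> = - y2 \<zeta> / 2" and B2: "B y2 s2 \<zeta> = - y1 \<zeta> / 2" if "\<zeta> \<in> ?L" for \<zeta>
  proof -
    \<comment> \<open>Cramer's rule: a solution is determined by its Wronskians with
      \<open>y1\<close> and \<open>y2\<close>, which are constant and can be read off at the base
      point.\<close>
    have rep: "B y s \<zeta> * - of_real W = y1 \<zeta> * (B y s \<zeta> * s2 \<zeta> - C y s \<zeta> * y2 \<zeta>) - y2 \<zeta> * (B y s \<zeta> * s1 \<zeta> - C y s \<zeta> * y1 \<zeta>)" for y s
      unfolding W12[OF that, symmetric] by (simp add: algebra_simps)
    have "B y1 s1 (-1) = -1/2" "B y2 s2 (-1) = 0"
      using W by (simp_all add: B_eq i1 i2)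
    then have w1: "B y1 s1 \<zeta> * s2 \<zeta> - C y1 s1 \<zeta> * y2 \<zeta> = 0" and w2: "B y1 s1 \<zeta> * s1 \<zeta> - C y1 s1 \<zeta> * y1 \<zeta> = - of_real W / 2"
      and w3: "B y2 s2 \<zeta> * s2 \<zeta> - C y2 s2 \<zeta> * y2 \<zeta> = of_real W / 2" and w4: "B y2 s2 \<zeta> * s1 \<zeta> - C y2 s2 \<zeta> * y1 \<zeta> = 0"
      using w[OF that BC[OF _ 1] 2] w[OF that BC[OF _ 1] 1] w[OF that BC[OF _ 2] 2] w[OF that BC[OF _ 2] 1] W
      by (simp_all add: i1 i2 C_eq)
    have "- (of_real W * (2 * B y1 s1 \<zeta>)) = of_real W * y2 \<zeta>" "- (of_real W * (2 * B y2 s2 \<zeta>)) = of_real W * y1 \<zeta>"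
      using rep[of y1 s1, unfolded w1 w2] rep[of y2 s2, unfolded w3 w4] by (simp_all add: field_simps)
    then have "of_real W * (2 * B y1 s1 \<zeta> + y2 \<zeta>) = 0" "of_real W * (2 * B y2 s2 \<zeta> + y1 \<zeta>) = 0"
      by (simp_all only: distrib_left neg_eq_iff_add_eq_0)
    then show "B y1 s1 \<zeta> = - y2 \<zeta> / 2" "B y2 s2 \<zeta> = - y1 \<zeta> / 2"
      using W by (simp_all add: add_eq_0_iff)
  qed
  have herm: "exp (u (exp \<zeta>)) * ((norm (y2 \<zeta>))\<^sup>2 - (norm (y1 \<zeta>))\<^sup>2) = 2 * W" if "\<zeta> \<in> ?L" for \<zeta>
  proof -
    have e1: "P \<zeta> * y1 \<zeta> + s1 \<zeta> = T \<zeta> * cnj (y2 \<zeta>) / 2"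
      using arg_cong[OF B1[OF that], of cnj] T(1,2)[of \<zeta>] unfolding B_eq by (simp add: field_simps)
    have e2: "P \<zeta> * y2 \<zeta> + s2 \<zeta> = T \<zeta> * cnj (y1 \<zeta>) / 2"
      using arg_cong[OF B2[OF that], of cnj] T(1,2)[of \<zeta>] unfolding B_eq by (simp add: field_simps)
    have e3: "(P \<zeta> * y1 \<zeta> + s1 \<zeta>) * y2 \<zeta> - (P \<zeta> * y2 \<zeta> + s2 \<zeta>) * y1 \<zeta> = of_real W"
      using W12[OF that] by (simp add: algebra_simps)
    have "T \<zeta> * (y2 \<zeta> * cnj (y2 \<zeta>) - y1 \<zeta> * cnj (y1 \<zeta>)) = 2 * of_real W"
      using e3 unfolding e1 e2 by (simp add: field_simps)
    then have "complex_of_real (exp (u (exp \<zeta>)) * ((norm (y2 \<zeta>))\<^sup>2 - (norm (y1 \<zeta>))\<^sup>2)) = of_real (2 * W)"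
      by (simp only: complex_norm_square[symmetric] T_def of_real_mult of_real_diff of_real_numeral)
    then show ?thesis by (simp only: of_real_eq_iff)
  qed
  have lt: "norm (y1 \<zeta>) < norm (y2 \<zeta>)" if "\<zeta> \<in> ?L" for \<zeta>
  proof -
    have "0 < exp (u (exp \<zeta>)) * ((norm (y2 \<zeta>))\<^sup>2 - (norm (y1 \<zeta>))\<^sup>2)" using herm[OF that] W by simp
    then have "(norm (y1 \<zeta>))\<^sup>2 < (norm (y2 \<zeta>))\<^sup>2" by (simp add: zero_less_mult_iff)
    then show ?thesis by (rule power2_less_imp_less) simp
  qed
  then have y2: "y2 \<zeta> \<noteq> 0" if "\<zeta> \<in> ?L" for \<zeta> using that by fastforce
  have df: "((\<lambda>\<zeta>. y1 \<zeta> / y2 \<zeta>) has_field_derivative exp \<zeta> * of_real W / (y2 \<zeta>)\<^sup>2) (at \<zeta>)" if "\<zeta> \<in> ?L" for \<zeta>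
  proof -
    have "exp \<zeta> * s1 \<zeta> * y2 \<zeta> - y1 \<zeta> * (exp \<zeta> * s2 \<zeta>) = exp \<zeta> * of_real W"
      using arg_cong[OF W12[OF that], of "\<lambda>x. - exp \<zeta> * x"] by (simp add: algebra_simps)
    then show ?thesis
      using DERIV_divide[OF 1(1)[OF that] 2(1)[OF that] y2[OF that]] by (simp add: power2_eq_square)
  qed
  show ?thesis
    unfolding developing_def
  proof (intro exI[of _ "\<lambda>\<zeta>. y1 \<zeta> / y2 \<zeta>"] conjI allI impI)
    show "(\<lambda>\<zeta>. y1 \<zeta> / y2 \<zeta>) holomorphic_on ?L"
      using df by (auto simp: holomorphic_on_def field_differentiable_def intro: has_field_derivative_at_within)
    fix \<zeta> :: complex assume "Re \<zeta> < 0"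
    then have \<zeta>: "\<zeta> \<in> ?L" by simp
    have n0: "norm (y2 \<zeta>) > 0" using y2[OF \<zeta>] by simp
    show "norm (y1 \<zeta> / y2 \<zeta>) < 1" using lt[OF \<zeta>] n0 by (simp add: norm_divide)
    have "norm (deriv (\<lambda>\<zeta>. y1 \<zeta> / y2 \<zeta>) \<zeta>) = norm (exp \<zeta>) * W / (norm (y2 \<zeta>))\<^sup>2"
      unfolding DERIV_imp_deriv[OF df[OF \<zeta>]] using W by (simp add: norm_mult norm_divide norm_power)
    moreover have "(1 - (norm (y1 \<zeta> / y2 \<zeta>))\<^sup>2) * exp (u (exp \<zeta>)) = 2 * W / (norm (y2 \<zeta>))\<^sup>2"
      unfolding herm[OF \<zeta>, symmetric] using n0 by (simp add: norm_divide power_divide divide_simps)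
    ultimately show "2 * norm (deriv (\<lambda>\<zeta>. y1 \<zeta> / y2 \<zeta>) \<zeta>)
        = (1 - (norm (y1 \<zeta> / y2 \<zeta>))\<^sup>2) * (exp (u (exp \<zeta>)) * norm (exp \<zeta>))"
      by (simp add: mult.assoc[symmetric])
  qed
qed

section \<open>Uniqueness of normal coordinates for rotationally symmetric metrics\<close>

text \<open>A maximum of \<open>|k|\<close> on a closed disc can be taken away from 0, since a
  maximum at 0 makes \<open>k\<close> constant. At such a point the outward radial derivative of
  \<open>|k|^2\<close> is nonnegative, so \<open>Re (z k' / k) \<ge> 0\<close> and
  \<open>|1 + z k' / k| \<ge> 1\<close>, against the hypothesis if \<open>|k| > 1\<close>
  there.\<close>

lemma norm_le_1_of_radial_derivative:
  assumes k: "k holomorphic_on ball 0 R"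
    and H: "\<And>z. \<lbrakk>z \<in> ball 0 R; z \<noteq> 0; norm (k z) > 1\<rbrakk> \<Longrightarrow> norm (1 + z * deriv k z / k z) < 1"
    and z: "z \<in> ball 0 R"
  shows "norm (k z) \<le> 1"
proof (rule ccontr)
  assume gt: "\<not> norm (k z) \<le> 1"
  have R: "R > 0" using z by (auto intro: le_less_trans[OF norm_ge_zero])
  define r where "r = max (norm z) (R / 2)"
  have r: "0 < r" "r < R" "norm z \<le> r" using z R by (auto simp: r_def)
  have sub: "cball 0 r \<subseteq> ball 0 R" using r by auto
  have "continuous_on (cball 0 r) (\<lambda>z. norm (k z))"
    by (intro continuous_on_norm holomorphic_on_imp_continuous_on holomorphic_on_subset[OF k sub])
  then obtain z1 where z1: "z1 \<in> cball 0 r" "\<And>y. y \<in> cball 0 r \<Longrightarrow> norm (k y) \<le> norm (k z1)"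
    using continuous_attains_sup[of "cball 0 r" "\<lambda>z. norm (k z)"] r by auto
  obtain z0 where z0: "z0 \<in> cball 0 r" "z0 \<noteq> 0" "\<And>y. y \<in> cball 0 r \<Longrightarrow> norm (k y) \<le> norm (k z0)"
  proof (cases "z1 = 0")
    case True
    have "k constant_on ball 0 R"
      by (rule maximum_modulus_principle[OF k, of "ball 0 r" 0]) (use z1 True r in auto)
    then have "k (of_real r) = k z1" using r True unfolding constant_on_def by force
    then show ?thesis using that[of "of_real r"] z1 r by auto
  qed (use that z1 in blast)
  have z0R: "z0 \<in> ball 0 R" using sub z0 by blast
  have n1: "norm (k z0) > 1" using z0(3)[of z] gt r by auto
  then have k0: "k z0 \<noteq> 0" by auto
  have dk: "(k has_field_derivative deriv k z0) (at z0)"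
    using k z0R holomorphic_derivI open_ball by blast
  have dk': "(k has_derivative (\<lambda>v. deriv k z0 * v)) (at (complex_of_real 1 * z0))"
    using dk by (simp add: has_field_derivative_def)
  have "((\<lambda>t. of_real t * z0) has_derivative (\<lambda>h. of_real h * z0)) (at (1::real))"
    by (auto intro!: derivative_eq_intros)
  from has_derivative_compose[OF this dk']
  have dt: "((\<lambda>t. k (of_real t * z0)) has_derivative (\<lambda>h. deriv k z0 * (of_real h * z0))) (at (1::real))" .
  have "((\<lambda>t. k (of_real t * z0) \<bullet> k (of_real t * z0)) has_derivative
      (\<lambda>h. k z0 \<bullet> (deriv k z0 * (of_real h * z0)) + (deriv k z0 * (of_real h * z0)) \<bullet> k z0)) (at (1::real))"
    using has_derivative_inner[OF dt dt] by simp
  then have der: "((\<lambda>t. k (of_real t * z0) \<bullet> k (of_real t * z0)) has_real_derivative 2 * (k z0 \<bullet> (deriv k z0 * z0))) (at (1::real))"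
    unfolding has_field_derivative_def
    by (rule has_derivative_eq_rhs) (auto simp: fun_eq_iff inner_complex_def algebra_simps)
  have "k z0 \<bullet> (deriv k z0 * z0) \<ge> 0"
  proof (rule ccontr)
    assume "\<not> ?thesis"
    then have "2 * (k z0 \<bullet> (deriv k z0 * z0)) < 0" by simp
    \<comment> \<open>Only the points \<open>(1 - h) z0\<close> on the inner side are compared: they
      stay in the closed disc even if \<open>z0\<close> lies on its boundary.\<close>
    from DERIV_neg_dec_left[OF der this] obtain d where d: "d > 0"
      "\<And>h. 0 < h \<Longrightarrow> h < d \<Longrightarrow> k z0 \<bullet> k z0 < k (of_real (1 - h) * z0) \<bullet> k (of_real (1 - h) * z0)" by auto
    define h where "h = min (d / 2) 1"
    have h: "0 < h" "h < d" "h \<le> 1" using d by (auto simp: h_def)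
    have "norm (complex_of_real (1 - h) * z0) = (1 - h) * norm z0" using h by (simp only: norm_mult norm_of_real)
    also have "\<dots> \<le> norm z0" using h by (simp add: mult_left_le_one_le)
    finally have "norm (k (of_real (1 - h) * z0)) \<le> norm (k z0)" using z0 by (intro z0(3)) auto
    then have "(norm (k (of_real (1 - h) * z0)))\<^sup>2 \<le> (norm (k z0))\<^sup>2" by (intro power_mono) auto
    then show False using d(2)[OF h(1,2)] by (simp add: power2_norm_eq_inner)
  qed
  moreover have "Re (z0 * deriv k z0 / k z0) = k z0 \<bullet> (deriv k z0 * z0) / (norm (k z0))\<^sup>2"
    by (simp add: Re_divide cmod_power2 inner_complex_def mult.commute)
  ultimately have "Re (1 + z0 * deriv k z0 / k z0) \<ge> 1" by simp
  then have "norm (1 + z0 * deriv k z0 / k z0) \<ge> 1" using complex_Re_le_cmod order_trans by blast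
  with H[OF z0R z0(2) n1] show False by simp
qed


text \<open>
  With \<open>z' = k(z) z\<close>, the equality of the metrics \<open>(R(|z|) / |z|)^2 |dz|^2\<close> and
  \<open>(R(|z'|) / |z'|)^2 |dz'|^2\<close> reads \<open>R(|z|) = R(|k| |z|) |1 + z k' / k|\<close>, so \<open>|1 + z k' / k| < 1\<close>
  wherever \<open>|k| > 1\<close>. At a maximum of \<open>|k|\<close> on a disc, however, \<open>Re (z k' / k)\<close> is nonnegative.
\<close>

lemma coordinate_comparison:
  fixes z z' :: "complex \<Rightarrow> complex" and R :: "real \<Rightarrow> real"
  assumes \<epsilon>: "\<epsilon> > 0" and z: "complex_coordinate (ball 0 \<epsilon>) z" "z 0 = 0"
    and z': "complex_coordinate (ball 0 \<epsilon>) z'" "z' 0 = 0"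
    and R: "\<And>t. \<lbrakk>0 < t; t < 1\<rbrakk> \<Longrightarrow> R t > 0" "\<And>s t. \<lbrakk>0 < s; s < t; t < 1\<rbrakk> \<Longrightarrow> R s < R t"
    and eq: "\<And>w. w \<in> ball 0 \<epsilon> - {0} \<Longrightarrow>
      R (norm (z w)) / norm (z w) * norm (deriv z w) = R (norm (z' w)) / norm (z' w) * norm (deriv z' w)"
  obtains r k where "r > 0" "k holomorphic_on ball 0 r" "\<And>\<zeta>. \<zeta> \<in> ball 0 r \<Longrightarrow> norm (k \<zeta>) \<le> 1"
    "\<forall>\<^sub>F w in nhds 0. z w \<in> ball 0 r \<and> z' w = k (z w) * z w"
proof -
  let ?B = "ball 0 \<epsilon> :: complex set"
  have hz: "z holomorphic_on ?B" "inj_on z ?B" and hz': "z' holomorphic_on ?B" "inj_on z' ?B"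
    using z z' by (auto simp: complex_coordinate_def)
  obtain h where h: "h holomorphic_on z ` ?B" "\<And>w. w \<in> ?B \<Longrightarrow> deriv z w * deriv h (z w) = 1"
      "\<And>w. w \<in> ?B \<Longrightarrow> h (z w) = w"
    using holomorphic_has_inverse[OF hz(1) open_ball hz(2)] by blast
  define S where "S = z ` ?B"
  have S: "open S" unfolding S_def by (rule open_mapping_thm3[OF hz(1) open_ball hz(2)])
  have hS: "h \<zeta> \<in> ?B" "z (h \<zeta>) = \<zeta>" if "\<zeta> \<in> S" for \<zeta>
    using that h(3) by (auto simp: S_def)
  have S0: "0 \<in> S" "h 0 = 0" using z(2) h(3)[of 0] \<epsilon> by (force simp: S_def)+
  \<comment> \<open>The transition function: \<open>z' = \<psi>(z)\<close> near 0. Its quotient by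
    the identity extends over 0 because \<open>\<psi> 0 = 0\<close>.\<close>
  define \<psi> where "\<psi> = z' \<circ> h"
  have \<psi>: "\<psi> holomorphic_on S"
    unfolding \<psi>_def by (rule holomorphic_on_compose_gen[OF _ hz'(1)]) (use h hS in \<open>auto simp: S_def\<close>)
  have \<psi>0: "\<psi> 0 = 0" by (simp add: \<psi>_def S0 z')
  have inj: "inj_on \<psi> S"
    unfolding \<psi>_def by (rule comp_inj_on) (use hS hz' in \<open>auto intro: inj_on_inverseI inj_on_subset\<close>)
  have "open (\<psi> -` ball 0 1 \<inter> S)"
    using continuous_open_preimage[OF holomorphic_on_imp_continuous_on[OF \<psi>] S open_ball, of 0 1] by (simp add: Int_commute)
  \<comment> \<open>Both \<open>|\<zeta>|\<close> and \<open>|\<psi> \<zeta>|\<close> must be below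
    1, where \<open>R\<close> is known to be positive and increasing.\<close>
  then have "open (\<psi> -` ball 0 1 \<inter> S \<inter> ball 0 1)" by blast
  moreover have "0 \<in> \<psi> -` ball 0 1 \<inter> S \<inter> ball 0 1" using \<psi>0 S0 by simp
  ultimately obtain r where r: "r > 0" "ball 0 r \<subseteq> \<psi> -` ball 0 1 \<inter> S \<inter> ball 0 1"
    using open_contains_ball by blast
  have sub: "ball 0 r \<subseteq> S" and lt: "\<And>\<zeta>. \<zeta> \<in> ball 0 r \<Longrightarrow> norm \<zeta> < 1 \<and> norm (\<psi> \<zeta>) < 1"
    using r(2) by auto
  define k where "k = (\<lambda>\<zeta>. if \<zeta> = 0 then deriv \<psi> 0 else (\<psi> \<zeta> - \<psi> 0) / (\<zeta> - 0))"
  have k: "k holomorphic_on ball 0 r"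
    using pole_lemma_open[OF holomorphic_on_subset[OF \<psi> sub] open_ball, of 0] by (simp only: k_def)
  have \<psi>k: "\<psi> \<zeta> = k \<zeta> * \<zeta>" for \<zeta> by (simp add: k_def \<psi>0)
  have k_le: "norm (k \<zeta>) \<le> 1" if "\<zeta> \<in> ball 0 r" for \<zeta>
  proof (rule norm_le_1_of_radial_derivative[OF k _ that])
    fix \<zeta> assume \<zeta>: "\<zeta> \<in> ball 0 r" "\<zeta> \<noteq> 0" "norm (k \<zeta>) > 1"
    then have k0: "k \<zeta> \<noteq> 0" by auto
    have \<zeta>S: "\<zeta> \<in> S" using \<zeta> sub by blast
    define w where "w = h \<zeta>"
    have w: "w \<in> ?B" "z w = \<zeta>" "w \<noteq> 0" using hS[OF \<zeta>S] \<zeta>(2) z(2) by (auto simp: w_def)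
    have dk: "(k has_field_derivative deriv k \<zeta>) (at \<zeta>)"
      using k \<zeta>(1) holomorphic_derivI open_ball by blast
    have "(\<psi> has_field_derivative (k \<zeta> + \<zeta> * deriv k \<zeta>)) (at \<zeta>)"
      unfolding \<psi>k[abs_def] using dk by (auto intro!: derivative_eq_intros)
    moreover have "(\<psi> has_field_derivative (deriv z' w * deriv h \<zeta>)) (at \<zeta>)"
      unfolding \<psi>_def
    proof (rule DERIV_chain)
      show "(z' has_field_derivative deriv z' w) (at (h \<zeta>))"
        using hz'(1) w(1) holomorphic_derivI open_ball unfolding w_def by blast
      show "(h has_field_derivative deriv h \<zeta>) (at \<zeta>)"
        using h(1) \<zeta>S S holomorphic_derivI unfolding S_def by blast
    qed
    ultimately have e1: "k \<zeta> + \<zeta> * deriv k \<zeta> = deriv z' w * deriv h \<zeta>" by (rule DERIV_unique)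
    have e2: "deriv z w * deriv h \<zeta> = 1" using h(2)[OF w(1)] w(2) by simp
    have zw': "z' w = k \<zeta> * \<zeta>" using \<psi>k[of \<zeta>] by (simp add: \<psi>_def w_def)
    have n\<zeta>: "0 < norm \<zeta>" "norm \<zeta> < norm (\<psi> \<zeta>)" "norm (\<psi> \<zeta>) < 1"
      using \<zeta> lt[of \<zeta>] by (auto simp: \<psi>k norm_mult)
    have "R (norm \<zeta>) / norm \<zeta> * norm (deriv z w) * norm (deriv h \<zeta>)
        = R (norm (\<psi> \<zeta>)) / norm (\<psi> \<zeta>) * norm (deriv z' w) * norm (deriv h \<zeta>)"
      using eq[of w] w zw' \<psi>k[of \<zeta>] by simp
    then have "R (norm \<zeta>) / norm \<zeta> = R (norm (\<psi> \<zeta>)) / norm (\<psi> \<zeta>) * norm (k \<zeta> + \<zeta> * deriv k \<zeta>)"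
      unfolding e1 using e2 by (simp add: mult.assoc flip: norm_mult)
    also have "k \<zeta> + \<zeta> * deriv k \<zeta> = k \<zeta> * (1 + \<zeta> * deriv k \<zeta> / k \<zeta>)" using k0 by (simp add: field_simps)
    finally have "R (norm \<zeta>) = R (norm (\<psi> \<zeta>)) * norm (1 + \<zeta> * deriv k \<zeta> / k \<zeta>)"
      unfolding \<psi>k norm_mult using \<zeta>(2) k0 by (simp add: field_simps)
    moreover have "R (norm \<zeta>) < R (norm (\<psi> \<zeta>))" using n\<zeta> by (intro R) auto
    moreover have "R (norm (\<psi> \<zeta>)) > 0" using n\<zeta> by (intro R) auto
    ultimately show "norm (1 + \<zeta> * deriv k \<zeta> / k \<zeta>) < 1" by simp
  qed
  have "open (z -` ball 0 r \<inter> ?B)"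
    using continuous_open_preimage[OF holomorphic_on_imp_continuous_on[OF hz(1)] open_ball open_ball, of 0 r] by (simp add: Int_commute)
  moreover have "0 \<in> z -` ball 0 r \<inter> ?B" using z r \<epsilon> by simp
  ultimately have "\<forall>\<^sub>F w in nhds 0. w \<in> z -` ball 0 r \<inter> ?B" by (rule eventually_nhds_in_open)
  then have "\<forall>\<^sub>F w in nhds 0. z w \<in> ball 0 r \<and> z' w = k (z w) * z w"
  proof eventually_elim
    case (elim w)
    then show ?case using \<psi>k[of "z w"] h(3)[of w] by (simp add: \<psi>_def)
  qed
  with r(1) k k_le show ?thesis by (rule that)
qed

text \<open>Comparison in both directions gives \<open>|z'| \<le> |z|\<close> and
  \<open>|z| \<le> |z'|\<close> near 0. So the quotient \<open>k\<close>, bounded by 1, attains the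
  modulus 1 at an interior point, and the maximum principle makes it constant.\<close>

lemma normal_coordinate_unique:
  fixes z z' :: "complex \<Rightarrow> complex" and R :: "real \<Rightarrow> real"
  assumes \<epsilon>: "\<epsilon> > 0" and z: "complex_coordinate (ball 0 \<epsilon>) z" "z 0 = 0"
    and z': "complex_coordinate (ball 0 \<epsilon>) z'" "z' 0 = 0"
    and R: "\<And>t. \<lbrakk>0 < t; t < 1\<rbrakk> \<Longrightarrow> R t > 0" "\<And>s t. \<lbrakk>0 < s; s < t; t < 1\<rbrakk> \<Longrightarrow> R s < R t"
    and eq: "\<And>w. w \<in> ball 0 \<epsilon> - {0} \<Longrightarrow>
      R (norm (z w)) / norm (z w) * norm (deriv z w) = R (norm (z' w)) / norm (z' w) * norm (deriv z' w)"
  shows "\<exists>c. norm c = 1 \<and> (\<forall>\<^sub>F w in nhds 0. z' w = c * z w)"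
proof -
  obtain r k where r: "r > 0" and k: "k holomorphic_on ball 0 r" "\<And>\<zeta>. \<zeta> \<in> ball 0 r \<Longrightarrow> norm (k \<zeta>) \<le> 1"
    and ev: "\<forall>\<^sub>F w in nhds 0. z w \<in> ball 0 r \<and> z' w = k (z w) * z w"
    using coordinate_comparison[OF \<epsilon> z z' R eq] by blast
  obtain r' k' where k': "\<And>\<zeta>. \<zeta> \<in> ball 0 r' \<Longrightarrow> norm (k' \<zeta>) \<le> 1"
    and ev': "\<forall>\<^sub>F w in nhds 0. z' w \<in> ball 0 r' \<and> z w = k' (z' w) * z' w"
    using coordinate_comparison[OF \<epsilon> z' z R eq[symmetric]] by blast
  have "\<forall>\<^sub>F w in nhds 0. w \<in> ball 0 \<epsilon>" using \<epsilon> by (intro eventually_nhds_in_open) auto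
  with ev ev' have "\<forall>\<^sub>F w in nhds 0. w \<in> ball 0 \<epsilon> \<and> z w \<in> ball 0 r \<and> norm (k (z w) * z w) = norm (z w)"
  proof eventually_elim
    case (elim w)
    have "norm (z' w) \<le> norm (z w)" using elim k(2)[of "z w"]
      by (metis mult_left_le_one_le norm_ge_zero norm_mult)
    moreover have "norm (z w) \<le> norm (z' w)" using elim k'[of "z' w"]
      by (metis mult_left_le_one_le norm_ge_zero norm_mult)
    ultimately show ?case using elim by (metis antisym)
  qed
  then obtain d where d: "d > 0" "\<And>w. w \<in> ball 0 d \<Longrightarrow> w \<in> ball 0 \<epsilon> \<and> z w \<in> ball 0 r \<and> norm (k (z w) * z w) = norm (z w)"
    unfolding eventually_nhds_metric by (auto simp: dist_commute)
  define w where "w = complex_of_real (d / 2)"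
  have w: "w \<in> ball 0 d" "w \<noteq> 0" using d(1) by (auto simp: w_def)
  have "inj_on z (ball 0 \<epsilon>)" using z by (simp add: complex_coordinate_def)
  then have "z w \<noteq> 0" using z(2) w d(2)[OF w(1)] \<epsilon> by (metis centre_in_ball inj_onD)
  then have "norm (k (z w)) = 1" using d(2)[OF w(1)] by (simp add: norm_mult)
  moreover have "k constant_on ball 0 r"
    by (rule maximum_modulus_principle[OF k(1), of "ball 0 r" "z w"])
      (use d(2)[OF w(1)] calculation k(2) in auto)
  then obtain c where c: "\<And>\<zeta>. \<zeta> \<in> ball 0 r \<Longrightarrow> k \<zeta> = c" unfolding constant_on_def by blast
  ultimately have "norm c = 1" using d(2)[OF w(1)] by auto
  moreover have "\<forall>\<^sub>F w in nhds 0. z' w = c * z w"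
    using ev by eventually_elim (auto simp: c)
  ultimately show ?thesis by blast
qed

section \<open>Disc automorphisms and the monodromy of the developing map\<close>

lemma disc_automorphism_denominator:
  fixes a z :: complex
  assumes "norm a < 1" "norm z \<le> 1"
  shows "1 - cnj a * z \<noteq> 0"
proof
  assume "1 - cnj a * z = 0"
  then have "norm (cnj a * z) = 1" by (metis eq_iff_diff_eq_0 norm_one)
  moreover have "norm (cnj a * z) \<le> norm a" using assms by (simp add: norm_mult mult_left_le)
  ultimately show False using assms by simp
qed

text \<open>Rests on \<open>|1 - cnj a z|^2 - |z - a|^2 = (1 - |a|^2) (1 - |z|^2)\<close>. It serves
  twice: positivity of the right-hand side shows that the disc is mapped into itself, and combined
  with the derivative of the map it is the invariance of the Poincare metric.\<close>

lemma disc_automorphism_norm: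
  fixes a z \<mu> :: complex
  assumes "norm a < 1" "norm z < 1" "norm \<mu> = 1"
  shows "1 - (norm (\<mu> * (z - a) / (1 - cnj a * z)))\<^sup>2
    = (1 - (norm a)\<^sup>2) * (1 - (norm z)\<^sup>2) / (norm (1 - cnj a * z))\<^sup>2"
proof -
  have d: "1 - cnj a * z \<noteq> 0" using disc_automorphism_denominator[of a z] assms by auto
  have "(norm (1 - cnj a * z))\<^sup>2 - (norm (z - a))\<^sup>2 = (1 - (norm a)\<^sup>2) * (1 - (norm z)\<^sup>2)"
    unfolding cmod_power2 by (simp add: power2_eq_square algebra_simps)
  moreover have "norm (\<mu> * (z - a) / (1 - cnj a * z)) = norm (z - a) / norm (1 - cnj a * z)"
    by (simp only: norm_divide norm_mult assms(3) mult_1)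
  ultimately show ?thesis using d by (simp only: power_divide) (simp add: field_simps)
qed

lemma one_minus_norm_square_pos: "norm (z::complex) < 1 \<Longrightarrow> 1 - (norm z)\<^sup>2 > 0"
  by (simp add: abs_square_less_1)

lemma disc_automorphism_in_disc:
  fixes a z \<mu> :: complex
  assumes "norm a < 1" "norm z < 1" "norm \<mu> = 1"
  shows "norm (\<mu> * (z - a) / (1 - cnj a * z)) < 1"
proof -
  have "1 - cnj a * z \<noteq> 0" using disc_automorphism_denominator[of a z] assms by auto
  then have "1 - (norm (\<mu> * (z - a) / (1 - cnj a * z)))\<^sup>2 > 0"
    unfolding disc_automorphism_norm[OF assms] using assms
    by (intro divide_pos_pos mult_pos_pos one_minus_norm_square_pos) auto
  then have "(norm (\<mu> * (z - a) / (1 - cnj a * z)))\<^sup>2 < 1\<^sup>2" by simp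
  then show ?thesis by (rule power2_less_imp_less) simp
qed

lemma developing_disc_automorphism:
  assumes f: "developing \<Lambda> f" and a: "norm a < 1"
  shows "developing \<Lambda> (\<lambda>\<zeta>. (f \<zeta> - a) / (1 - cnj a * f \<zeta>))"
proof -
  let ?F = "\<lambda>\<zeta>. (f \<zeta> - a) / (1 - cnj a * f \<zeta>)"
  have hol: "f holomorphic_on {\<zeta>. Re \<zeta> < 0}" and f1: "\<And>\<zeta>. Re \<zeta> < 0 \<Longrightarrow> norm (f \<zeta>) < 1"
    and f2: "\<And>\<zeta>. Re \<zeta> < 0 \<Longrightarrow> 2 * norm (deriv f \<zeta>) = (1 - (norm (f \<zeta>))\<^sup>2) * \<Lambda> \<zeta>"
    using f by (auto simp: developing_def)
  have d: "1 - cnj a * f \<zeta> \<noteq> 0" if "Re \<zeta> < 0" for \<zeta>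
    using disc_automorphism_denominator[OF a] f1[OF that] by auto
  have df: "(f has_field_derivative deriv f \<zeta>) (at \<zeta>)" if "Re \<zeta> < 0" for \<zeta>
    using hol holomorphic_derivI[OF hol open_halfspace_Re_lt] that by simp
  have dF: "(?F has_field_derivative (1 - cnj a * a) * deriv f \<zeta> / (1 - cnj a * f \<zeta>)\<^sup>2) (at \<zeta>)" if "Re \<zeta> < 0" for \<zeta>
    by (rule DERIV_cong, rule DERIV_divide[OF DERIV_diff[OF df[OF that] DERIV_const] DERIV_diff[OF DERIV_const DERIV_cmult[OF df[OF that]]] d[OF that]])
      (simp add: power2_eq_square algebra_simps)
  show ?thesis unfolding developing_def
  proof (intro conjI allI impI)
    show "?F holomorphic_on {\<zeta>. Re \<zeta> < 0}" using hol d by (intro holomorphic_intros) auto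
    fix \<zeta> :: complex assume \<zeta>: "Re \<zeta> < 0"
    show "norm (?F \<zeta>) < 1" using disc_automorphism_in_disc[OF a f1[OF \<zeta>], of 1] by simp
    have "norm (1 - cnj a * a) = 1 - (norm a)\<^sup>2"
    proof -
      have "1 - cnj a * a = of_real (1 - (norm a)\<^sup>2)" by (simp only: of_real_diff of_real_1 complex_norm_square mult.commute)
      then show ?thesis using one_minus_norm_square_pos[OF a] by (simp only: norm_of_real)
    qed
    then have "norm (deriv ?F \<zeta>) = (1 - (norm a)\<^sup>2) * norm (deriv f \<zeta>) / (norm (1 - cnj a * f \<zeta>))\<^sup>2"
      unfolding DERIV_imp_deriv[OF dF[OF \<zeta>]] by (simp add: norm_divide norm_mult norm_power)
    then have "2 * norm (deriv ?F \<zeta>) = (1 - (norm a)\<^sup>2) * (2 * norm (deriv f \<zeta>)) / (norm (1 - cnj a * f \<zeta>))\<^sup>2" by simp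
    also have "\<dots> = (1 - (norm (1 * (f \<zeta> - a) / (1 - cnj a * f \<zeta>)))\<^sup>2) * \<Lambda> \<zeta>"
      unfolding f2[OF \<zeta>] disc_automorphism_norm[OF a f1[OF \<zeta>] norm_one] by simp
    finally show "2 * norm (deriv ?F \<zeta>) = (1 - (norm (?F \<zeta>))\<^sup>2) * \<Lambda> \<zeta>" by simp
  qed
qed

text \<open>Positivity of \<open>\<Lambda>\<close> makes both maps injective near -1. They are thus
  coordinates vanishing at -1 in which the metric is the Poincare metric, which is rotationally
  symmetric with \<open>R t = 2 t / (1 - t^2)\<close>. Uniqueness of normal coordinates gives a
  rotation near -1, and analytic continuation carries it to the half plane.\<close>

lemma developing_unique_centred:
  assumes f: "developing \<Lambda> f" "f (-1) = 0" and h: "developing \<Lambda> h" "h (-1) = 0"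
    and pos: "\<And>\<zeta>. Re \<zeta> < 0 \<Longrightarrow> \<Lambda> \<zeta> > 0"
  shows "\<exists>c. norm c = 1 \<and> (\<forall>\<zeta>. Re \<zeta> < 0 \<longrightarrow> h \<zeta> = c * f \<zeta>)"
proof -
  let ?L = "{\<zeta>. Re \<zeta> < 0}"
  have L: "open ?L" "-1 \<in> ?L" "connected ?L"
    by (auto simp: open_halfspace_Re_lt convex_halfspace_Re_lt intro: convex_connected)
  have inj: "\<exists>r>0. ball (-1) r \<subseteq> ?L \<and> inj_on F (ball (-1) r)" if F: "developing \<Lambda> F" "F (-1) = 0" for F
  proof -
    have "2 * norm (deriv F (-1)) = (1 - (norm (F (-1)))\<^sup>2) * \<Lambda> (-1)" using F(1) by (simp add: developing_def)
    then have "deriv F (-1) \<noteq> 0" using F(2) pos[of "-1"] by auto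
    moreover have "F holomorphic_on ?L" using F by (simp add: developing_def)
    ultimately show ?thesis
      using has_complex_derivative_locally_injective[OF _ L(2,1)] by metis
  qed
  obtain r1 r2 where r: "r1 > 0" "ball (-1) r1 \<subseteq> ?L" "inj_on f (ball (-1) r1)"
    "r2 > 0" "inj_on h (ball (-1) r2)" using inj[OF f] inj[OF h] by metis
  define \<epsilon> where "\<epsilon> = min r1 r2"
  have \<epsilon>: "\<epsilon> > 0" using r by (simp add: \<epsilon>_def)
  have im: "-1 + w \<in> ball (-1) r1" "-1 + w \<in> ball (-1) r2" "Re (-1 + w) < 0" if "w \<in> ball 0 \<epsilon>" for w
  proof -
    show 1: "-1 + w \<in> ball (-1) r1" "-1 + w \<in> ball (-1) r2" using that by (auto simp: \<epsilon>_def dist_norm)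
    show "Re (-1 + w) < 0" using 1(1) r(2) by auto
  qed
  have coord: "complex_coordinate (ball 0 \<epsilon>) (\<lambda>w. F (-1 + w))"
    and der: "\<And>w. w \<in> ball 0 \<epsilon> \<Longrightarrow> deriv (\<lambda>w. F (-1 + w)) w = deriv F (-1 + w)"
    if F: "developing \<Lambda> F" "inj_on F (ball (-1) \<epsilon>)" for F
  proof -
    have hF: "F holomorphic_on ?L" using F by (simp add: developing_def)
    have d: "((\<lambda>w. F (-1 + w)) has_field_derivative deriv F (-1 + w)) (at w)" if "w \<in> ball 0 \<epsilon>" for w
    proof -
      have "(F has_field_derivative deriv F (-1 + w)) (at (-1 + w))"
        using holomorphic_derivI[OF hF L(1)] im(3)[OF that] by simp
      moreover have "((\<lambda>w. -1 + w) has_field_derivative 1) (at w)" by (auto intro!: derivative_eq_intros)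
      ultimately show ?thesis using DERIV_chain2[where f = F and g = "\<lambda>w. -1 + w"] by fastforce
    qed
    then show "deriv (\<lambda>w. F (-1 + w)) w = deriv F (-1 + w)" if "w \<in> ball 0 \<epsilon>" for w
      using that by (blast intro: DERIV_imp_deriv)
    have "inj_on (\<lambda>w. F (-1 + w)) (ball 0 \<epsilon>)"
    proof (rule inj_onI)
      fix x y assume xy: "x \<in> ball 0 \<epsilon>" "y \<in> ball 0 \<epsilon>" "F (-1 + x) = F (-1 + y)"
      then have "-1 + x = -1 + y" by (intro inj_onD[OF F(2) xy(3)]) (auto simp: dist_norm)
      then show "x = y" by simp
    qed
    moreover have "(\<lambda>w. F (-1 + w)) holomorphic_on ball 0 \<epsilon>"
      unfolding holomorphic_on_open[OF open_ball] using d by blast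
    ultimately show "complex_coordinate (ball 0 \<epsilon>) (\<lambda>w. F (-1 + w))"
      unfolding complex_coordinate_def by blast
  qed
  have if': "inj_on f (ball (-1) \<epsilon>)" "inj_on h (ball (-1) \<epsilon>)"
    using r by (auto intro: inj_on_subset simp: \<epsilon>_def)
  let ?R = "\<lambda>t::real. 2 * t / (1 - t\<^sup>2)"
  have Req: "?R (norm (F (-1 + w))) / norm (F (-1 + w)) * norm (deriv (\<lambda>w. F (-1 + w)) w) = \<Lambda> (-1 + w)"
    if F: "developing \<Lambda> F" "F (-1) = 0" "inj_on F (ball (-1) \<epsilon>)" and w: "w \<in> ball 0 \<epsilon> - {0}" for F w
  proof -
    have "F (-1 + w) \<noteq> 0"
    proof
      assume "F (-1 + w) = 0"
      then have "-1 + w = -1" using F w \<epsilon> by (intro inj_onD[OF F(3), of "-1 + w" "-1"]) (auto simp: dist_norm)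
      then show False using w by simp
    qed
    moreover have "norm (F (-1 + w)) < 1" "2 * norm (deriv F (-1 + w)) = (1 - (norm (F (-1 + w)))\<^sup>2) * \<Lambda> (-1 + w)"
      using F(1) im(3)[of w] w by (auto simp: developing_def)
    moreover have "1 - (norm (F (-1 + w)))\<^sup>2 > 0" using one_minus_norm_square_pos calculation by blast
    moreover have "2 * n / (1 - n\<^sup>2) / n * d = \<Lambda> (-1 + w)"
      if "n \<noteq> 0" "2 * d = (1 - n\<^sup>2) * \<Lambda> (-1 + w)" "1 - n\<^sup>2 > 0" for n d
    proof -
      have "2 * n / (1 - n\<^sup>2) / n * d = 2 * d / (1 - n\<^sup>2)" using that(1) by simp
      then show ?thesis unfolding that(2) using that(3) by simp
    qed
    ultimately have "?R (norm (F (-1 + w))) / norm (F (-1 + w)) * norm (deriv F (-1 + w)) = \<Lambda> (-1 + w)"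
      by (metis norm_eq_zero)
    then show ?thesis using der[OF F(1,3), of w] w by simp
  qed
  have Rpos: "?R t > 0" if "0 < t" "t < 1" for t :: real
    using that by (simp add: abs_square_less_1)
  have Rmono: "?R s < ?R t" if "0 < s" "s < t" "t < 1" for s t :: real
  proof -
    have "s\<^sup>2 < t\<^sup>2" using that by (intro power_strict_mono) auto
    moreover have "t\<^sup>2 < 1" using that by (simp add: abs_square_less_1)
    ultimately show ?thesis using that by (intro frac_less) auto
  qed
  have "\<exists>c. norm c = 1 \<and> (\<forall>\<^sub>F w in nhds 0. h (-1 + w) = c * f (-1 + w))"
  proof (rule normal_coordinate_unique[where R = ?R, OF \<epsilon> coord[OF f(1) if'(1)] _ coord[OF h(1) if'(2)]])
    show "f (-1 + 0) = 0" "h (-1 + 0) = 0" using f(2) h(2) by simp_all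
    show "?R t > 0" if "0 < t" "t < 1" for t using Rpos[OF that] .
    show "?R s < ?R t" if "0 < s" "s < t" "t < 1" for s t using Rmono[OF that] .
    show "?R (norm (f (-1 + w))) / norm (f (-1 + w)) * norm (deriv (\<lambda>w. f (-1 + w)) w)
      = ?R (norm (h (-1 + w))) / norm (h (-1 + w)) * norm (deriv (\<lambda>w. h (-1 + w)) w)"
      if "w \<in> ball 0 \<epsilon> - {0}" for w
      by (simp only: Req[OF f if'(1) that] Req[OF h if'(2) that])
  qed
  then obtain c where c: "norm c = 1" and ev: "\<forall>\<^sub>F w in nhds 0. h (-1 + w) = c * f (-1 + w)" by blast
  obtain d where d: "d > 0" "\<And>w. norm w < d \<Longrightarrow> h (-1 + w) = c * f (-1 + w)"
    using ev unfolding eventually_nhds_metric by auto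
  have "h \<zeta> = c * f \<zeta>" if "Re \<zeta> < 0" for \<zeta>
  proof (rule analytic_continuation_open[of "ball (-1) (min d r1)" ?L h "\<lambda>\<zeta>. c * f \<zeta>"])
    show "h holomorphic_on ?L" "(\<lambda>\<zeta>. c * f \<zeta>) holomorphic_on ?L"
      using f h by (auto simp: developing_def intro!: holomorphic_intros)
    show "h z = c * f z" if "z \<in> ball (-1) (min d r1)" for z
      using d(2)[of "z + 1"] that by (simp add: dist_norm norm_minus_commute add.commute)
  qed (use L d r that in auto)
  with c show ?thesis by blast
qed

text \<open>Moving \<open>f (-1)\<close> and \<open>h (-1)\<close> to 0 reduces to the centred case.
  It remains to bring the composite of a disc automorphism, a rotation and an inverse automorphism
  into the standard form.\<close>

lemma developing_unique:
  assumes f: "developing \<Lambda> f" and h: "developing \<Lambda> h"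
    and pos: "\<And>\<zeta>. Re \<zeta> < 0 \<Longrightarrow> \<Lambda> \<zeta> > 0"
  obtains \<mu> a where "norm \<mu> = 1" "norm a < 1"
    "\<And>\<zeta>. Re \<zeta> < 0 \<Longrightarrow> h \<zeta> = \<mu> * (f \<zeta> - a) / (1 - cnj a * f \<zeta>)"
proof -
  define a where "a = f (-1)"
  define b where "b = h (-1)"
  have a: "norm a < 1" and b: "norm b < 1" using f h by (auto simp: developing_def a_def b_def)
  obtain c where c: "norm c = 1" and
    eq: "\<And>\<zeta>. Re \<zeta> < 0 \<Longrightarrow> (h \<zeta> - b) / (1 - cnj b * h \<zeta>) = c * ((f \<zeta> - a) / (1 - cnj a * f \<zeta>))"
    using developing_unique_centred[OF developing_disc_automorphism[OF f a] _ developing_disc_automorphism[OF h b] _ pos]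
    by (auto simp: a_def b_def)
  have cc: "c * cnj c = 1" using c by (simp add: complex_norm_square[symmetric])
  have c0: "c \<noteq> 0" using c by auto
  then have ccinv: "cnj c = 1 / c" using cc by (simp add: field_simps)
  \<comment> \<open>Coefficients of the composite: solving for \<open>h\<close> gives
    \<open>h = (c * cnj P * f + N) / (P + c * cnj N * f)\<close>. The identity \<open>PN\<close>
    yields \<open>|N| < |P|\<close>, so the zero of the numerator lies in the disc.\<close>
  define P where "P = 1 - cnj b * c * a"
  define N where "N = b - c * a"
  have PN: "(norm P)\<^sup>2 - (norm N)\<^sup>2 = (1 - (norm a)\<^sup>2) * (1 - (norm b)\<^sup>2)"
  proof -
    have "complex_of_real ((norm P)\<^sup>2 - (norm N)\<^sup>2) = of_real ((1 - (norm a)\<^sup>2) * (1 - (norm b)\<^sup>2))"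
      unfolding of_real_diff of_real_mult of_real_1 complex_norm_square P_def N_def
      using cc by (simp add: algebra_simps) 
    then show ?thesis by (simp only: of_real_eq_iff)
  qed
  have "(norm N)\<^sup>2 < (norm P)\<^sup>2"
    using PN mult_pos_pos[OF one_minus_norm_square_pos[OF a] one_minus_norm_square_pos[OF b]] by linarith
  then have NP: "norm N < norm P" by (rule power2_less_imp_less) simp
  then have P0: "P \<noteq> 0" by auto
  have cP: "c * cnj P = c - b * cnj a" "c * cnj N = c * cnj b - cnj a"
    using cc by (simp_all add: P_def N_def algebra_simps)
  show ?thesis
  proof
    show "norm (c * cnj P / P) = 1" using c P0 by (simp add: norm_mult norm_divide)
    show "norm (- N / (c * cnj P)) < 1" using c P0 NP by (simp add: norm_mult norm_divide)
    fix \<zeta> :: complex assume \<zeta>: "Re \<zeta> < 0"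
    define x where "x = f \<zeta>"
    define y where "y = h \<zeta>"
    have dx: "1 - cnj a * x \<noteq> 0" and dy: "1 - cnj b * y \<noteq> 0"
      using disc_automorphism_denominator[OF a, of x] disc_automorphism_denominator[OF b, of y] f h \<zeta>
      by (auto simp: developing_def x_def y_def less_imp_le)
    have "(y - b) * (1 - cnj a * x) = c * (x - a) * (1 - cnj b * y)"
      using eq[OF \<zeta>] dx dy by (simp add: x_def y_def field_simps)
    then have E: "y * (P + c * cnj N * x) = c * cnj P * x + N"
      unfolding cP by (simp add: P_def N_def algebra_simps)
    have den: "1 - cnj (- N / (c * cnj P)) * x = (P + c * cnj N * x) / P"
      using P0 c0 by (simp add: ccinv field_simps)
    have "norm (- N / (c * cnj P)) < 1" using c P0 NP by (simp add: norm_mult norm_divide)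
    moreover have "norm x \<le> 1" using f \<zeta> by (auto simp: developing_def x_def less_imp_le)
    ultimately have "1 - cnj (- N / (c * cnj P)) * x \<noteq> 0" by (rule disc_automorphism_denominator)
    then have "P + c * cnj N * x \<noteq> 0" unfolding den by auto
    moreover from this have "y = (c * cnj P * x + N) / (P + c * cnj N * x)" using E by (simp add: eq_divide_eq)
    moreover have "c * cnj P / P * (x - - N / (c * cnj P)) = (c * cnj P * x + N) / P"
      using P0 c0 by (simp add: field_simps)
    ultimately show "h \<zeta> = c * cnj P / P * (f \<zeta> - - N / (c * cnj P)) / (1 - cnj (- N / (c * cnj P)) * f \<zeta>)"
      unfolding x_def[symmetric] y_def[symmetric] den using P0 by simp
  qed
qed

text \<open>For nonzero \<open>a\<close> the fixed points are the roots of
  \<open>cnj a * c^2 + (\<mu> - 1) * c - \<mu> * a\<close>. Their product has modulus 1, so one of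
  them lies in the closed disc.\<close>

lemma disc_automorphism_fixed_point:
  fixes a \<mu> :: complex
  assumes a: "norm a < 1" and \<mu>: "norm \<mu> = 1"
  obtains c where "norm c \<le> 1" "c * (1 - cnj a * c) = \<mu> * (c - a)"
proof (cases "a = 0")
  case True
  then show ?thesis using that[of 0] by simp
next
  case False
  define s where "s = csqrt ((\<mu> - 1)\<^sup>2 + 4 * cnj a * \<mu> * a)"
  have s: "s\<^sup>2 = (\<mu> - 1)\<^sup>2 + 4 * cnj a * \<mu> * a" by (simp add: s_def)
  have fixed: "c * (1 - cnj a * c) = \<mu> * (c - a)" if "2 * cnj a * c = 1 - \<mu> + t" "t\<^sup>2 = s\<^sup>2" for c t
  proof -
    have t: "t = 2 * cnj a * c - 1 + \<mu>" using that(1) by (simp add: algebra_simps)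
    have "4 * cnj a * (c * (1 - cnj a * c) - \<mu> * (c - a)) = 0"
      using that(2) unfolding s t by (simp add: power2_eq_square algebra_simps)
    then show ?thesis using False by simp
  qed
  define c1 where "c1 = (1 - \<mu> + s) / (2 * cnj a)"
  define c2 where "c2 = (1 - \<mu> - s) / (2 * cnj a)"
  have "c1 * c2 = ((1 - \<mu>)\<^sup>2 - s\<^sup>2) / (4 * (cnj a)\<^sup>2)"
    by (simp add: c1_def c2_def power2_eq_square algebra_simps)
  also have "\<dots> = - \<mu> * a / cnj a" unfolding s using False by (simp add: power2_eq_square field_simps)
  finally have "norm c1 * norm c2 = 1" using False \<mu> by (simp flip: norm_mult) (simp add: norm_mult norm_divide)
  then have "norm c1 \<le> 1 \<or> norm c2 \<le> 1"
    by (metis less_1_mult not_le less_irrefl)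
  moreover have "c1 * (1 - cnj a * c1) = \<mu> * (c1 - a)" by (rule fixed[of _ s]) (use False in \<open>simp_all add: c1_def\<close>)
  moreover have "c2 * (1 - cnj a * c2) = \<mu> * (c2 - a)" by (rule fixed[of _ "- s"]) (use False in \<open>simp_all add: c2_def\<close>)
  ultimately show ?thesis using that by blast
qed

text \<open>Conjugated by an automorphism taking \<open>c\<close> to 0, the map fixes 0 and is hence
  a rotation. Numerator and denominator are cleared separately; the denominator uses the complex
  conjugate of the fixed point equation, where \<open>|\<mu>| = 1\<close> enters.\<close>

lemma disc_automorphism_conjugate_rotation:
  fixes a \<mu> c z :: complex
  assumes a: "norm a < 1" and \<mu>: "norm \<mu> = 1" and c: "norm c < 1" and z: "norm z < 1"
    and fix_c: "c * (1 - cnj a * c) = \<mu> * (c - a)"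
  defines "m \<equiv> \<mu> * (z - a) / (1 - cnj a * z)"
  shows "(m - c) / (1 - cnj c * m) = \<mu> * (1 - a * cnj c) / (1 - cnj a * c) * ((z - c) / (1 - cnj c * z))"
proof -
  define D1 where "D1 = 1 - cnj a * z"
  define D2 where "D2 = 1 - cnj a * c"
  define D3 where "D3 = 1 - a * cnj c"
  define X where "X = 1 - cnj a * a"
  have nz: "D1 \<noteq> 0" "D2 \<noteq> 0" "D3 \<noteq> 0" "1 - cnj c * z \<noteq> 0" "X \<noteq> 0"
    using disc_automorphism_denominator[of a z] disc_automorphism_denominator[of a c]
      disc_automorphism_denominator[of c a] disc_automorphism_denominator[of c z]
      disc_automorphism_denominator[of a a] assms
    by (auto simp: D1_def D2_def D3_def X_def mult.commute less_imp_le)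
  have m1: "norm m < 1" unfolding m_def by (rule disc_automorphism_in_disc[OF a z \<mu>])
  have nm: "1 - cnj c * m \<noteq> 0" using disc_automorphism_denominator[of c m] c m1 by auto
  have \<mu>\<mu>: "\<mu> * cnj \<mu> = 1" using \<mu> by (simp add: complex_norm_square[symmetric])
  have h: "c * D2 = \<mu> * (c - a)" using fix_c by (simp add: D2_def)
  have "cnj c * D3 = cnj \<mu> * (cnj c - cnj a)" using arg_cong[OF fix_c, of cnj] by (simp add: D3_def)
  then have "\<mu> * (cnj c * D3) = (\<mu> * cnj \<mu>) * (cnj c - cnj a)" by simp
  then have h': "cnj c * \<mu> * D3 = cnj c - cnj a" by (simp add: \<mu>\<mu> algebra_simps)
  have mD: "m * D1 = \<mu> * (z - a)" using nz by (simp add: m_def D1_def)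
  have "(m - c) * D1 * D2 = m * D1 * D2 - c * D2 * D1" by (simp add: algebra_simps)
  also have "\<dots> = \<mu> * X * (z - c)" unfolding mD h by (simp add: D1_def D2_def X_def algebra_simps)
  finally have A: "(m - c) * D1 * D2 = \<mu> * X * (z - c)" .
  have "(1 - cnj c * m) * D1 * D3 = D1 * D3 - cnj c * D3 * (m * D1)" by (simp add: algebra_simps)
  also have "\<dots> = D1 * D3 - (cnj c * \<mu> * D3) * (z - a)" unfolding mD by (simp add: algebra_simps)
  also have "\<dots> = X * (1 - cnj c * z)" unfolding h' by (simp add: D1_def D3_def X_def algebra_simps)
  finally have B: "(1 - cnj c * m) * D1 * D3 = X * (1 - cnj c * z)" .
  have "(m - c) / (1 - cnj c * m) = ((m - c) * D1 * D2) / ((1 - cnj c * m) * D1 * D3) * (D3 / D2)"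
    using nz nm by (simp add: field_simps)
  also have "\<dots> = \<mu> * D3 / D2 * ((z - c) / (1 - cnj c * z))"
    unfolding A B using nz by (simp add: field_simps)
  finally show ?thesis by (simp add: D2_def D3_def)
qed

text \<open>The map sending \<open>z\<close> to \<open>\<i> (c + z) / (c - z)\<close> takes the disc
  to the upper half plane and \<open>c\<close> to infinity, so an automorphism fixing
  \<open>c\<close> becomes a real affine map. With explicit coefficients, positivity of the linear
  one can be read off.\<close>

lemma disc_automorphism_conjugate_affine:
  fixes a \<mu> c z :: complex
  assumes a: "norm a < 1" and \<mu>: "norm \<mu> = 1" and c: "norm c = 1" and z: "norm z < 1"
    and fix_c: "c * (1 - cnj a * c) = \<mu> * (c - a)"
  defines "m \<equiv> \<mu> * (z - a) / (1 - cnj a * z)"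
  shows "\<i> * (c + m) / (c - m) = of_real ((norm (1 - cnj a * c))\<^sup>2 / (1 - (norm a)\<^sup>2)) * (\<i> * (c + z) / (c - z))
    + of_real (- 2 * Im (cnj a * c) / (1 - (norm a)\<^sup>2))"
proof -
  define D1 where "D1 = 1 - cnj a * z"
  define D2 where "D2 = 1 - cnj a * c"
  define X where "X = 1 - cnj a * a"
  have nz: "D1 \<noteq> 0" "D2 \<noteq> 0" "X \<noteq> 0" "\<mu> \<noteq> 0" "c \<noteq> 0"
    using disc_automorphism_denominator[of a z] disc_automorphism_denominator[of a c]
      disc_automorphism_denominator[of a a] assms
    by (auto simp: D1_def D2_def X_def mult.commute less_imp_le)
  have cz: "c - z \<noteq> 0" using c z by auto
  have cm: "c - m \<noteq> 0" using c disc_automorphism_in_disc[OF a z \<mu>] by (auto simp: m_def)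
  have cc: "c * cnj c = 1" using c by (simp add: complex_norm_square[symmetric])
  then have ccinv: "cnj c = 1 / c" using nz by (simp add: field_simps)
  have X: "of_real (1 - (norm a)\<^sup>2) = X" by (simp only: X_def of_real_diff of_real_1 complex_norm_square mult.commute)
  have N: "of_real ((norm (1 - cnj a * c))\<^sup>2) = D2 * (1 - a / c)"
    unfolding complex_norm_square D2_def by (simp add: ccinv)
  have "complex_of_real (2 * Im (cnj a * c)) * \<i> = cnj a * c - cnj (cnj a * c)"
    by (simp only: complex_diff_cnj)
  then have "complex_of_real (- 2 * Im (cnj a * c)) = \<i> * (cnj a * c - cnj (cnj a * c))"
    by (simp add: complex_eq_iff)
  then have I: "complex_of_real (- 2 * Im (cnj a * c)) = \<i> * (cnj a * c - a / c)" by (simp add: ccinv)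
  have h: "c * D2 = \<mu> * (c - a)" using fix_c by (simp add: D2_def)
  have mD: "m * D1 = \<mu> * (z - a)" using nz by (simp add: m_def D1_def)
  have "(c - m) * D1 * D2 = c * D2 * D1 - m * D1 * D2" by (simp add: algebra_simps)
  also have "\<dots> = \<mu> * X * (c - z)" unfolding mD h by (simp add: D1_def D2_def X_def algebra_simps)
  finally have A: "(c - m) * D1 * D2 = \<mu> * X * (c - z)" .
  have split: "(P * S + Q * T) / (X * T) = P / X * (S / T) + Q / X" if "T \<noteq> 0" for P S Q T
    using that nz by (simp add: field_simps)
  have "(c + m) / (c - m) = 2 * c / (c - m) - 1" using cm by (simp add: field_simps)
  also have "2 * c / (c - m) = 2 * (c * D2) * D1 / ((c - m) * D1 * D2)" using nz by simp
  also have "\<dots> = 2 * (c - a) * D1 / (X * (c - z))" unfolding A h using nz by simp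
  also have "\<dots> - 1 = (2 * (c - a) * D1 - X * (c - z)) / (X * (c - z))" using nz cz by (simp add: field_simps)
  \<comment> \<open>The numerator is split along \<open>c + z\<close> and \<open>c - z\<close>.
    Since \<open>cnj c = 1 / c\<close>, the coefficient of \<open>c + z\<close> is
    \<open>|D2|^2\<close> and that of \<open>c - z\<close> is purely imaginary, which is why both
    affine coefficients come out real.\<close>
  also have "2 * (c - a) * D1 - X * (c - z) = D2 * (1 - a / c) * (c + z) + (cnj a * c - a / c) * (c - z)"
    using nz by (simp add: D1_def D2_def X_def field_simps power2_eq_square)
  finally have "(c + m) / (c - m) = D2 * (1 - a / c) / X * ((c + z) / (c - z)) + (cnj a * c - a / c) / X"
    by (simp only: split[OF cz])
  then have fin: "(c + m) / (c - m) = D2 * (1 - a / c) / X * ((c + z) / (c - z)) + (cnj a * c - a / c) / X" .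
  have "\<i> * (A * Y + B / X) = A * (\<i> * Y) + \<i> * B / X" for A B Y by (simp add: algebra_simps)
  then have "\<i> * ((c + m) / (c - m)) = D2 * (1 - a / c) / X * (\<i> * ((c + z) / (c - z))) + \<i> * (cnj a * c - a / c) / X"
    by (simp only: fin)
  then show ?thesis unfolding of_real_divide X N I by simp
qed

text \<open>The developing map in the half plane model: the metric becomes the pullback of
  \<open>|dz|^2 / (Im z)^2\<close>, for which automorphisms fixing infinity are translations and
  dilations.\<close>

lemma half_plane_developing:
  assumes f: "developing \<Lambda> f" and c: "norm c = 1"
  defines "G \<equiv> \<lambda>\<zeta>. \<i> * (c + f \<zeta>) / (c - f \<zeta>)"
  shows "G holomorphic_on {\<zeta>. Re \<zeta> < 0}" and "\<And>\<zeta>. Re \<zeta> < 0 \<Longrightarrow> Im (G \<zeta>) > 0"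
    and "\<And>\<zeta>. Re \<zeta> < 0 \<Longrightarrow> norm (deriv G \<zeta>) = Im (G \<zeta>) * \<Lambda> \<zeta>"
proof -
  have hol: "f holomorphic_on {\<zeta>. Re \<zeta> < 0}" and f1: "\<And>\<zeta>. Re \<zeta> < 0 \<Longrightarrow> norm (f \<zeta>) < 1"
    and f2: "\<And>\<zeta>. Re \<zeta> < 0 \<Longrightarrow> 2 * norm (deriv f \<zeta>) = (1 - (norm (f \<zeta>))\<^sup>2) * \<Lambda> \<zeta>"
    using f by (auto simp: developing_def)
  have d: "c - f \<zeta> \<noteq> 0" if "Re \<zeta> < 0" for \<zeta> using f1[OF that] c by auto
  show "G holomorphic_on {\<zeta>. Re \<zeta> < 0}" unfolding G_def using hol d by (intro holomorphic_intros) auto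
  fix \<zeta> :: complex assume \<zeta>: "Re \<zeta> < 0"
  have "Im (G \<zeta>) = Re ((c + f \<zeta>) / (c - f \<zeta>))" 
  proof -
    have "Im (\<i> * x) = Re x" for x by simp
    then show ?thesis unfolding G_def times_divide_eq_right[symmetric] .
  qed
  also have "\<dots> = ((norm c)\<^sup>2 - (norm (f \<zeta>))\<^sup>2) / (norm (c - f \<zeta>))\<^sup>2"
    unfolding Re_divide cmod_power2 by (simp add: power2_eq_square algebra_simps)
  finally have Im: "Im (G \<zeta>) = (1 - (norm (f \<zeta>))\<^sup>2) / (norm (c - f \<zeta>))\<^sup>2" using c by simp
  show "Im (G \<zeta>) > 0" unfolding Im using d[OF \<zeta>] one_minus_norm_square_pos[OF f1[OF \<zeta>]] by simp
  have df: "(f has_field_derivative deriv f \<zeta>) (at \<zeta>)"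
    using hol holomorphic_derivI[OF hol open_halfspace_Re_lt] \<zeta> by simp
  have "(G has_field_derivative \<i> * (2 * c) * deriv f \<zeta> / (c - f \<zeta>)\<^sup>2) (at \<zeta>)"
    unfolding G_def
    by (rule DERIV_cong, rule DERIV_divide[OF DERIV_cmult[OF DERIV_add[OF DERIV_const df]] DERIV_diff[OF DERIV_const df] d[OF \<zeta>]])
      (simp add: power2_eq_square algebra_simps)
  then have "norm (deriv G \<zeta>) = 2 * norm (deriv f \<zeta>) / (norm (c - f \<zeta>))\<^sup>2"
    using c by (simp add: DERIV_imp_deriv norm_mult norm_divide norm_power)
  then show "norm (deriv G \<zeta>) = Im (G \<zeta>) * \<Lambda> \<zeta>" unfolding f2[OF \<zeta>] Im by simp
qed

section \<open>Descent to the punctured disc\<close>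

text \<open>By periodicity the value of \<open>G\<close> at a logarithm of \<open>w\<close> does not
  depend on the branch. Holomorphy, also across the cut of \<open>Ln\<close>, is checked with the
  branch \<open>Ln w0 + Ln (w / w0)\<close>, which is holomorphic near \<open>w0\<close>.\<close>

lemma periodic_descends:
  assumes G: "G holomorphic_on {\<zeta>. Re \<zeta> < 0}"
    and per: "\<And>\<zeta>. Re \<zeta> < 0 \<Longrightarrow> G (\<zeta> + 2 * of_real pi * \<i>) = G \<zeta>"
  obtains \<Phi> where "\<Phi> holomorphic_on ball 0 1 - {0}" "\<And>\<zeta>. Re \<zeta> < 0 \<Longrightarrow> \<Phi> (exp \<zeta>) = G \<zeta>"
proof -
  have pern: "G (\<zeta> + of_nat n * (2 * of_real pi * \<i>)) = G \<zeta>" if "Re \<zeta> < 0" for \<zeta> n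
  proof (induction n)
    case (Suc n)
    have "G (\<zeta> + of_nat (Suc n) * (2 * of_real pi * \<i>)) = G ((\<zeta> + of_nat n * (2 * of_real pi * \<i>)) + 2 * of_real pi * \<i>)"
      by (simp add: algebra_simps)
    also have "\<dots> = G (\<zeta> + of_nat n * (2 * of_real pi * \<i>))" by (rule per) (use that in simp)
    finally show ?case using Suc.IH by simp
  qed simp
  have eq: "G x = G y" if xy: "exp x = exp y" "Re x < 0" for x y
  proof -
    obtain n :: int where n: "x = y + (of_int (2 * n) * pi) * \<i>" using xy(1) exp_eq by blast
    then have Re: "Re y < 0" using xy(2) by simp
    show ?thesis
    proof (cases "n \<ge> 0")
      case True
      then have "x = y + of_nat (nat n) * (2 * of_real pi * \<i>)" unfolding n by (simp add: algebra_simps)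
      then show ?thesis using pern[OF Re] by simp
    next
      case False
      then have "y = x + of_nat (nat (- n)) * (2 * of_real pi * \<i>)" unfolding n by (simp add: algebra_simps)
      then show ?thesis using pern[OF xy(2)] by simp
    qed
  qed
  show ?thesis
  proof
    show "(\<lambda>w. G (Ln w)) holomorphic_on ball 0 1 - {0}"
    proof (subst holomorphic_on_open)
      show "open (ball 0 1 - {0 :: complex})" by (simp add: open_delete)
      show "\<forall>w0\<in>ball 0 1 - {0}. \<exists>f'. ((\<lambda>w. G (Ln w)) has_field_derivative f') (at w0)"
      proof
        fix w0 :: complex assume w0: "w0 \<in> ball 0 1 - {0}"
        have e: "exp (Ln w0 + Ln (w / w0)) = w" if "w \<noteq> 0" for w
          using that w0 by (simp add: exp_add)
        have Re: "Re (Ln w0 + Ln (w / w0)) < 0" "Re (Ln w) < 0" if "w \<in> ball 0 1 - {0}" for w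
        proof -
          have "exp (Re (Ln w0 + Ln (w / w0))) = norm w" using e[of w] that norm_exp_eq_Re by (metis DiffD2 singletonI)
          then have "exp (Re (Ln w0 + Ln (w / w0))) < exp 0" using that by simp
          then show "Re (Ln w0 + Ln (w / w0)) < 0" by (simp only: exp_less_cancel_iff)
          show "Re (Ln w) < 0" using that by simp
        qed
        have quot: "((\<lambda>w. w / w0) has_field_derivative 1 / w0) (at w0)"
          using w0 by (auto intro!: derivative_eq_intros)
        have dLn: "(Ln has_field_derivative inverse (w0 / w0)) (at (w0 / w0))"
          by (rule has_field_derivative_Ln) (use w0 in auto)
        from DERIV_add[OF DERIV_const[of "Ln w0"] DERIV_chain2[where f = Ln and g = "\<lambda>w. w / w0", OF dLn quot]]
        have l: "((\<lambda>w. Ln w0 + Ln (w / w0)) has_field_derivative (0 + inverse (w0 / w0) * (1 / w0))) (at w0)" .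
        have "(G has_field_derivative deriv G (Ln w0 + Ln (w0 / w0))) (at (Ln w0 + Ln (w0 / w0)))"
          using holomorphic_derivI[OF G open_halfspace_Re_lt] Re(1)[OF w0] by blast
        from DERIV_chain2[OF this l]
        have "((\<lambda>w. G (Ln w0 + Ln (w / w0))) has_field_derivative
           deriv G (Ln w0 + Ln (w0 / w0)) * (0 + inverse (w0 / w0) * (1 / w0))) (at w0)" .
        then have "((\<lambda>w. G (Ln w)) has_field_derivative
           deriv G (Ln w0 + Ln (w0 / w0)) * (0 + inverse (w0 / w0) * (1 / w0))) (at w0)"
        proof (rule has_field_derivative_transform_within_open)
          show "open (ball 0 1 - {0 :: complex})" "w0 \<in> ball 0 1 - {0}" using w0 by (simp_all add: open_delete)
          show "G (Ln w0 + Ln (w / w0)) = G (Ln w)" if "w \<in> ball 0 1 - {0}" for w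
            by (rule eq) (use e[of w] Re[OF that] that in auto)
        qed
        then show "\<exists>f'. ((\<lambda>w. G (Ln w)) has_field_derivative f') (at w0)" by blast
      qed
    qed
    show "G (Ln (exp \<zeta>)) = G \<zeta>" if "Re \<zeta> < 0" for \<zeta>
      by (rule eq[symmetric]) (use that in auto)
  qed
qed

lemma periodic_bounded_descends:
  assumes G: "G holomorphic_on {\<zeta>. Re \<zeta> < 0}"
    and per: "\<And>\<zeta>. Re \<zeta> < 0 \<Longrightarrow> G (\<zeta> + 2 * of_real pi * \<i>) = G \<zeta>"
    and bd: "\<And>\<zeta>. Re \<zeta> < 0 \<Longrightarrow> norm (G \<zeta>) \<le> C"
  obtains \<Phi> where "\<Phi> holomorphic_on ball 0 1" "\<And>\<zeta>. Re \<zeta> < 0 \<Longrightarrow> \<Phi> (exp \<zeta>) = G \<zeta>"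
proof -
  obtain \<Phi> where \<Phi>: "\<Phi> holomorphic_on ball 0 1 - {0}" "\<And>\<zeta>. Re \<zeta> < 0 \<Longrightarrow> \<Phi> (exp \<zeta>) = G \<zeta>"
    using periodic_descends[OF G per] by blast
  have "norm (\<Phi> w) \<le> C" if "w \<in> ball 0 1 - {0}" for w
    using \<Phi>(2)[of "Ln w"] bd[of "Ln w"] that by simp
  then have "\<forall>\<^sub>F w in at 0. norm (\<Phi> w) \<le> C"
    unfolding eventually_at by (intro exI[of _ 1]) auto
  then obtain \<Psi> where \<Psi>: "\<Psi> holomorphic_on ball 0 1" "\<forall>w\<in>ball 0 1 - {0}. \<Psi> w = \<Phi> w"
    using holomorphic_on_extend_bounded[OF \<Phi>(1), of] by auto
  show ?thesis by (rule that[OF \<Psi>(1)]) (use \<Psi>(2) \<Phi>(2) in auto)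
qed

lemma nonvanishing_log_on_ball:
  assumes "g holomorphic_on ball 0 r" "\<And>w. w \<in> ball 0 r \<Longrightarrow> g w \<noteq> (0::complex)"
  obtains h where "h holomorphic_on ball 0 r" "\<And>w. w \<in> ball 0 r \<Longrightarrow> g w = exp (h w)"
  using contractible_imp_holomorphic_log[OF assms(1) convex_imp_contractible[OF convex_ball] assms(2)] by blast

text \<open>The argument principle on the universal cover: if \<open>g = exp h\<close>, then
  \<open>K \<zeta> - n \<zeta> - h (exp \<zeta>)\<close> is a logarithm of 1 and hence constant. As
  \<open>h (exp \<zeta>)\<close> has period \<open>2 \<pi> \<i>\<close>, the increment of
  \<open>K\<close> is that of \<open>n \<zeta>\<close>.\<close>

lemma log_period_eq_order:
  assumes r: "0 < r" "r \<le> 1" and g: "g holomorphic_on ball 0 r" "\<And>w. w \<in> ball 0 r \<Longrightarrow> g w \<noteq> 0"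
    and K: "K holomorphic_on {\<zeta>. Re \<zeta> < 0}"
    and eq: "\<And>\<zeta>. Re \<zeta> < ln r \<Longrightarrow> exp (K \<zeta>) = exp \<zeta> ^ n * g (exp \<zeta>)"
    and \<zeta>: "Re \<zeta> < ln r"
  shows "K (\<zeta> + 2 * of_real pi * \<i>) = K \<zeta> + of_nat n * (2 * of_real pi * \<i>)"
proof -
  obtain h where h: "h holomorphic_on ball 0 r" "\<And>w. w \<in> ball 0 r \<Longrightarrow> g w = exp (h w)"
    using nonvanishing_log_on_ball[OF g] by blast
  let ?S = "{\<zeta>. Re \<zeta> < ln r}"
  have S: "open ?S" "convex ?S" by (auto simp: open_halfspace_Re_lt convex_halfspace_Re_lt)
  have lnr: "ln r \<le> 0" using r by simp
  have ball: "exp \<zeta> \<in> ball 0 r" if "Re \<zeta> < ln r" for \<zeta> :: complex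
  proof -
    have "exp (Re \<zeta>) < exp (ln r)" using that by simp
    then show ?thesis using r by simp
  qed
  define E where "E = (\<lambda>\<zeta>. K \<zeta> - of_nat n * \<zeta> - h (exp \<zeta>))"
  have "(\<lambda>\<zeta>. h (exp \<zeta>)) holomorphic_on ?S"
    by (rule holomorphic_on_compose_gen[OF _ h(1), unfolded o_def]) (use ball in \<open>auto intro: holomorphic_intros\<close>)
  moreover have "K holomorphic_on ?S" by (rule holomorphic_on_subset[OF K]) (use lnr in auto)
  ultimately have E: "E holomorphic_on ?S" unfolding E_def by (intro holomorphic_intros)
  have E1: "exp (E \<zeta>) = 1" if "\<zeta> \<in> ?S" for \<zeta>
    using eq[of \<zeta>] h(2)[OF ball, of \<zeta>] that by (simp add: E_def exp_diff exp_of_nat_mult)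
  have "(E has_field_derivative 0) (at \<zeta> within ?S)" if "\<zeta> \<in> ?S" for \<zeta>
  proof -
    have d: "(E has_field_derivative deriv E \<zeta>) (at \<zeta>)" using holomorphic_derivI[OF E S(1) that] .
    have "((\<lambda>\<zeta>. exp (E \<zeta>)) has_field_derivative exp (E \<zeta>) * deriv E \<zeta>) (at \<zeta>)"
      by (rule DERIV_chain2[OF DERIV_exp d])
    moreover have "((\<lambda>\<zeta>. exp (E \<zeta>)) has_field_derivative 0) (at \<zeta>)"
      by (rule has_field_derivative_transform_within_open[OF DERIV_const S(1) that]) (use E1 in auto)
    ultimately have "exp (E \<zeta>) * deriv E \<zeta> = 0" by (rule DERIV_unique)
    then show ?thesis using d by (auto intro: has_field_derivative_at_within)
  qed
  then have "\<exists>c. \<forall>\<zeta>\<in>?S. E \<zeta> = c" by (rule has_field_derivative_zero_constant[OF S(2)])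
  then have "E (\<zeta> + 2 * of_real pi * \<i>) = E \<zeta>" using \<zeta> by force
  moreover have "exp (\<zeta> + 2 * of_real pi * \<i>) = exp \<zeta>" by (simp add: exp_add)
  ultimately show ?thesis by (simp add: E_def algebra_simps)
qed

lemma zero_order_factor:
  assumes \<Phi>: "\<Phi> holomorphic_on ball 0 1" "\<And>w. w \<in> ball 0 1 - {0} \<Longrightarrow> \<Phi> w \<noteq> 0"
  obtains n g r where "0 < r" "r \<le> (1::real)" "g holomorphic_on ball 0 r" "\<And>w. w \<in> ball 0 r \<Longrightarrow> g w \<noteq> 0"
    "\<And>w. w \<in> ball 0 r \<Longrightarrow> \<Phi> w = w ^ n * g w"  "\<Phi> 0 \<noteq> 0 \<Longrightarrow> n = 0"
proof (cases "\<Phi> 0 = 0")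
  case False
  then have "\<Phi> w \<noteq> 0" if "w \<in> ball 0 1" for w using \<Phi>(2)[of w] that by (cases "w = 0") auto
  then show ?thesis by (intro that[of 1 \<Phi> 0]) (use \<Phi>(1) in auto)
next
  case True
  have nc: "\<not> \<Phi> constant_on ball 0 1"
  proof
    assume "\<Phi> constant_on ball 0 1"
    then have "\<Phi> (1/2) = \<Phi> 0" unfolding constant_on_def by force
    then show False using True \<Phi>(2)[of "1/2"] by (simp add: norm_divide)
  qed
  obtain g r n where g: "0 < n" "0 < r" "ball 0 r \<subseteq> ball (0::complex) (1::real)" "g holomorphic_on ball 0 r"
            "\<And>w. w \<in> ball 0 r \<Longrightarrow> \<Phi> w = (w - 0)^n * g w" "\<And>w. w \<in> ball 0 r \<Longrightarrow> g w \<noteq> 0"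
    by (rule holomorphic_factor_zero_nonconstant[OF \<Phi>(1) open_ball convex_connected[OF convex_ball] _ True nc])
      simp_all
  from g(2,3) have "r \<le> 1" by (simp add: ball_subset_ball_iff)
  then show ?thesis using True g by (intro that[of r g n]) auto
qed

section \<open>Normal coordinates from the developing map\<close>

text \<open>The normal form is an equation for the potential alone, which is what a developing map
  provides. The bound \<open>\<epsilon> \<le> 1\<close> keeps the punctured ball inside the
  punctured unit disc.\<close>

definition hyperbolic_cone_at :: "(complex \<Rightarrow> real) \<Rightarrow> real \<Rightarrow> real \<Rightarrow> (complex \<Rightarrow> complex) \<Rightarrow> bool" where
  "hyperbolic_cone_at u \<beta> \<epsilon> z \<longleftrightarrow> 0 < \<epsilon> \<and> \<epsilon> \<le> 1 \<and> complex_coordinate (ball 0 \<epsilon>) z \<and> z 0 = 0 \<and>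
    (\<forall>w \<in> ball 0 \<epsilon> - {0}. exp (2 * u w) =
      4 * \<beta>\<^sup>2 * norm (z w) powr (2 * \<beta> - 2) / (1 - norm (z w) powr (2 * \<beta>))\<^sup>2 * (norm (deriv z w))\<^sup>2)"

definition hyperbolic_cusp_at :: "(complex \<Rightarrow> real) \<Rightarrow> real \<Rightarrow> (complex \<Rightarrow> complex) \<Rightarrow> bool" where
  "hyperbolic_cusp_at u \<epsilon> z \<longleftrightarrow> 0 < \<epsilon> \<and> \<epsilon> \<le> 1 \<and> complex_coordinate (ball 0 \<epsilon>) z \<and> z 0 = 0 \<and>
    (\<forall>w \<in> ball 0 \<epsilon> - {0}. exp (2 * u w) =
      norm (z w) powi (-2) * ln (norm (z w)) powi (-2) * (norm (deriv z w))\<^sup>2)"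

text \<open>Write \<open>\<Phi> = w^n exp h\<close> near 0, with \<open>n > 0\<close>. Then
  \<open>F = exp (\<beta> \<zeta> + h)\<close> for \<open>\<beta> = \<alpha> + n\<close>, and
  \<open>z = w exp (h / \<beta>)\<close> is a single-valued coordinate with
  \<open>|F| = |z|^\<beta>\<close>. The condition on \<open>\<alpha>\<close> excludes
  \<open>\<beta> = 0\<close>, and \<open>|F| < 1\<close> excludes
  \<open>\<beta> < 0\<close>.\<close>

lemma conical_coordinate_of_developing_map:
  assumes F: "developing (\<lambda>\<zeta>. exp (u (exp \<zeta>)) * norm (exp \<zeta>)) F"
    and rep: "\<And>\<zeta>. Re \<zeta> < 0 \<Longrightarrow> F \<zeta> = exp (of_real \<alpha> * \<zeta>) * \<Phi> (exp \<zeta>)"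
    and \<Phi>: "\<Phi> holomorphic_on ball 0 1" "\<Phi> 0 = 0"
    and \<alpha>: "\<alpha> \<ge> 0 \<or> \<alpha> \<notin> \<int>"
  shows "\<exists>\<beta>>0. \<exists>\<epsilon> z. hyperbolic_cone_at u \<beta> \<epsilon> z"
proof -
  let ?L = "{\<zeta>. Re \<zeta> < 0}"
  have holF: "F holomorphic_on ?L" and F1: "\<And>\<zeta>. Re \<zeta> < 0 \<Longrightarrow> norm (F \<zeta>) < 1"
    and F2: "\<And>\<zeta>. Re \<zeta> < 0 \<Longrightarrow> 2 * norm (deriv F \<zeta>) = (1 - (norm (F \<zeta>))\<^sup>2) * (exp (u (exp \<zeta>)) * norm (exp \<zeta>))"
    using F by (auto simp: developing_def)
  have nc: "\<not> \<Phi> constant_on ball 0 1"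
  proof
    assume "\<Phi> constant_on ball 0 1"
    then have "\<Phi> w = 0" if "w \<in> ball 0 1" for w using \<Phi>(2) that unfolding constant_on_def by force
    then have z: "F \<zeta> = 0" if "\<zeta> \<in> ?L" for \<zeta> using rep[of \<zeta>] that by simp
    have "(F has_field_derivative 0) (at (-1))"
      by (rule has_field_derivative_transform_within_open[OF DERIV_const open_halfspace_Re_lt[of 0]]) (use z in auto)
    then show False using F2[of "-1"] z[of "-1"] by (simp add: DERIV_imp_deriv)
  qed
  obtain g r n where n: "0 < n" and r: "0 < r" "ball 0 r \<subseteq> ball (0::complex) (1::real)"
    and g: "g holomorphic_on ball 0 r"
      "\<And>w. w \<in> ball 0 r \<Longrightarrow> \<Phi> w = (w - 0)^n * g w" "\<And>w. w \<in> ball 0 r \<Longrightarrow> g w \<noteq> 0"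
    by (rule holomorphic_factor_zero_nonconstant[OF \<Phi>(1) open_ball convex_connected[OF convex_ball] _ \<Phi>(2) nc])
      simp_all
  have r1: "r \<le> 1" using r by (simp add: ball_subset_ball_iff)
  define \<beta> where "\<beta> = \<alpha> + real n"
  obtain h where h: "h holomorphic_on ball 0 r" "\<And>w. w \<in> ball 0 r \<Longrightarrow> g w = exp (h w)"
    using nonvanishing_log_on_ball[OF g(1,3)] by blast
  have ball: "exp \<zeta> \<in> ball 0 r" "Re \<zeta> < 0" if "Re \<zeta> < ln r" for \<zeta> :: complex
  proof -
    have "exp (Re \<zeta>) < exp (ln r)" using that by simp
    then show "exp \<zeta> \<in> ball 0 r" using r by simp
    show "Re \<zeta> < 0" using that r r1 by (smt (verit) ln_le_zero_iff)
  qed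
  have Feq: "F \<zeta> = exp (of_real \<beta> * \<zeta> + h (exp \<zeta>))" if "Re \<zeta> < ln r" for \<zeta>
    using rep[OF ball(2)[OF that]] g(2)[OF ball(1)[OF that]] h(2)[OF ball(1)[OF that]]
    by (simp add: \<beta>_def exp_add distrib_right exp_of_nat_mult)
  \<comment> \<open>For negative \<open>\<beta>\<close> the bound \<open>|F| < 1\<close> gives
    \<open>|g w| \<le> |w|^(-\<beta>)\<close>, which would force the nonvanishing \<open>g\<close>
    to be 0 at 0.\<close>
  have "\<beta> \<ge> 0"
  proof (rule ccontr)
    assume neg: "\<not> \<beta> \<ge> 0"
    have "((\<lambda>w. norm (g w)) \<longlongrightarrow> norm (g 0)) (at 0)"
      using holomorphic_on_imp_continuous_on[OF g(1)] r
      by (intro tendsto_norm) (simp add: continuous_on_eq_continuous_at isCont_def)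
    moreover have "((\<lambda>w::complex. norm w powr (- \<beta>)) \<longlongrightarrow> 0) (at 0)"
      using neg by (auto intro!: tendsto_eq_intros)
    moreover have "\<forall>\<^sub>F w in at 0. norm (g w) \<le> norm w powr (- \<beta>)"
      unfolding eventually_at
    proof (intro exI[of _ r] conjI ballI impI)
      fix w :: complex assume w: "w \<noteq> 0 \<and> dist w 0 < r"
      then have "Re (Ln w) < ln r" using r(1) by simp
      from Feq[OF this] F1[OF ball(2)[OF this]] w h(2)[of w]
      have "norm (exp (of_real \<beta> * Ln w)) * norm (g w) < 1" by (simp add: exp_add norm_mult)
      moreover have "norm (exp (of_real \<beta> * Ln w)) = norm w powr \<beta>" using w by (simp add: powr_def)
      ultimately show "norm (g w) \<le> norm w powr (- \<beta>)"
        using w by (simp add: powr_minus field_simps)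
    qed (use r in simp)
    ultimately have "norm (g 0) \<le> 0" using tendsto_le[OF at_neq_bot] by blast
    then show False using g(3)[of 0] r by simp
  qed
  moreover have "\<beta> \<noteq> 0"
  proof
    assume "\<beta> = 0"
    then have "\<alpha> = - of_nat n" by (simp add: \<beta>_def)
    then show False using \<alpha> n by auto
  qed
  ultimately have \<beta>: "\<beta> > 0" by simp
  define z where "z = (\<lambda>w. w * exp (h w / of_real \<beta>))"
  have z: "z holomorphic_on ball 0 r" unfolding z_def using h(1) \<beta> by (intro holomorphic_intros) auto
  have dz: "deriv z w = exp (h w / of_real \<beta>) * (1 + w * deriv h w / of_real \<beta>)" if "w \<in> ball 0 r" for w
  proof (rule DERIV_imp_deriv)
    have "(h has_field_derivative deriv h w) (at w)" using holomorphic_derivI[OF h(1) open_ball that] .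
    from DERIV_mult[OF DERIV_ident DERIV_chain2[OF DERIV_exp DERIV_cdivide[OF this, of "of_real \<beta>"]]]
    show "(z has_field_derivative exp (h w / of_real \<beta>) * (1 + w * deriv h w / of_real \<beta>)) (at w)"
      unfolding z_def by (rule DERIV_cong) (simp add: algebra_simps)
  qed
  have dz0: "deriv z 0 \<noteq> 0" and c0: "0 \<in> ball (0::complex) r" using dz[of 0] r by simp_all
  obtain \<epsilon> where \<epsilon>: "\<epsilon> > 0" "ball (0::complex) \<epsilon> \<subseteq> ball 0 r" "inj_on z (ball 0 \<epsilon>)"
    by (rule has_complex_derivative_locally_injective[OF z c0 open_ball dz0]) (rule that)
  have "complex_coordinate (ball 0 \<epsilon>) z"
    unfolding complex_coordinate_def using z \<epsilon> holomorphic_on_subset by blast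
  moreover have "exp (2 * u w) =
      4 * \<beta>\<^sup>2 * norm (z w) powr (2 * \<beta> - 2) / (1 - norm (z w) powr (2 * \<beta>))\<^sup>2 * (norm (deriv z w))\<^sup>2"
    if w: "w \<in> ball 0 \<epsilon> - {0}" for w
  proof -
    define \<zeta> where "\<zeta> = Ln w"
    have wr: "w \<in> ball 0 r" "w \<noteq> 0" using w \<epsilon>(2) by auto
    then have \<zeta>: "Re \<zeta> < ln r" "exp \<zeta> = w" using r(1) by (simp_all add: \<zeta>_def)
    define s where "s = norm (z w)"
    have s0: "s > 0" using wr by (simp add: s_def z_def)
    have nF: "norm (F \<zeta>) = s powr \<beta>"
    proof -
      have "s = norm (exp (\<zeta> + h w / of_real \<beta>))" by (simp add: s_def z_def \<zeta> exp_add)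
      then have "s = exp (Re (\<zeta> + h w / of_real \<beta>))" by (simp only: norm_exp_eq_Re)
      then have "s powr \<beta> = exp (\<beta> * Re (\<zeta> + h w / of_real \<beta>))" by (simp add: powr_def)
      also have "\<beta> * Re (\<zeta> + h w / of_real \<beta>) = Re (of_real \<beta> * \<zeta> + h w)"
        using \<beta> by (simp add: field_simps)
      finally show ?thesis using Feq[OF \<zeta>(1)] \<zeta>(2) by (simp only: norm_exp_eq_Re)
    qed
    have hw: "(h has_field_derivative deriv h w) (at (exp \<zeta>))" using holomorphic_derivI[OF h(1) open_ball wr(1)] \<zeta>(2) by simp
    have "((\<lambda>\<zeta>. exp (of_real \<beta> * \<zeta> + h (exp \<zeta>))) has_field_derivative
        exp (of_real \<beta> * \<zeta> + h (exp \<zeta>)) * (of_real \<beta> + deriv h w * exp \<zeta>)) (at \<zeta>)"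
      by (rule DERIV_cong, rule DERIV_chain2[OF DERIV_exp DERIV_add[OF DERIV_cmult[OF DERIV_ident] DERIV_chain2[OF hw DERIV_exp]]]) simp
    then have "(F has_field_derivative exp (of_real \<beta> * \<zeta> + h (exp \<zeta>)) * (of_real \<beta> + deriv h w * exp \<zeta>)) (at \<zeta>)"
      by (rule has_field_derivative_transform_within_open[OF _ open_halfspace_Re_lt[of "ln r"]]) (use \<zeta>(1) Feq in auto)
    \<comment> \<open>The logarithmic derivative in cleared form,
      \<open>z F' = \<beta> w z' F\<close>: on the half plane \<open>F\<close> is a branch of the
      \<open>\<beta>\<close>-th power of \<open>z\<close>.\<close>
    then have "deriv F \<zeta> = F \<zeta> * (of_real \<beta> + deriv h w * w)" using Feq[OF \<zeta>(1)] \<zeta>(2) by (simp add: DERIV_imp_deriv)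
    also have "\<dots> * z w = F \<zeta> * of_real \<beta> * w * deriv z w"
      unfolding dz[OF wr(1)] using \<beta> by (simp add: z_def field_simps)
    finally have "norm (deriv F \<zeta>) * s = s powr \<beta> * \<beta> * norm w * norm (deriv z w)"
      using \<beta> nF s0 unfolding s_def by (metis abs_of_pos norm_mult norm_of_real)
    moreover have "2 * norm (deriv F \<zeta>) = (1 - (s powr \<beta>)\<^sup>2) * (exp (u w) * norm w)"
      using F2[OF ball(2)[OF \<zeta>(1)]] \<zeta>(2) nF by simp
    ultimately have "(1 - (s powr \<beta>)\<^sup>2) * (exp (u w) * norm w) * s = 2 * (s powr \<beta> * \<beta> * norm w * norm (deriv z w))"
      by (metis mult.assoc)
    then have "(1 - (s powr \<beta>)\<^sup>2) * exp (u w) * s * norm w = 2 * s powr \<beta> * \<beta> * norm (deriv z w) * norm w"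
      by (simp only: mult_ac)
    moreover have nw: "norm w \<noteq> 0" using wr(2) by simp
    ultimately have "(1 - (s powr \<beta>)\<^sup>2) * exp (u w) * s = 2 * s powr \<beta> * \<beta> * norm (deriv z w)"
      by (simp only: mult_right_cancel[OF nw])
    moreover have D: "1 - (s powr \<beta>)\<^sup>2 > 0"
      using one_minus_norm_square_pos[OF F1[OF ball(2)[OF \<zeta>(1)]]] nF by simp
    ultimately have "exp (u w) = 2 * \<beta> * (s powr \<beta> / s) * norm (deriv z w) / (1 - (s powr \<beta>)\<^sup>2)"
      using s0 by (simp add: field_simps)
    then have "(exp (u w))\<^sup>2 = 4 * \<beta>\<^sup>2 * (s powr \<beta> / s)\<^sup>2 / (1 - (s powr \<beta>)\<^sup>2)\<^sup>2 * (norm (deriv z w))\<^sup>2"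
      by (simp add: power_mult_distrib power_divide)
    moreover have "(exp (u w))\<^sup>2 = exp (2 * u w)" by (simp add: exp_double)
    moreover have "(s powr \<beta> / s)\<^sup>2 = s powr (2 * \<beta> - 2)"
    proof -
      have "s powr \<beta> / s = s powr (\<beta> - 1)" using s0 by (simp add: powr_diff)
      then show ?thesis using s0 by (simp add: power2_eq_square flip: powr_add)
    qed
    moreover have "(s powr \<beta>)\<^sup>2 = s powr (2 * \<beta>)" using s0 by (simp add: power2_eq_square flip: powr_add)
    ultimately show ?thesis by (simp add: s_def)
  qed
  moreover have "\<epsilon> \<le> 1" using \<epsilon> r1 by (simp add: ball_subset_ball_iff)
  moreover have "z 0 = 0" by (simp add: z_def)
  ultimately show ?thesis using \<beta> \<epsilon>(1) unfolding hyperbolic_cone_at_def by blast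
qed

text \<open>After scaling the translation to length \<open>2 \<pi>\<close>, the exponential
  \<open>exp K\<close> descends to a function \<open>\<Phi>\<close> with a simple zero at 0, which
  is the coordinate. As \<open>ln |\<Phi>| = - 2 \<pi> Im G / b\<close>, the length element
  \<open>|dG| / Im G\<close> is \<open>|d\<Phi>| / (|\<Phi>| (- ln |\<Phi>|))\<close>.\<close>

lemma cusp_coordinate_of_developing_map:
  fixes G :: "complex \<Rightarrow> complex"
  assumes G: "G holomorphic_on {\<zeta>. Re \<zeta> < 0}" "\<And>\<zeta>. Re \<zeta> < 0 \<Longrightarrow> Im (G \<zeta>) > 0"
      "\<And>\<zeta>. Re \<zeta> < 0 \<Longrightarrow> norm (deriv G \<zeta>) = Im (G \<zeta>) * (exp (u (exp \<zeta>)) * norm (exp \<zeta>))"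
    and B: "\<And>\<zeta>. Re \<zeta> < 0 \<Longrightarrow> G (\<zeta> + 2 * of_real pi * \<i>) = G \<zeta> + of_real B" "B \<noteq> 0"
  shows "\<exists>\<epsilon> z. hyperbolic_cusp_at u \<epsilon> z"
proof -
  \<comment> \<open>The sign of \<open>B\<close> is not known at this point; scaling by
    \<open>|B|\<close> ensures \<open>|exp K| < 1\<close> in either case.\<close>
  define b where "b = \<bar>B\<bar>"
  have b: "b > 0" using B(2) by (simp add: b_def)
  define K where "K = (\<lambda>\<zeta>. 2 * of_real pi * \<i> / of_real b * G \<zeta>)"
  have K: "K holomorphic_on {\<zeta>. Re \<zeta> < 0}" unfolding K_def using G(1) by (intro holomorphic_intros)
  have ReK: "Re (K \<zeta>) = - 2 * pi / b * Im (G \<zeta>)" for \<zeta>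
    by (simp add: K_def Re_divide_of_real)
  have Kper: "K (\<zeta> + 2 * of_real pi * \<i>) = K \<zeta> + of_real (sgn B) * (2 * of_real pi * \<i>)" if "Re \<zeta> < 0" for \<zeta>
    unfolding K_def B(1)[OF that] using b B(2) by (simp add: field_simps b_def sgn_if)
  obtain \<Phi> where \<Phi>: "\<Phi> holomorphic_on ball 0 1" "\<And>\<zeta>. Re \<zeta> < 0 \<Longrightarrow> \<Phi> (exp \<zeta>) = exp (K \<zeta>)"
  proof (rule periodic_bounded_descends[where G = "\<lambda>\<zeta>. exp (K \<zeta>)" and C = 1])
    show "(\<lambda>\<zeta>. exp (K \<zeta>)) holomorphic_on {\<zeta>. Re \<zeta> < 0}" using K by (intro holomorphic_intros)
    fix \<zeta> :: complex assume \<zeta>: "Re \<zeta> < 0"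
    have "exp (of_real (sgn B) * (2 * of_real pi * \<i>)) = 1"
      using B(2) by (auto simp: sgn_if exp_minus)
    then show "exp (K (\<zeta> + 2 * of_real pi * \<i>)) = exp (K \<zeta>)" unfolding Kper[OF \<zeta>] exp_add by simp
    show "norm (exp (K \<zeta>)) \<le> 1" unfolding norm_exp_eq_Re ReK using G(2)[OF \<zeta>] b by simp
  qed blast
  have \<Phi>0: "\<Phi> w \<noteq> 0" if "w \<in> ball 0 1 - {0}" for w
    using \<Phi>(2)[of "Ln w"] that by auto
  obtain n g r where r: "0 < r" "r \<le> (1::real)" and g: "g holomorphic_on ball 0 r" "\<And>w. w \<in> ball 0 r \<Longrightarrow> g w \<noteq> 0"
    "\<And>w. w \<in> ball 0 r \<Longrightarrow> \<Phi> w = w ^ n * g w"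
    using zero_order_factor[OF \<Phi>(1) \<Phi>0] by metis
  have ball: "exp \<zeta> \<in> ball 0 r" "Re \<zeta> < 0" if "Re \<zeta> < ln r" for \<zeta> :: complex
  proof -
    have "exp (Re \<zeta>) < exp (ln r)" using that by simp
    then show "exp \<zeta> \<in> ball 0 r" using r by simp
    show "Re \<zeta> < 0" using that r by (smt (verit) ln_le_zero_iff)
  qed
  \<comment> \<open>The increment of \<open>K\<close> is \<open>2 \<pi> \<i>\<close> times
    \<open>sgn B\<close> and also times the order \<open>n\<close> of \<open>\<Phi>\<close> at 0. As
    \<open>n\<close> is a natural number, \<open>B\<close> is positive and the zero is
    simple.\<close>
  have "n = 1"
  proof -
    have K\<Phi>: "exp (K \<zeta>) = exp \<zeta> ^ n * g (exp \<zeta>)" if "Re \<zeta> < ln r" for \<zeta>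
      using \<Phi>(2)[OF ball(2)[OF that]] g(3)[OF ball(1)[OF that]] by simp
    have \<zeta>: "Re (of_real (ln r - 1)) < ln r" by simp
    have "K (of_real (ln r - 1) + 2 * of_real pi * \<i>) = K (of_real (ln r - 1)) + of_nat n * (2 * of_real pi * \<i>)"
      by (rule log_period_eq_order[OF r g(1,2) K K\<Phi> \<zeta>])
    then have "of_real (sgn B) * (2 * of_real pi * \<i>) = of_nat n * (2 * of_real pi * \<i>)"
      using Kper[OF ball(2)[OF \<zeta>]] by simp
    then have "complex_of_real (sgn B) = of_real (real n)" by simp
    then have "sgn B = real n" by (simp only: of_real_eq_iff)
    then show ?thesis using B(2) by (auto simp: sgn_if split: if_splits)
  qed
  then have \<Phi>g: "\<Phi> w = w * g w" if "w \<in> ball 0 r" for w using g(3)[OF that] by simp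
  have z: "\<Phi> holomorphic_on ball 0 r" by (rule holomorphic_on_subset[OF \<Phi>(1)]) (use r in auto)
  have c0: "0 \<in> ball (0::complex) r" using r by simp
  have dz0: "deriv \<Phi> 0 \<noteq> 0"
  proof -
    have "((\<lambda>w. w * g w) has_field_derivative g 0) (at 0)"
      by (rule DERIV_cong, rule DERIV_mult[OF DERIV_ident holomorphic_derivI[OF g(1) open_ball]]) (use r in auto)
    then have "(\<Phi> has_field_derivative g 0) (at 0)"
      by (rule has_field_derivative_transform_within_open[OF _ open_ball[of 0 r]]) (use r \<Phi>g in auto)
    then show ?thesis using g(2)[of 0] r by (simp add: DERIV_imp_deriv)
  qed
  obtain \<epsilon> where \<epsilon>: "\<epsilon> > 0" "ball (0::complex) \<epsilon> \<subseteq> ball 0 r" "inj_on \<Phi> (ball 0 \<epsilon>)"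
    by (rule has_complex_derivative_locally_injective[OF z c0 open_ball dz0]) (rule that)
  have "complex_coordinate (ball 0 \<epsilon>) \<Phi>"
    unfolding complex_coordinate_def using z \<epsilon> holomorphic_on_subset by blast
  moreover have "exp (2 * u w) = norm (\<Phi> w) powi (-2) * ln (norm (\<Phi> w)) powi (-2) * (norm (deriv \<Phi> w))\<^sup>2"
    if w: "w \<in> ball 0 \<epsilon> - {0}" for w
  proof -
    define \<zeta> where "\<zeta> = Ln w"
    have wr: "w \<in> ball 0 r" "w \<noteq> 0" using w \<epsilon>(2) by auto
    then have "Re \<zeta> < ln r" and \<zeta>: "exp \<zeta> = w" using r(1) by (simp_all add: \<zeta>_def)
    then have Re: "Re \<zeta> < 0" using ball by blast
    have n\<Phi>: "norm (\<Phi> w) = exp (Re (K \<zeta>))" using \<Phi>(2)[OF Re] \<zeta> by simp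
    have "(\<Phi> has_field_derivative deriv \<Phi> w) (at (exp \<zeta>))" using holomorphic_derivI[OF z open_ball wr(1)] \<zeta> by simp
    from DERIV_chain2[OF this DERIV_exp]
    have "((\<lambda>\<zeta>. \<Phi> (exp \<zeta>)) has_field_derivative deriv \<Phi> w * exp \<zeta>) (at \<zeta>)" .
    moreover have "((\<lambda>\<zeta>. exp (K \<zeta>)) has_field_derivative exp (K \<zeta>) * (2 * of_real pi * \<i> / of_real b * deriv G \<zeta>)) (at \<zeta>)"
      unfolding K_def using holomorphic_derivI[OF G(1) open_halfspace_Re_lt, of \<zeta>] Re
      by (intro DERIV_chain2[OF DERIV_exp] DERIV_cmult) simp
    then have "((\<lambda>\<zeta>. \<Phi> (exp \<zeta>)) has_field_derivative exp (K \<zeta>) * (2 * of_real pi * \<i> / of_real b * deriv G \<zeta>)) (at \<zeta>)"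
      by (rule has_field_derivative_transform_within_open[OF _ open_halfspace_Re_lt[of 0]]) (use Re \<Phi>(2) in auto)
    ultimately have "deriv \<Phi> w * exp \<zeta> = exp (K \<zeta>) * (2 * of_real pi * \<i> / of_real b * deriv G \<zeta>)"
      by (rule DERIV_unique)
    then have "norm (deriv \<Phi> w * exp \<zeta>) = norm (exp (K \<zeta>) * (2 * of_real pi * \<i> / of_real b * deriv G \<zeta>))" by simp
    then have "norm (deriv \<Phi> w) * norm w = norm (\<Phi> w) * (2 * pi / b * norm (deriv G \<zeta>))"
      using b \<Phi>(2)[OF Re] unfolding \<zeta> by (simp add: norm_mult norm_divide)
    also have "\<dots> = norm (\<Phi> w) * (- ln (norm (\<Phi> w))) * exp (u w) * norm w"
      unfolding G(3)[OF Re] n\<Phi> using \<zeta> by (simp add: ReK)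
    finally have "norm (deriv \<Phi> w) * norm w = norm (\<Phi> w) * (- ln (norm (\<Phi> w))) * exp (u w) * norm w" .
    moreover have nw: "norm w \<noteq> 0" using wr(2) by simp
    ultimately have eq: "norm (deriv \<Phi> w) = norm (\<Phi> w) * (- ln (norm (\<Phi> w))) * exp (u w)"
      by (simp only: mult_right_cancel[OF nw])
    have "norm (\<Phi> w) > 0" "ln (norm (\<Phi> w)) \<noteq> 0" using n\<Phi> ReK[of \<zeta>] G(2)[OF Re] b by simp_all
    moreover have "exp (2 * u w) = (exp (u w))\<^sup>2" by (simp add: exp_double)
    ultimately show ?thesis unfolding eq
      by (simp add: power_int_minus power_mult_distrib divide_simps)
  qed
  moreover have "\<epsilon> \<le> 1" using \<epsilon> r by (simp add: ball_subset_ball_iff)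
  moreover have "\<Phi> 0 = 0" using \<Phi>g[of 0] r by simp
  ultimately show ?thesis using \<epsilon>(1) unfolding hyperbolic_cusp_at_def by blast
qed

text \<open>
  The function \<open>exp (2 \<pi> i Ln G / ln A)\<close> descends to the punctured disc and is bounded away from 0
  and infinity, so it has no winding around 0, whereas its logarithm increases by \<open>2 \<pi> i\<close>.
\<close>

lemma no_hyperbolic_monodromy:
  fixes G :: "complex \<Rightarrow> complex"
  assumes G: "G holomorphic_on {\<zeta>. Re \<zeta> < 0}" "\<And>\<zeta>. Re \<zeta> < 0 \<Longrightarrow> Im (G \<zeta>) > 0"
    and A: "\<And>\<zeta>. Re \<zeta> < 0 \<Longrightarrow> G (\<zeta> + 2 * of_real pi * \<i>) = of_real A * G \<zeta>" "A > 0" "A \<noteq> 1"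
  shows False
proof -
  define a where "a = ln A"
  have a: "a \<noteq> 0" using A by (simp add: a_def)
  define K where "K = (\<lambda>\<zeta>. 2 * of_real pi * \<i> / of_real a * Ln (G \<zeta>))"
  have K: "K holomorphic_on {\<zeta>. Re \<zeta> < 0}" unfolding K_def
    using G by (intro holomorphic_intros) (force simp: complex_nonpos_Reals_iff)+
  have Kper: "K (\<zeta> + 2 * of_real pi * \<i>) = K \<zeta> + 2 * of_real pi * \<i>" if "Re \<zeta> < 0" for \<zeta>
  proof -
    have "G \<zeta> \<noteq> 0" using G(2)[OF that] by auto
    then have "Ln (G (\<zeta> + 2 * of_real pi * \<i>)) = of_real a + Ln (G \<zeta>)"
      unfolding A(1)[OF that] a_def using A(2) by (simp add: Ln_times_of_real Ln_of_real)
    then show ?thesis unfolding K_def using a by (simp add: field_simps)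
  qed
  \<comment> \<open>\<open>G\<close> stays in the upper half plane, so its argument is bounded.
    Multiplication by \<open>2 \<pi> \<i> / a\<close> turns this into a bound on the real part of
    \<open>K\<close> from both sides.\<close>
  have bound: "\<bar>Re (K \<zeta>)\<bar> \<le> 2 * pi * pi / \<bar>a\<bar>" if "Re \<zeta> < 0" for \<zeta>
  proof -
    have "Re (K \<zeta>) = - 2 * pi / a * Im (Ln (G \<zeta>))" by (simp add: K_def Re_divide_of_real)
    moreover have "\<bar>Im (Ln (G \<zeta>))\<bar> \<le> pi"
      using G(2)[OF that] by (cases "G \<zeta> = 0") (auto simp: abs_le_iff mpi_less_Im_Ln Im_Ln_le_pi less_imp_le minus_le_iff)
    ultimately show ?thesis by (simp add: abs_mult abs_divide divide_right_mono mult_left_mono)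
  qed
  define C where "C = exp (2 * pi * pi / \<bar>a\<bar>)"
  have nK: "norm (exp (K \<zeta>)) \<le> C" "norm (exp (K \<zeta>)) \<ge> 1 / C" if "Re \<zeta> < 0" for \<zeta>
    using bound[OF that] by (auto simp: C_def abs_le_iff simp flip: exp_minus inverse_eq_divide)
  obtain \<Phi> where \<Phi>: "\<Phi> holomorphic_on ball 0 1" "\<And>\<zeta>. Re \<zeta> < 0 \<Longrightarrow> \<Phi> (exp \<zeta>) = exp (K \<zeta>)"
  proof (rule periodic_bounded_descends[where G = "\<lambda>\<zeta>. exp (K \<zeta>)" and C = C])
    show "(\<lambda>\<zeta>. exp (K \<zeta>)) holomorphic_on {\<zeta>. Re \<zeta> < 0}" using K by (intro holomorphic_intros)
    show "exp (K (\<zeta> + 2 * of_real pi * \<i>)) = exp (K \<zeta>)" if "Re \<zeta> < 0" for \<zeta>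
      unfolding Kper[OF that] exp_add by simp
    show "norm (exp (K \<zeta>)) \<le> C" if "Re \<zeta> < 0" for \<zeta> by (rule nK[OF that])
  qed blast
  have \<Phi>K: "\<Phi> w = exp (K (Ln w))" if "w \<in> ball 0 1 - {0}" for w
    using \<Phi>(2)[of "Ln w"] that by simp
  have \<Phi>0: "\<Phi> w \<noteq> 0" if "w \<in> ball 0 1 - {0}" for w using \<Phi>K[OF that] by simp
  have "((\<lambda>w. norm (\<Phi> w)) \<longlongrightarrow> norm (\<Phi> 0)) (at 0)"
    using holomorphic_on_imp_continuous_on[OF \<Phi>(1)]
    by (intro tendsto_norm) (simp add: continuous_on_eq_continuous_at isCont_def)
  moreover have "\<forall>\<^sub>F w in at 0. 1 / C \<le> norm (\<Phi> w)"
    unfolding eventually_at using \<Phi>K nK(2) by (intro exI[of _ 1]) auto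
  ultimately have "1 / C \<le> norm (\<Phi> 0)" by (rule tendsto_lowerbound) simp
  moreover have "C > 0" by (simp add: C_def)
  ultimately have "\<Phi> 0 \<noteq> 0" by auto
  \<comment> \<open>Since \<open>\<Phi>\<close> does not vanish at 0, its order there is 0, so the
    logarithm \<open>K\<close> should have no increment.\<close>
  then obtain g r where r: "0 < r" "r \<le> (1::real)" and g: "g holomorphic_on ball 0 r" "\<And>w. w \<in> ball 0 r \<Longrightarrow> g w \<noteq> 0"
    "\<And>w. w \<in> ball 0 r \<Longrightarrow> \<Phi> w = w ^ 0 * g w"
    using zero_order_factor[OF \<Phi>(1) \<Phi>0] by metis
  have ball: "exp \<zeta> \<in> ball 0 r" "Re \<zeta> < 0" if "Re \<zeta> < ln r" for \<zeta> :: complex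
  proof -
    have "exp (Re \<zeta>) < exp (ln r)" using that by simp
    then show "exp \<zeta> \<in> ball 0 r" using r by simp
    show "Re \<zeta> < 0" using that r by (smt (verit) ln_le_zero_iff)
  qed
  have K\<Phi>: "exp (K \<zeta>) = exp \<zeta> ^ 0 * g (exp \<zeta>)" if "Re \<zeta> < ln r" for \<zeta>
    using \<Phi>(2)[OF ball(2)[OF that]] g(3)[OF ball(1)[OF that]] by simp
  have \<zeta>: "Re (of_real (ln r - 1)) < ln r" by simp
  have "K (of_real (ln r - 1) + 2 * of_real pi * \<i>) = K (of_real (ln r - 1)) + of_nat 0 * (2 * of_real pi * \<i>)"
    by (rule log_period_eq_order[OF r g(1,2) K K\<Phi> \<zeta>])
  then show False using Kper[OF ball(2)[OF \<zeta>]] by simp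
qed

section \<open>From the metric to its monodromy\<close>

lemma punctured_disk_eq: "punctured_disk = ball 0 1 - {0}"
  by (auto simp: punctured_disk_def)

lemma open_punctured_disk: "open punctured_disk"
  by (simp add: punctured_disk_eq open_delete)

text \<open>Smoothness applied to the identity coordinate on the whole punctured disc gives one
  global potential, for which curvature -1 is the Liouville equation.\<close>

lemma hyperbolic_metric_potential:
  assumes "hyperbolic_conformal_metric punctured_disk g"
  obtains u where "\<And>w v. w \<in> punctured_disk \<Longrightarrow> g w v = exp (2 * u w) * (norm v)\<^sup>2"
    "Cinf_on punctured_disk u" "\<And>w. w \<in> punctured_disk \<Longrightarrow> laplacian u w = exp (2 * u w)"
proof -
  have sm: "smooth_conformal_metric punctured_disk g"
    and cu: "\<And>w. w \<in> punctured_disk \<Longrightarrow> gaussian_curvature g w = -1"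
    using assms by (auto simp: hyperbolic_conformal_metric_def)
  have "complex_coordinate punctured_disk (\<lambda>w. w)"
    by (simp add: complex_coordinate_def open_punctured_disk)
  then obtain u where u: "Cinf_on punctured_disk u" and
    g: "metric_form punctured_disk g punctured_disk (\<lambda>w. w) (\<lambda>w. exp (2 * u w))"
    using sm unfolding smooth_conformal_metric_def by blast
  have gu: "g w v = exp (2 * u w) * (norm v)\<^sup>2" if "w \<in> punctured_disk" for w v
    using g that by (simp add: metric_form_def)
  have lap: "laplacian u w = exp (2 * u w)" if w: "w \<in> punctured_disk" for w
  proof -
    have eq: "ln (g x 1) / 2 = u x" if "x \<in> punctured_disk" for x
      using gu[OF that, of 1] by simp
    have "frechet_derivative (\<lambda>x. ln (g x 1) / 2) (at y) = frechet_derivative u (at y)" if "y \<in> punctured_disk" for y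
      using frechet_derivative_cong_open[OF open_punctured_disk that eq] .
    then have "frechet_derivative (\<lambda>y. frechet_derivative (\<lambda>x. ln (g x 1) / 2) (at y) b) (at w)
        = frechet_derivative (\<lambda>y. frechet_derivative u (at y) b) (at w)" for b
      by (intro frechet_derivative_cong_open[OF open_punctured_disk w]) simp
    then have "laplacian (\<lambda>x. ln (g x 1) / 2) w = laplacian u w" by (simp add: laplacian_def)
    then show ?thesis using cu[OF w] gu[OF w, of 1] by (simp add: gaussian_curvature_def field_simps)
  qed
  show ?thesis by (rule that[OF gu u lap])
qed

lemma developing_shift:
  assumes f: "developing \<Lambda> f" and per: "\<And>\<zeta>. Re \<zeta> < 0 \<Longrightarrow> \<Lambda> (\<zeta> + 2 * of_real pi * \<i>) = \<Lambda> \<zeta>"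
  shows "developing \<Lambda> (\<lambda>\<zeta>. f (\<zeta> + 2 * of_real pi * \<i>))"
proof -
  let ?t = "2 * of_real pi * \<i>"
  have hol: "f holomorphic_on {\<zeta>. Re \<zeta> < 0}" using f by (simp add: developing_def)
  have d: "((\<lambda>\<zeta>. f (\<zeta> + ?t)) has_field_derivative deriv f (\<zeta> + ?t)) (at \<zeta>)" if "Re \<zeta> < 0" for \<zeta>
  proof -
    have 1: "(f has_field_derivative deriv f (\<zeta> + ?t)) (at (\<zeta> + ?t))"
      using holomorphic_derivI[OF hol open_halfspace_Re_lt] that by simp
    have 2: "((\<lambda>\<zeta>. \<zeta> + ?t) has_field_derivative 1) (at \<zeta>)" by (auto intro!: derivative_eq_intros)
    show ?thesis using DERIV_chain2[where f = f and g = "\<lambda>\<zeta>. \<zeta> + ?t", OF 1 2] by simp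
  qed
  show ?thesis unfolding developing_def
  proof (intro conjI allI impI)
    show "(\<lambda>\<zeta>. f (\<zeta> + ?t)) holomorphic_on {\<zeta>. Re \<zeta> < 0}"
      unfolding holomorphic_on_open[OF open_halfspace_Re_lt] using d by blast
    fix \<zeta> :: complex assume \<zeta>: "Re \<zeta> < 0"
    then have \<zeta>': "Re (\<zeta> + ?t) < 0" by simp
    show "norm (f (\<zeta> + ?t)) < 1" using f \<zeta>' unfolding developing_def by blast
    show "2 * norm (deriv (\<lambda>\<zeta>. f (\<zeta> + ?t)) \<zeta>) = (1 - (norm (f (\<zeta> + ?t)))\<^sup>2) * \<Lambda> \<zeta>"
      unfolding DERIV_imp_deriv[OF d[OF \<zeta>]] using f \<zeta>' per[OF \<zeta>] unfolding developing_def by metis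
  qed
qed

text \<open>With trivial monodromy the developing map itself descends and extends over the puncture.
  The maximum principle keeps its value \<open>d\<close> at 0 inside the open disc, so an
  automorphism can move \<open>d\<close> to 0. This produces the cone angles that are multiples of
  \<open>2 \<pi>\<close>, regular points included.\<close>

lemma cone_of_periodic_developing_map:
  assumes F: "developing (\<lambda>\<zeta>. exp (u (exp \<zeta>)) * norm (exp \<zeta>)) F"
    and per: "\<And>\<zeta>. Re \<zeta> < 0 \<Longrightarrow> F (\<zeta> + 2 * of_real pi * \<i>) = F \<zeta>"
  shows "\<exists>\<beta>>0. \<exists>\<epsilon> z. hyperbolic_cone_at u \<beta> \<epsilon> z"
proof -
  have hol: "F holomorphic_on {\<zeta>. Re \<zeta> < 0}" and F1: "\<And>\<zeta>. Re \<zeta> < 0 \<Longrightarrow> norm (F \<zeta>) < 1"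
    using F by (auto simp: developing_def)
  obtain \<Phi> where \<Phi>: "\<Phi> holomorphic_on ball 0 1" "\<And>\<zeta>. Re \<zeta> < 0 \<Longrightarrow> \<Phi> (exp \<zeta>) = F \<zeta>"
    using periodic_bounded_descends[OF hol per less_imp_le[OF F1]] by blast
  have lt: "norm (\<Phi> w) < 1" if "w \<in> ball 0 1 - {0}" for w
    using \<Phi>(2)[of "Ln w"] F1[of "Ln w"] that by simp
  have \<Phi>0: "norm (\<Phi> 0) < 1"
  proof (rule ccontr)
    assume c: "\<not> norm (\<Phi> 0) < 1"
    have "\<Phi> constant_on ball 0 1"
    proof (rule maximum_modulus_principle[OF \<Phi>(1), of "ball 0 1" 0])
      fix w :: complex assume "w \<in> ball 0 1"
      then show "norm (\<Phi> w) \<le> norm (\<Phi> 0)" using lt[of w] c by (cases "w = 0") auto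
    qed auto
    then have "\<Phi> (1/2) = \<Phi> 0" unfolding constant_on_def by force
    then show False using lt[of "1/2"] c by (simp add: norm_divide)
  qed
  define d where "d = \<Phi> 0"
  let ?\<Psi> = "\<lambda>w. (\<Phi> w - d) / (1 - cnj d * \<Phi> w)"
  have "norm (\<Phi> w) < 1" if "w \<in> ball 0 1" for w
    using lt[of w] \<Phi>0 that by (cases "w = 0") auto
  then have "?\<Psi> holomorphic_on ball 0 1"
    using \<Phi>0 by (intro holomorphic_intros \<Phi>(1) disc_automorphism_denominator) (auto simp: d_def less_imp_le)
  moreover have "developing (\<lambda>\<zeta>. exp (u (exp \<zeta>)) * norm (exp \<zeta>)) (\<lambda>\<zeta>. (F \<zeta> - d) / (1 - cnj d * F \<zeta>))"
    using \<Phi>0 by (intro developing_disc_automorphism[OF F]) (simp add: d_def)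
  moreover have F\<Psi>: "(F \<zeta> - d) / (1 - cnj d * F \<zeta>) = exp (of_real 0 * \<zeta>) * ?\<Psi> (exp \<zeta>)" if "Re \<zeta> < 0" for \<zeta>
    using \<Phi>(2)[OF that] by simp
  ultimately show ?thesis
    by (intro conical_coordinate_of_developing_map[where \<alpha> = 0 and \<Phi> = ?\<Psi>
          and F = "\<lambda>\<zeta>. (F \<zeta> - d) / (1 - cnj d * F \<zeta>)"]) (assumption | simp add: d_def)+
qed

text \<open>Dividing by \<open>exp (\<alpha> \<zeta>)\<close> with
  \<open>exp (2 \<pi> \<i> \<alpha>) = \<kappa>\<close> removes the rotation. For negative
  \<open>\<alpha>\<close> the bound \<open>|F| < 1\<close> makes the quotient tend to 0 at the
  puncture, so it extends with a zero there. Since \<open>\<kappa> \<noteq> 1\<close>,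
  \<open>\<alpha>\<close> is not an integer.\<close>

lemma cone_of_elliptic_developing_map:
  assumes F: "developing (\<lambda>\<zeta>. exp (u (exp \<zeta>)) * norm (exp \<zeta>)) F"
    and per: "\<And>\<zeta>. Re \<zeta> < 0 \<Longrightarrow> F (\<zeta> + 2 * of_real pi * \<i>) = \<kappa> * F \<zeta>" and \<kappa>: "norm \<kappa> = 1" "\<kappa> \<noteq> 1"
  shows "\<exists>\<beta>>0. \<exists>\<epsilon> z. hyperbolic_cone_at u \<beta> \<epsilon> z"
proof -
  have hol: "F holomorphic_on {\<zeta>. Re \<zeta> < 0}" and F1: "\<And>\<zeta>. Re \<zeta> < 0 \<Longrightarrow> norm (F \<zeta>) < 1"
    using F by (auto simp: developing_def)
  \<comment> \<open>\<open>Arg\<close> is at most \<open>\<pi>\<close>, so subtracting 1 makes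
    \<open>\<alpha>\<close> negative and leaves the rotation factor unchanged.\<close>
  define \<alpha> where "\<alpha> = Arg \<kappa> / (2 * pi) - 1"
  have "\<kappa> \<noteq> 0" using \<kappa> by auto
  then have \<kappa>_eq: "exp (of_real \<alpha> * (2 * of_real pi * \<i>)) = \<kappa>"
  proof -
    have "of_real \<alpha> * (2 * of_real pi * \<i>) = \<i> * of_real (Arg \<kappa>) - 2 * of_real pi * \<i>"
      by (simp add: \<alpha>_def field_simps)
    then show ?thesis using Arg_eq[OF \<open>\<kappa> \<noteq> 0\<close>] \<kappa> by (simp add: exp_diff)
  qed
  have neg: "\<alpha> < 0"
  proof -
    have "Arg \<kappa> < 2 * pi" using Arg_le_pi[of \<kappa>] pi_gt_zero by linarith
    then show ?thesis by (simp add: \<alpha>_def)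
  qed
  have nint: "\<alpha> \<notin> \<int>"
  proof
    assume "\<alpha> \<in> \<int>"
    then obtain n where "\<alpha> = of_int n" by (auto elim: Ints_cases)
    then have "exp (of_real \<alpha> * (2 * of_real pi * \<i>)) = exp (of_int (2 * n) * of_real pi * \<i>)" by (simp add: algebra_simps)
    also have "\<dots> = 1" unfolding exp_eq_1 by (auto intro!: exI[of _ n])
    finally show False using \<kappa>_eq \<kappa> by simp
  qed
  let ?H = "\<lambda>\<zeta>. F \<zeta> * exp (- of_real \<alpha> * \<zeta>)"
  have nH: "norm (?H \<zeta>) \<le> exp (- \<alpha> * Re \<zeta>)" if "Re \<zeta> < 0" for \<zeta>
    using F1[OF that] by (simp add: norm_mult)
  obtain \<Phi> where \<Phi>: "\<Phi> holomorphic_on ball 0 1" "\<And>\<zeta>. Re \<zeta> < 0 \<Longrightarrow> \<Phi> (exp \<zeta>) = ?H \<zeta>"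
  proof (rule periodic_bounded_descends[where G = ?H and C = 1])
    show "?H holomorphic_on {\<zeta>. Re \<zeta> < 0}" using hol by (intro holomorphic_intros)
    fix \<zeta> :: complex assume \<zeta>: "Re \<zeta> < 0"
    have "exp (- of_real \<alpha> * (\<zeta> + 2 * of_real pi * \<i>)) = exp (- of_real \<alpha> * \<zeta>) * inverse \<kappa>"
      unfolding \<kappa>_eq[symmetric] by (simp add: exp_minus[symmetric] exp_add[symmetric] algebra_simps)
    then show "?H (\<zeta> + 2 * of_real pi * \<i>) = ?H \<zeta>" using per[OF \<zeta>] \<open>\<kappa> \<noteq> 0\<close> by simp
    have "exp (- \<alpha> * Re \<zeta>) \<le> 1" using neg \<zeta> by (simp add: mult_neg_neg less_imp_le)
    then show "norm (?H \<zeta>) \<le> 1" using nH[OF \<zeta>] by linarith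
  qed blast
  have \<Phi>_le: "norm (\<Phi> w) \<le> norm w powr (- \<alpha>)" if "w \<in> ball 0 1 - {0}" for w
    using \<Phi>(2)[of "Ln w"] nH[of "Ln w"] that by (simp add: powr_def)
  have "((\<lambda>w. norm (\<Phi> w)) \<longlongrightarrow> norm (\<Phi> 0)) (at 0)"
    using holomorphic_on_imp_continuous_on[OF \<Phi>(1)]
    by (intro tendsto_norm) (simp add: continuous_on_eq_continuous_at isCont_def)
  moreover have "((\<lambda>w::complex. norm w powr (- \<alpha>)) \<longlongrightarrow> 0) (at 0)"
    using neg by (auto intro!: tendsto_eq_intros)
  moreover have "\<forall>\<^sub>F w in at 0. norm (\<Phi> w) \<le> norm w powr (- \<alpha>)"
    unfolding eventually_at using \<Phi>_le by (intro exI[of _ 1]) auto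
  ultimately have "norm (\<Phi> 0) \<le> 0" using tendsto_le[OF at_neq_bot] by blast
  then have \<Phi>0: "\<Phi> 0 = 0" by simp
  have "F \<zeta> = exp (of_real \<alpha> * \<zeta>) * \<Phi> (exp \<zeta>)" if "Re \<zeta> < 0" for \<zeta>
    using \<Phi>(2)[OF that] by (simp add: exp_minus)
  then show ?thesis
    using nint by (intro conical_coordinate_of_developing_map[OF F _ \<Phi>(1) \<Phi>0]) auto
qed

lemma cone_or_cusp_coordinate:
  assumes u: "Cinf_on punctured_disk u" "\<And>w. w \<in> punctured_disk \<Longrightarrow> laplacian u w = exp (2 * u w)"
  shows "(\<exists>\<beta>>0. \<exists>\<epsilon> z. hyperbolic_cone_at u \<beta> \<epsilon> z) \<or> (\<exists>\<epsilon> z. hyperbolic_cusp_at u \<epsilon> z)"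
proof -
  let ?\<Lambda> = "\<lambda>\<zeta>. exp (u (exp \<zeta>)) * norm (exp \<zeta>)"
  let ?t = "2 * of_real pi * \<i>"
  have \<Lambda>pos: "?\<Lambda> \<zeta> > 0" for \<zeta> by simp
  have \<Lambda>per: "?\<Lambda> (\<zeta> + ?t) = ?\<Lambda> \<zeta>" for \<zeta> by (simp add: exp_add)
  obtain p q where pq: "\<And>w. w \<in> punctured_disk \<Longrightarrow> (u has_derivative (\<lambda>v. 2 * Re (p w * v))) (at w)"
    "\<And>w. w \<in> punctured_disk \<Longrightarrow> (p has_derivative (\<lambda>v. (q w + (p w)\<^sup>2) * v + of_real (exp (2 * u w)) / 4 * cnj v)) (at w)"
    "q holomorphic_on punctured_disk"
    using liouville_equation_wirtinger[OF open_punctured_disk u] by blast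
  obtain f where f: "developing ?\<Lambda> f"
    using developing_map[OF pq] by blast
  have f1: "norm (f \<zeta>) < 1" if "Re \<zeta> < 0" for \<zeta> using f that by (auto simp: developing_def)
  obtain \<mu> a where \<mu>: "norm \<mu> = 1" and a: "norm a < 1" and
    mono: "\<And>\<zeta>. Re \<zeta> < 0 \<Longrightarrow> f (\<zeta> + ?t) = \<mu> * (f \<zeta> - a) / (1 - cnj a * f \<zeta>)"
    using developing_unique[OF f developing_shift[OF f \<Lambda>per] \<Lambda>pos] by blast
  obtain c where c: "norm c \<le> 1" "c * (1 - cnj a * c) = \<mu> * (c - a)"
    using disc_automorphism_fixed_point[OF a \<mu>] by blast
  show ?thesis
  proof (cases "norm c < 1")
    case True
    let ?F = "\<lambda>\<zeta>. (f \<zeta> - c) / (1 - cnj c * f \<zeta>)"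
    define \<kappa> where "\<kappa> = \<mu> * (1 - a * cnj c) / (1 - cnj a * c)"
    have F: "developing ?\<Lambda> ?F" by (rule developing_disc_automorphism[OF f True])
    have rot: "?F (\<zeta> + ?t) = \<kappa> * ?F \<zeta>" if "Re \<zeta> < 0" for \<zeta>
      unfolding mono[OF that] \<kappa>_def by (rule disc_automorphism_conjugate_rotation[OF a \<mu> True f1[OF that] c(2)])
    have "1 - cnj a * c \<noteq> 0" using disc_automorphism_denominator[OF a c(1)] .
    moreover have "norm (1 - a * cnj c) = norm (1 - cnj a * c)"
    proof -
      have "1 - a * cnj c = cnj (1 - cnj a * c)" by simp
      then show ?thesis by (simp only: complex_mod_cnj)
    qed
    ultimately have "norm \<kappa> = 1" using \<mu> by (simp add: \<kappa>_def norm_mult norm_divide)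
    then have "\<exists>\<beta>>0. \<exists>\<epsilon> z. hyperbolic_cone_at u \<beta> \<epsilon> z"
      using cone_of_periodic_developing_map[OF F] cone_of_elliptic_developing_map[OF F rot] rot
      by (cases "\<kappa> = 1") simp_all
    then show ?thesis by blast
  next
    case False
    then have c1: "norm c = 1" using c by simp
    show ?thesis
    \<comment> \<open>The identity also fixes boundary points, so trivial monodromy can reach this
      branch. It is separated here and corresponds to \<open>A = 1\<close>, \<open>B = 0\<close>
      below.\<close>
    proof (cases "\<forall>\<zeta>. Re \<zeta> < 0 \<longrightarrow> f (\<zeta> + ?t) = f \<zeta>")
      case True
      then show ?thesis using cone_of_periodic_developing_map[OF f] by blast
    next
      case nper: False
      define G where "G = (\<lambda>\<zeta>. \<i> * (c + f \<zeta>) / (c - f \<zeta>))"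
      have G: "G holomorphic_on {\<zeta>. Re \<zeta> < 0}" "\<And>\<zeta>. Re \<zeta> < 0 \<Longrightarrow> Im (G \<zeta>) > 0"
        "\<And>\<zeta>. Re \<zeta> < 0 \<Longrightarrow> norm (deriv G \<zeta>) = Im (G \<zeta>) * (exp (u (exp \<zeta>)) * norm (exp \<zeta>))"
        unfolding G_def using half_plane_developing[OF f c1] by simp_all
      define A where "A = (norm (1 - cnj a * c))\<^sup>2 / (1 - (norm a)\<^sup>2)"
      define B where "B = - 2 * Im (cnj a * c) / (1 - (norm a)\<^sup>2)"
      have aff: "G (\<zeta> + ?t) = of_real A * G \<zeta> + of_real B" if "Re \<zeta> < 0" for \<zeta>
        unfolding G_def mono[OF that] A_def B_def
        by (rule disc_automorphism_conjugate_affine[OF a \<mu> c1 f1[OF that] c(2)])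
      have A: "A > 0" unfolding A_def
        using disc_automorphism_denominator[OF a c(1)] one_minus_norm_square_pos[OF a] by simp
      show ?thesis
      proof (cases "A = 1")
        case True
        have B0: "B \<noteq> 0"
        proof
          assume "B = 0"
          have "f (\<zeta> + ?t) = f \<zeta>" if \<zeta>: "Re \<zeta> < 0" for \<zeta>
          proof -
            have "Re (\<zeta> + ?t) < 0" using \<zeta> by simp
            then have "c - f \<zeta> \<noteq> 0" "c - f (\<zeta> + ?t) \<noteq> 0" "c \<noteq> 0" using f1[OF \<zeta>] f1[of "\<zeta> + ?t"] c1 by force+
            moreover have "G (\<zeta> + ?t) = G \<zeta>" using aff[OF \<zeta>] \<open>B = 0\<close> True by simp
            ultimately have "(c + f (\<zeta> + ?t)) * (c - f \<zeta>) = (c + f \<zeta>) * (c - f (\<zeta> + ?t))"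
              unfolding G_def by (simp add: frac_eq_eq)
            then have "2 * c * (f (\<zeta> + ?t) - f \<zeta>) = 0" by (simp add: algebra_simps)
            then show ?thesis using \<open>c \<noteq> 0\<close> by simp
          qed
          then show False using nper by blast
        qed
        have trans: "G (\<zeta> + ?t) = G \<zeta> + of_real B" if "Re \<zeta> < 0" for \<zeta>
          using aff[OF that] True by simp
        show ?thesis
          using cusp_coordinate_of_developing_map[where u = u, OF G trans B0] by blast
      next
        case A1: False
        \<comment> \<open>The fixed point of the affine map with coefficients \<open>A\<close> and
          \<open>B\<close>. Being real, it can be subtracted without leaving the upper half plane,
          and the map becomes the dilation by \<open>A\<close>.\<close>
        define k where "k = complex_of_real (B / (1 - A))"
        define H where "H = (\<lambda>\<zeta>. G \<zeta> - k)"
        have H1: "H holomorphic_on {\<zeta>. Re \<zeta> < 0}"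
          unfolding H_def by (rule holomorphic_on_diff[OF G(1) holomorphic_on_const])
        have H2: "Im (H \<zeta>) > 0" if "Re \<zeta> < 0" for \<zeta>
          using G(2)[OF that] by (simp add: H_def k_def)
        have "(1 - complex_of_real A) * k = of_real ((1 - A) * (B / (1 - A)))"
          unfolding k_def by (simp only: of_real_mult of_real_diff of_real_1)
        also have "(1 - A) * (B / (1 - A)) = B" using A1 by simp
        finally have k: "of_real B = k - of_real A * k" by (simp add: left_diff_distrib)
        have H3: "H (\<zeta> + ?t) = of_real A * H \<zeta>" if "Re \<zeta> < 0" for \<zeta>
          unfolding H_def aff[OF that] k by (simp add: right_diff_distrib)
        show ?thesis using no_hyperbolic_monodromy[OF H1 H2 H3 A A1] by blast
      qed
    qed
  qed
qed

section \<open>Asymptotics at the singularity\<close>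

lemma bounded_over_log_tendsto_0:
  assumes "(h \<longlongrightarrow> (c::real)) (at (0::complex))"
  shows "((\<lambda>w. h w / ln (norm w)) \<longlongrightarrow> 0) (at 0)"
proof (rule tendsto_divide_0[OF assms])
  have "filterlim norm (at_right 0) (at (0::complex))"
    unfolding filterlim_at by (auto simp: eventually_at_filter intro!: tendsto_eq_intros)
  then show "filterlim (\<lambda>w::complex. ln (norm w)) at_infinity (at 0)"
    using filterlim_compose[OF ln_at_0] by (intro filterlim_at_bot_imp_at_infinity) blast
qed

text \<open>\<open>z / w\<close> and \<open>z'\<close> have nonzero limits at 0, so
  \<open>ln |z| - ln |w|\<close> and \<open>ln |z'|\<close> stay bounded and disappear after
  division by \<open>ln |w|\<close>. Thus the coordinate in which a singularity is given does not
  affect the leading behaviour of the metric.\<close>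

lemma coordinate_asymptotics:
  assumes U: "complex_coordinate U z" "0 \<in> U" "z 0 = 0"
  shows "(z \<longlongrightarrow> 0) (at 0)" "\<forall>\<^sub>F w in at 0. w \<in> U \<and> z w \<noteq> 0 \<and> deriv z w \<noteq> 0"
    "((\<lambda>w. ln (norm (z w)) / ln (norm w)) \<longlongrightarrow> 1) (at 0)"
    "((\<lambda>w. ln (norm (deriv z w)) / ln (norm w)) \<longlongrightarrow> 0) (at 0)"
proof -
  have o: "open U" and hol: "z holomorphic_on U" and inj: "inj_on z U"
    using U by (auto simp: complex_coordinate_def)
  have cont: "isCont z 0" "isCont (deriv z) 0"
    using holomorphic_on_imp_continuous_on[OF hol] holomorphic_on_imp_continuous_on[OF holomorphic_deriv[OF hol o]] o U(2)
    by (auto simp: continuous_on_eq_continuous_at)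
  have reg: "deriv z w \<noteq> 0" if "w \<in> U" for w using holomorphic_injective_imp_regular[OF hol o inj that] .
  show z0: "(z \<longlongrightarrow> 0) (at 0)" using cont(1) U(3) by (simp add: isCont_def)
  have "\<forall>\<^sub>F w in at 0. w \<in> U" using eventually_at_in_open'[OF o U(2)] .
  moreover have "\<forall>\<^sub>F w in at (0::complex). w \<noteq> 0" by (simp add: eventually_at_filter)
  ultimately show nz: "\<forall>\<^sub>F w in at 0. w \<in> U \<and> z w \<noteq> 0 \<and> deriv z w \<noteq> 0"
  proof eventually_elim
    case (elim w)
    then show ?case using inj_onD[OF inj, of w 0] U reg by auto
  qed
  have "((\<lambda>w. ln (norm (deriv z w))) \<longlongrightarrow> ln (norm (deriv z 0))) (at 0)"
    using cont(2) reg[OF U(2)] by (intro tendsto_intros) (auto simp: isCont_def)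
  then show "((\<lambda>w. ln (norm (deriv z w)) / ln (norm w)) \<longlongrightarrow> 0) (at 0)"
    by (rule bounded_over_log_tendsto_0)
  have "((\<lambda>w. z w / w) \<longlongrightarrow> deriv z 0) (at 0)"
    using holomorphic_derivI[OF hol o U(2)] U(3) by (simp add: has_field_derivative_iff)
  then have "((\<lambda>w. ln (norm (z w / w))) \<longlongrightarrow> ln (norm (deriv z 0))) (at 0)"
    using reg[OF U(2)] by (intro tendsto_intros) auto
  then have "((\<lambda>w. ln (norm (z w / w)) / ln (norm w)) \<longlongrightarrow> 0) (at 0)"
    by (rule bounded_over_log_tendsto_0)
  then have "((\<lambda>w. 1 + ln (norm (z w / w)) / ln (norm w)) \<longlongrightarrow> 1) (at 0)"
    using tendsto_add[OF tendsto_const[of 1]] by fastforce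
  moreover have "\<forall>\<^sub>F w in at 0. 1 + ln (norm (z w / w)) / ln (norm w) = ln (norm (z w)) / ln (norm w)"
  proof -
    have "\<forall>\<^sub>F w in at (0::complex). w \<noteq> 0 \<and> norm w < 1"
      unfolding eventually_at by (intro exI[of _ 1]) auto
    with nz show ?thesis
      by eventually_elim (auto simp: norm_divide ln_div field_simps)
  qed
  ultimately show "((\<lambda>w. ln (norm (z w)) / ln (norm w)) \<longlongrightarrow> 1) (at 0)" by (rule Lim_transform_eventually)
qed

text \<open>
  The type of the singularity is read off the metric as the limit of \<open>ln (g w 1) / ln |w|\<close>, a cusp
  corresponding to the cone angle 0.
\<close>

lemma conical_singularity_asymptotics:
  assumes "conical_singularity S g 0 \<theta>"
  shows "((\<lambda>w. ln (g w 1) / ln (norm w)) \<longlongrightarrow> 2 * (\<theta> - 1)) (at 0)"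
proof -
  obtain U z u h where U: "0 \<in> U" "complex_coordinate U z" "z 0 = 0"
    and g: "metric_form S g (U - {0}) z (\<lambda>w. exp (2 * u w))"
    and h: "continuous_on U h" "\<And>w. w \<in> U - {0} \<Longrightarrow> h w = u w - (\<theta> - 1) * ln (norm (z w))"
    using assms unfolding conical_singularity_def by blast
  note as = coordinate_asymptotics[OF U(2,1,3)]
  have o: "open U" using U by (simp add: complex_coordinate_def)
  have "(h \<longlongrightarrow> h 0) (at 0)" using h(1) o U(1) by (simp add: continuous_on_eq_continuous_at isCont_def)
  from tendsto_add[OF tendsto_add[OF tendsto_mult[OF tendsto_const[of 2] bounded_over_log_tendsto_0[OF this]]
        tendsto_mult[OF tendsto_const[of "2 * (\<theta> - 1)"] as(3)]] tendsto_mult[OF tendsto_const[of 2] as(4)]]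
  have "((\<lambda>w. 2 * (h w / ln (norm w)) + 2 * (\<theta> - 1) * (ln (norm (z w)) / ln (norm w)) + 2 * (ln (norm (deriv z w)) / ln (norm w)))
    \<longlongrightarrow> 2 * (\<theta> - 1)) (at 0)" by simp
  moreover have "\<forall>\<^sub>F w in at 0. 2 * (h w / ln (norm w)) + 2 * (\<theta> - 1) * (ln (norm (z w)) / ln (norm w)) + 2 * (ln (norm (deriv z w)) / ln (norm w))
      = ln (g w 1) / ln (norm w)"
  proof -
    have "\<forall>\<^sub>F w in at (0::complex). w \<noteq> 0" by (simp add: eventually_at_filter)
    with as(2) show ?thesis
    proof eventually_elim
      case (elim w)
      then have "g w 1 = exp (2 * u w) * (norm (deriv z w))\<^sup>2" using g by (simp add: metric_form_def)
      then have "ln (g w 1) = 2 * u w + 2 * ln (norm (deriv z w))" using elim by (simp add: ln_mult ln_realpow)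
      also have "u w = h w + (\<theta> - 1) * ln (norm (z w))" using h(2)[of w] elim by simp
      finally have "ln (g w 1) = 2 * h w + 2 * (\<theta> - 1) * ln (norm (z w)) + 2 * ln (norm (deriv z w))" by simp
      then show ?case by (simp only: add_divide_distrib times_divide_eq_right)
    qed
  qed
  ultimately show ?thesis by (rule Lim_transform_eventually)
qed

lemma cusp_singularity_asymptotics:
  assumes "cusp_singularity S g 0"
  shows "((\<lambda>w. ln (g w 1) / ln (norm w)) \<longlongrightarrow> - 2) (at 0)"
proof -
  obtain U z u h where U: "0 \<in> U" "complex_coordinate U z" "z 0 = 0" 
    and g: "metric_form S g (U - {0}) z (\<lambda>w. exp (2 * u w))"
    and h: "continuous_on U h" "\<And>w. w \<in> U - {0} \<Longrightarrow> h w = u w + ln (norm (z w)) + ln (- ln (norm (z w)))"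
    using assms unfolding cusp_singularity_def by blast
  note as = coordinate_asymptotics[OF U(2,1,3)]
  have o: "open U" using U by (simp add: complex_coordinate_def)
  \<comment> \<open>The double logarithm, the one term that a cone does not have, is of lower order
    than \<open>ln |w|\<close>.\<close>
  have "filterlim (\<lambda>w. norm (z w)) (at_right 0) (at 0)"
    unfolding filterlim_at using tendsto_norm[OF as(1)] eventually_mono[OF as(2)] by auto
  then have "filterlim (\<lambda>w. - ln (norm (z w))) at_top (at 0)"
    using filterlim_compose[OF ln_at_0] unfolding filterlim_uminus_at_bot[symmetric] by blast
  from filterlim_compose[OF ln_x_over_x_tendsto_0 this, THEN tendsto_minus]
  have "((\<lambda>w. ln (- ln (norm (z w))) / ln (norm (z w))) \<longlongrightarrow> 0) (at 0)" by simp
  from tendsto_mult[OF this as(3)]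
  have "((\<lambda>w. ln (- ln (norm (z w))) / ln (norm (z w)) * (ln (norm (z w)) / ln (norm w))) \<longlongrightarrow> 0) (at 0)" by simp
  moreover have "\<forall>\<^sub>F w in at 0. ln (- ln (norm (z w))) / ln (norm (z w)) * (ln (norm (z w)) / ln (norm w)) = ln (- ln (norm (z w))) / ln (norm w)"
    by (rule always_eventually) auto
  ultimately have ll: "((\<lambda>w. ln (- ln (norm (z w))) / ln (norm w)) \<longlongrightarrow> 0) (at 0)" by (rule Lim_transform_eventually)
  have "(h \<longlongrightarrow> h 0) (at 0)" using h(1) o U(1) by (simp add: continuous_on_eq_continuous_at isCont_def)
  from tendsto_add[OF tendsto_diff[OF tendsto_diff[OF tendsto_mult[OF tendsto_const[of 2] bounded_over_log_tendsto_0[OF this]]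
        tendsto_mult[OF tendsto_const[of 2] as(3)]] tendsto_mult[OF tendsto_const[of 2] ll]] tendsto_mult[OF tendsto_const[of 2] as(4)]]
  have "((\<lambda>w. 2 * (h w / ln (norm w)) - 2 * (ln (norm (z w)) / ln (norm w)) - 2 * (ln (- ln (norm (z w))) / ln (norm w))
      + 2 * (ln (norm (deriv z w)) / ln (norm w))) \<longlongrightarrow> - 2) (at 0)" by simp
  moreover have "\<forall>\<^sub>F w in at 0. 2 * (h w / ln (norm w)) - 2 * (ln (norm (z w)) / ln (norm w)) - 2 * (ln (- ln (norm (z w))) / ln (norm w))
      + 2 * (ln (norm (deriv z w)) / ln (norm w)) = ln (g w 1) / ln (norm w)"
  proof -
    have "\<forall>\<^sub>F w in at (0::complex). w \<noteq> 0" by (simp add: eventually_at_filter)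
    with as(2) show ?thesis
    proof eventually_elim
      case (elim w)
      then have "g w 1 = exp (2 * u w) * (norm (deriv z w))\<^sup>2" using g by (simp add: metric_form_def)
      then have "ln (g w 1) = 2 * u w + 2 * ln (norm (deriv z w))" using elim by (simp add: ln_mult ln_realpow)
      also have "u w = h w - ln (norm (z w)) - ln (- ln (norm (z w)))" using h(2)[of w] elim by simp
      finally have "ln (g w 1) = 2 * h w - 2 * ln (norm (z w)) - 2 * ln (- ln (norm (z w))) + 2 * ln (norm (deriv z w))" by simp
      then show ?case by (simp only: add_divide_distrib diff_divide_distrib times_divide_eq_right)
    qed
  qed
  ultimately show ?thesis by (rule Lim_transform_eventually)
qed

section \<open>Classification\<close>

lemma conical_normal_coordinate_of_cone:
  assumes g: "\<And>w v. w \<in> punctured_disk \<Longrightarrow> g w v = exp (2 * u w) * (norm v)\<^sup>2"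
    and z: "hyperbolic_cone_at u \<beta> \<epsilon> z"
  shows "conical_normal_coordinate punctured_disk g \<beta> \<epsilon> z"
  unfolding conical_normal_coordinate_def metric_form_def
proof (intro conjI ballI allI)
  show "ball 0 \<epsilon> - {0} \<subseteq> punctured_disk" using z by (auto simp: hyperbolic_cone_at_def punctured_disk_eq)
  then show "g w v = 4 * \<beta>\<^sup>2 * norm (z w) powr (2 * \<beta> - 2) / (1 - norm (z w) powr (2 * \<beta>))\<^sup>2 * (norm (deriv z w * v))\<^sup>2"
    if "w \<in> ball 0 \<epsilon> - {0}" for w v
    using g[of w v] z that unfolding hyperbolic_cone_at_def norm_mult power_mult_distrib by auto
qed (use z in \<open>auto simp: hyperbolic_cone_at_def\<close>)

lemma cusp_normal_coordinate_of_cusp: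
  assumes g: "\<And>w v. w \<in> punctured_disk \<Longrightarrow> g w v = exp (2 * u w) * (norm v)\<^sup>2"
    and z: "hyperbolic_cusp_at u \<epsilon> z"
  shows "cusp_normal_coordinate punctured_disk g \<epsilon> z"
  unfolding cusp_normal_coordinate_def metric_form_def
proof (intro conjI ballI allI)
  show "ball 0 \<epsilon> - {0} \<subseteq> punctured_disk" using z by (auto simp: hyperbolic_cusp_at_def punctured_disk_eq)
  then show "g w v = norm (z w) powi (-2) * ln (norm (z w)) powi (-2) * (norm (deriv z w * v))\<^sup>2"
    if "w \<in> ball 0 \<epsilon> - {0}" for w v
    using g[of w v] z that unfolding hyperbolic_cusp_at_def norm_mult power_mult_distrib by auto
qed (use z in \<open>auto simp: hyperbolic_cusp_at_def\<close>)

section \<open>Normal coordinates exhibit the type of the singularity\<close>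

lemma coordinate_nonzero:
  assumes "complex_coordinate (ball 0 \<epsilon>) z" "z 0 = 0" "w \<in> ball 0 \<epsilon> - {0}"
  shows "norm (z w) > 0"
proof -
  have "0 \<in> ball (0::complex) \<epsilon>" using assms(3) by (auto intro: le_less_trans[OF norm_ge_zero])
  then show ?thesis using assms inj_onD[of z "ball 0 \<epsilon>" w 0] by (auto simp: complex_coordinate_def)
qed

text \<open>Subtracting \<open>(\<alpha> - 1) ln |z|\<close> from the potential leaves the logarithm
  of \<open>2 \<alpha>\<close> divided by the absolute value of \<open>1 - |z|^(2 \<alpha>)\<close>,
  which is continuous at 0 too. Positivity of \<open>g\<close> excludes \<open>|z| = 1\<close>,
  where division by zero would make the metric vanish.\<close>

lemma conical_singularity_of_normal_coordinate:
  assumes pos: "\<And>w. w \<in> S \<Longrightarrow> g w 1 > 0" and \<alpha>: "\<alpha> > 0" and z: "conical_normal_coordinate S g \<alpha> \<epsilon> z"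
  shows "conical_singularity S g 0 \<alpha>"
proof -
  let ?\<rho> = "\<lambda>w. 4 * \<alpha>\<^sup>2 * norm (z w) powr (2 * \<alpha> - 2) / (1 - norm (z w) powr (2 * \<alpha>))\<^sup>2"
  have \<epsilon>: "\<epsilon> > 0" and coord: "complex_coordinate (ball 0 \<epsilon>) z" and z0: "z 0 = 0"
    and mf: "metric_form S g (ball 0 \<epsilon> - {0}) z ?\<rho>"
    using z by (auto simp: conical_normal_coordinate_def)
  have n0: "norm (z w) > 0" if "w \<in> ball 0 \<epsilon> - {0}" for w
    using coordinate_nonzero[OF coord z0 that] .
  have d: "1 - norm (z w) powr (2 * \<alpha>) \<noteq> 0" if "w \<in> ball 0 \<epsilon> - {0}" for w
  proof
    assume "1 - norm (z w) powr (2 * \<alpha>) = 0"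
    then have "g w 1 = 0" using mf that by (simp add: metric_form_def)
    then show False using pos[of w] mf that by (auto simp: metric_form_def)
  qed
  have \<rho>: "?\<rho> w > 0" if "w \<in> ball 0 \<epsilon> - {0}" for w using n0[OF that] d[OF that] \<alpha> by simp
  define u where "u = (\<lambda>w. ln (?\<rho> w) / 2)"
  define h where "h = (\<lambda>w. ln (2 * \<alpha>) - ln \<bar>1 - norm (z w) powr (2 * \<alpha>)\<bar>)"
  have "metric_form S g (ball 0 \<epsilon> - {0}) z (\<lambda>w. exp (2 * u w))"
    using mf \<rho> unfolding metric_form_def u_def by (simp add: exp_ln)
  moreover have "continuous_on (ball 0 \<epsilon>) h"
  proof -
    have "continuous_on (ball 0 \<epsilon>) z" using coord holomorphic_on_imp_continuous_on by (auto simp: complex_coordinate_def)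
    moreover have "\<bar>1 - norm (z w) powr (2 * \<alpha>)\<bar> \<noteq> 0" if "w \<in> ball 0 \<epsilon>" for w
      using d[of w] that z0 by (cases "w = 0") auto
    ultimately show ?thesis unfolding h_def using \<alpha> by (intro continuous_intros continuous_on_powr') auto
  qed
  moreover have "h w = u w - (\<alpha> - 1) * ln (norm (z w))" if w: "w \<in> ball 0 \<epsilon> - {0}" for w
  proof -
    have "ln (?\<rho> w) = ln (4 * \<alpha>\<^sup>2) + ln (norm (z w) powr (2 * \<alpha> - 2)) - ln ((1 - norm (z w) powr (2 * \<alpha>))\<^sup>2)"
      using n0[OF w] d[OF w] \<alpha> by (simp add: ln_div ln_mult)
    also have "ln ((1 - norm (z w) powr (2 * \<alpha>))\<^sup>2) = 2 * ln \<bar>1 - norm (z w) powr (2 * \<alpha>)\<bar>"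
    proof -
      have "ln (\<bar>1 - norm (z w) powr (2 * \<alpha>)\<bar>\<^sup>2) = real 2 * ln \<bar>1 - norm (z w) powr (2 * \<alpha>)\<bar>"
        by (rule ln_realpow)
      then show ?thesis by (simp only: power2_abs of_nat_numeral)
    qed
    also have "4 * \<alpha>\<^sup>2 = (2 * \<alpha>)\<^sup>2" by simp
    also have "ln ((2 * \<alpha>)\<^sup>2) = 2 * ln (2 * \<alpha>)" using \<alpha> by (simp only: ln_realpow) 
    also have "ln (norm (z w) powr (2 * \<alpha> - 2)) = (2 * \<alpha> - 2) * ln (norm (z w))" using n0[OF w] by (simp add: ln_powr)
    finally show ?thesis by (simp add: u_def h_def field_simps)
  qed
  ultimately show ?thesis unfolding conical_singularity_def using coord z0 \<epsilon> \<alpha>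
    by (intro conjI exI[of _ "ball 0 \<epsilon>"] exI[of _ z] exI[of _ u] exI[of _ h] ballI) auto
qed

lemma complex_coordinate_subset:
  assumes "complex_coordinate U z" "open V" "V \<subseteq> U"
  shows "complex_coordinate V z"
  using assms unfolding complex_coordinate_def by (meson holomorphic_on_subset inj_on_subset)

text \<open>In the normal coordinate the continuous function required by the definition is
  identically 0. The neighbourhood is cut down to \<open>|z| < 1\<close>, as the definition
  demands.\<close>

lemma cusp_singularity_of_normal_coordinate:
  assumes z: "cusp_normal_coordinate S g \<epsilon> z"
  shows "cusp_singularity S g 0"
proof -
  let ?\<rho> = "\<lambda>w. norm (z w) powi (-2) * ln (norm (z w)) powi (-2)"
  have \<epsilon>: "\<epsilon> > 0" and coord: "complex_coordinate (ball 0 \<epsilon>) z" and z0: "z 0 = 0"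
    and mf: "metric_form S g (ball 0 \<epsilon> - {0}) z ?\<rho>"
    using z by (auto simp: cusp_normal_coordinate_def)
  have hol: "z holomorphic_on ball 0 \<epsilon>" using coord by (simp add: complex_coordinate_def)
  define V where "V = ball 0 \<epsilon> \<inter> z -` ball 0 1"
  have V: "open V" "V \<subseteq> ball 0 \<epsilon>" unfolding V_def
    using continuous_open_preimage[OF holomorphic_on_imp_continuous_on[OF hol]] by auto
  have coordV: "complex_coordinate V z"
    by (rule complex_coordinate_subset[OF coord V])
  define u where "u = (\<lambda>w. - ln (norm (z w)) - ln (- ln (norm (z w))))"
  have "metric_form S g (V - {0}) z (\<lambda>w. exp (2 * u w))"
    unfolding metric_form_def
  proof (intro conjI ballI allI)
    show "V - {0} \<subseteq> S" using mf V by (auto simp: metric_form_def)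
    fix w v assume w: "w \<in> V - {0}"
    then have wb: "w \<in> ball 0 \<epsilon> - {0}" using V by auto
    have n: "norm (z w) > 0" "norm (z w) < 1" using coordinate_nonzero[OF coord z0 wb] w by (auto simp: V_def)
    have "exp (2 * u w) = (exp (u w))\<^sup>2" by (simp add: exp_double)
    also have "exp (u w) = inverse (norm (z w)) * inverse (- ln (norm (z w)))"
      unfolding u_def using n by (simp add: exp_diff exp_minus divide_inverse)
    also have "\<dots>\<^sup>2 = ?\<rho> w" by (simp add: power_int_minus power_mult_distrib power_inverse)
    finally show "g w v = exp (2 * u w) * (norm (deriv z w * v))\<^sup>2" using mf wb by (simp add: metric_form_def)
  qed
  then show ?thesis unfolding cusp_singularity_def using coordV z0 \<epsilon>
    by (intro exI[of _ V] exI[of _ z] exI[of _ u] exI[of _ "\<lambda>_. 0"]) (auto simp: V_def u_def)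
qed

section \<open>Uniqueness of conical and cusp coordinates\<close>

lemma normal_coordinate_unique_of_metric:
  fixes R :: "real \<Rightarrow> real"
  assumes R: "\<And>t. \<lbrakk>0 < t; t < 1\<rbrakk> \<Longrightarrow> R t > 0" "\<And>s t. \<lbrakk>0 < s; s < t; t < 1\<rbrakk> \<Longrightarrow> R s < R t" "\<And>t. R t \<ge> 0"
    and \<epsilon>: "\<epsilon> > 0" "\<epsilon>' > 0"
    and z: "complex_coordinate (ball 0 \<epsilon>) z" "z 0 = 0"
    and z': "complex_coordinate (ball 0 \<epsilon>') z'" "z' 0 = 0"
    and g: "\<And>w. w \<in> ball 0 \<epsilon> - {0} \<Longrightarrow> g w 1 = (R (norm (z w)) / norm (z w) * norm (deriv z w))\<^sup>2"
    and g': "\<And>w. w \<in> ball 0 \<epsilon>' - {0} \<Longrightarrow> g w 1 = (R (norm (z' w)) / norm (z' w) * norm (deriv z' w))\<^sup>2"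
  shows "\<exists>c. norm c = 1 \<and> (\<forall>\<^sub>F w in nhds 0. z' w = c * z w)"
proof (rule normal_coordinate_unique[where R = R and \<epsilon> = "min \<epsilon> \<epsilon>'"])
  show "complex_coordinate (ball 0 (min \<epsilon> \<epsilon>')) z" "complex_coordinate (ball 0 (min \<epsilon> \<epsilon>')) z'"
    using z z' by (auto intro: complex_coordinate_subset)
  fix w :: complex assume "w \<in> ball 0 (min \<epsilon> \<epsilon>') - {0}"
  then have "(R (norm (z w)) / norm (z w) * norm (deriv z w))\<^sup>2 = (R (norm (z' w)) / norm (z' w) * norm (deriv z' w))\<^sup>2"
    using g[of w] g'[of w] by simp
  then show "R (norm (z w)) / norm (z w) * norm (deriv z w) = R (norm (z' w)) / norm (z' w) * norm (deriv z' w)"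
    using R(3) by (simp add: power2_eq_iff_nonneg)
qed (use R \<epsilon> z z' in auto)

text \<open>
  In the next two lemmas the absolute values in \<open>R\<close> make the metric the square of a nonnegative
  quantity without first excluding that the coordinate has modulus greater than 1.
\<close>

lemma conical_normal_coordinate_unique:
  assumes \<alpha>: "\<alpha> > 0" and z: "conical_normal_coordinate S g \<alpha> \<epsilon> z" and z': "conical_normal_coordinate S g \<alpha> \<epsilon>' z'"
  shows "\<exists>c. norm c = 1 \<and> (\<forall>\<^sub>F w in nhds 0. z' w = c * z w)"
proof (rule normal_coordinate_unique_of_metric[where R = "\<lambda>t. 2 * \<alpha> * t powr \<alpha> / \<bar>1 - t powr (2 * \<alpha>)\<bar>" and \<epsilon> = \<epsilon> and \<epsilon>' = \<epsilon>' and g = g])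
  have lt1: "t powr (2 * \<alpha>) < 1" if "0 < t" "t < 1" for t
    using powr_less_mono2[of "2 * \<alpha>" t 1] that \<alpha> by simp
  show "2 * \<alpha> * t powr \<alpha> / \<bar>1 - t powr (2 * \<alpha>)\<bar> > 0" if "0 < t" "t < 1" for t
    using lt1[OF that] that \<alpha> by simp
  show "2 * \<alpha> * s powr \<alpha> / \<bar>1 - s powr (2 * \<alpha>)\<bar> < 2 * \<alpha> * t powr \<alpha> / \<bar>1 - t powr (2 * \<alpha>)\<bar>" if "0 < s" "s < t" "t < 1" for s t
  proof (rule frac_less)
    show "2 * \<alpha> * s powr \<alpha> < 2 * \<alpha> * t powr \<alpha>" using that \<alpha> by (simp add: powr_less_mono2)
    have "s powr (2 * \<alpha>) < t powr (2 * \<alpha>)" using that \<alpha> by (intro powr_less_mono2) auto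
    then show "\<bar>1 - t powr (2 * \<alpha>)\<bar> \<le> \<bar>1 - s powr (2 * \<alpha>)\<bar>" "0 < \<bar>1 - t powr (2 * \<alpha>)\<bar>"
      using lt1[of t] that by auto
  qed (use \<alpha> in auto)
  have eq: "g w 1 = (2 * \<alpha> * norm (z w) powr \<alpha> / \<bar>1 - norm (z w) powr (2 * \<alpha>)\<bar> / norm (z w) * norm (deriv z w))\<^sup>2"
    if z: "conical_normal_coordinate S g \<alpha> \<epsilon> z" and w: "w \<in> ball 0 \<epsilon> - {0}" for \<epsilon> z w
  proof -
    define s where "s = norm (z w)"
    have s: "s > 0" unfolding s_def using z w by (intro coordinate_nonzero) (auto simp: conical_normal_coordinate_def)
    have "(s powr \<alpha> / s)\<^sup>2 = s powr (2 * \<alpha> - 2)"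
    proof -
      have "s powr \<alpha> / s = s powr (\<alpha> - 1)" using s by (simp add: powr_diff)
      then show ?thesis using s by (simp add: power2_eq_square flip: powr_add)
    qed
    moreover have "g w 1 = 4 * \<alpha>\<^sup>2 * s powr (2 * \<alpha> - 2) / (1 - s powr (2 * \<alpha>))\<^sup>2 * (norm (deriv z w))\<^sup>2"
      using z w by (simp add: conical_normal_coordinate_def metric_form_def s_def)
    moreover have "(2 * \<alpha> * s powr \<alpha> / \<bar>1 - s powr (2 * \<alpha>)\<bar> / s * norm (deriv z w))\<^sup>2
      = 4 * \<alpha>\<^sup>2 * (s powr \<alpha> / s)\<^sup>2 / (1 - s powr (2 * \<alpha>))\<^sup>2 * (norm (deriv z w))\<^sup>2"
      by (simp add: power_mult_distrib power_divide)
    ultimately show ?thesis by (simp add: s_def)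
  qed
  show "g w 1 = (2 * \<alpha> * norm (z w) powr \<alpha> / \<bar>1 - norm (z w) powr (2 * \<alpha>)\<bar> / norm (z w) * norm (deriv z w))\<^sup>2"
    if "w \<in> ball 0 \<epsilon> - {0}" for w by (rule eq[OF z that])
  show "g w 1 = (2 * \<alpha> * norm (z' w) powr \<alpha> / \<bar>1 - norm (z' w) powr (2 * \<alpha>)\<bar> / norm (z' w) * norm (deriv z' w))\<^sup>2"
    if "w \<in> ball 0 \<epsilon>' - {0}" for w by (rule eq[OF z' that])
qed (use z z' \<alpha> in \<open>auto simp: conical_normal_coordinate_def\<close>)

lemma cusp_normal_coordinate_unique:
  assumes z: "cusp_normal_coordinate S g \<epsilon> z" and z': "cusp_normal_coordinate S g \<epsilon>' z'"
  shows "\<exists>c. norm c = 1 \<and> (\<forall>\<^sub>F w in nhds 0. z' w = c * z w)"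
proof (rule normal_coordinate_unique_of_metric[where R = "\<lambda>t. 1 / \<bar>ln t\<bar>" and \<epsilon> = \<epsilon> and \<epsilon>' = \<epsilon>' and g = g])
  show "1 / \<bar>ln t\<bar> > 0" if "0 < t" "t < 1" for t :: real
    using that by simp
  show "1 / \<bar>ln s\<bar> < 1 / \<bar>ln t\<bar>" if "0 < s" "s < t" "t < 1" for s t :: real
  proof -
    have "ln s < ln t" "ln t < 0" using that by simp_all
    then show ?thesis by (intro divide_strict_left_mono) (auto simp: abs_if mult_neg_neg)
  qed
  have eq: "g w 1 = (1 / \<bar>ln (norm (z w))\<bar> / norm (z w) * norm (deriv z w))\<^sup>2"
    if "cusp_normal_coordinate S g \<epsilon> z" and "w \<in> ball 0 \<epsilon> - {0}" for \<epsilon> z w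
    using that by (simp add: cusp_normal_coordinate_def metric_form_def power_int_minus power_mult_distrib power_divide divide_inverse power_inverse)
  show "g w 1 = (1 / \<bar>ln (norm (z w))\<bar> / norm (z w) * norm (deriv z w))\<^sup>2"
    if "w \<in> ball 0 \<epsilon> - {0}" for w by (rule eq[OF z that])
  show "g w 1 = (1 / \<bar>ln (norm (z' w))\<bar> / norm (z' w) * norm (deriv z' w))\<^sup>2"
    if "w \<in> ball 0 \<epsilon>' - {0}" for w by (rule eq[OF z' that])
qed (use z z' in \<open>auto simp: cusp_normal_coordinate_def\<close>)

lemma complex_coordinate_rotate:
  assumes z: "complex_coordinate U z" and c: "norm c = 1"
  shows "complex_coordinate U (\<lambda>w. c * z w)"
    and "w \<in> U \<Longrightarrow> deriv (\<lambda>w. c * z w) w = c * deriv z w"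
proof -
  have "c \<noteq> 0" using c by auto
  then show "complex_coordinate U (\<lambda>w. c * z w)"
    using z by (auto simp: complex_coordinate_def inj_on_def intro: holomorphic_intros)
  show "deriv (\<lambda>w. c * z w) w = c * deriv z w" if "w \<in> U"
    using z that by (intro deriv_cmult) (auto simp: complex_coordinate_def holomorphic_on_imp_differentiable_at)
qed

lemma conical_normal_coordinate_rotate:
  assumes "conical_normal_coordinate S g \<alpha> \<epsilon> z" "norm c = 1"
  shows "conical_normal_coordinate S g \<alpha> \<epsilon> (\<lambda>w. c * z w)"
  using assms complex_coordinate_rotate[of "ball 0 \<epsilon>" z c]
  by (auto simp: conical_normal_coordinate_def metric_form_def norm_mult)

lemma cusp_normal_coordinate_rotate:
  assumes "cusp_normal_coordinate S g \<epsilon> z" "norm c = 1"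
  shows "cusp_normal_coordinate S g \<epsilon> (\<lambda>w. c * z w)"
  using assms complex_coordinate_rotate[of "ball 0 \<epsilon>" z c]
  by (auto simp: cusp_normal_coordinate_def metric_form_def norm_mult)

theorem theorem1p1:
  fixes g :: metric
  assumes "hyperbolic_conformal_metric punctured_disk g"
  shows "((\<exists>\<theta>>0. conical_singularity punctured_disk g 0 \<theta>) \<or> cusp_singularity punctured_disk g 0) \<and>
    \<not> ((\<exists>\<theta>>0. conical_singularity punctured_disk g 0 \<theta>) \<and> cusp_singularity punctured_disk g 0) \<and>
    (\<forall>\<alpha>>0. conical_singularity punctured_disk g 0 \<alpha> \<longrightarrow>
      (\<exists>\<epsilon> z. conical_normal_coordinate punctured_disk g \<alpha> \<epsilon> z) \<and>
      (\<forall>\<epsilon> z \<epsilon>' z'.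
         conical_normal_coordinate punctured_disk g \<alpha> \<epsilon> z \<and>
         conical_normal_coordinate punctured_disk g \<alpha> \<epsilon>' z' \<longrightarrow>
           (\<exists>c. norm c = 1 \<and> (\<forall>\<^sub>F w in nhds 0. z' w = c * z w))) \<and>
      (\<forall>\<epsilon> z c. conical_normal_coordinate punctured_disk g \<alpha> \<epsilon> z \<and> norm c = 1 \<longrightarrow>
         conical_normal_coordinate punctured_disk g \<alpha> \<epsilon> (\<lambda>w. c * z w))) \<and>
    (cusp_singularity punctured_disk g 0 \<longrightarrow>
      (\<exists>\<epsilon> z. cusp_normal_coordinate punctured_disk g \<epsilon> z) \<and>
      (\<forall>\<epsilon> z \<epsilon>' z'.
         cusp_normal_coordinate punctured_disk g \<epsilon> z \<and>
         cusp_normal_coordinate punctured_disk g \<epsilon>' z' \<longrightarrow>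
           (\<exists>c. norm c = 1 \<and> (\<forall>\<^sub>F w in nhds 0. z' w = c * z w))) \<and>
      (\<forall>\<epsilon> z c. cusp_normal_coordinate punctured_disk g \<epsilon> z \<and> norm c = 1 \<longrightarrow>
         cusp_normal_coordinate punctured_disk g \<epsilon> (\<lambda>w. c * z w)))"
proof -
  let ?D = punctured_disk
  obtain u where g: "\<And>w v. w \<in> ?D \<Longrightarrow> g w v = exp (2 * u w) * (norm v)\<^sup>2"
    and u: "Cinf_on ?D u" "\<And>w. w \<in> ?D \<Longrightarrow> laplacian u w = exp (2 * u w)"
    using hyperbolic_metric_potential[OF assms] by blast
  have pos: "g w 1 > 0" if "w \<in> ?D" for w using g[OF that, of 1] by simp
  have normal: "(\<exists>\<beta>>0. \<exists>\<epsilon> z. conical_normal_coordinate ?D g \<beta> \<epsilon> z) \<or> (\<exists>\<epsilon> z. cusp_normal_coordinate ?D g \<epsilon> z)"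
  proof -
    have "conical_normal_coordinate ?D g \<beta> \<epsilon> z" if "hyperbolic_cone_at u \<beta> \<epsilon> z" for \<beta> \<epsilon> z
      by (rule conical_normal_coordinate_of_cone[OF _ that]) (rule g)
    moreover have "cusp_normal_coordinate ?D g \<epsilon> z" if "hyperbolic_cusp_at u \<epsilon> z" for \<epsilon> z
      by (rule cusp_normal_coordinate_of_cusp[OF _ that]) (rule g)
    moreover have "(\<exists>\<beta>>0. \<exists>\<epsilon> z. hyperbolic_cone_at u \<beta> \<epsilon> z) \<or> (\<exists>\<epsilon> z. hyperbolic_cusp_at u \<epsilon> z)"
      by (rule cone_or_cusp_coordinate[OF u])
    ultimately show ?thesis by blast
  qed
  \<comment> \<open>The limit of \<open>ln (g w 1) / ln |w|\<close> is
    \<open>2 (\<theta> - 1)\<close> for a cone and -2 for a cusp, so the metric determines the angle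
    and a cone is never a cusp.\<close>
  have angle: "\<theta> = \<theta>'" if "conical_singularity ?D g 0 \<theta>" "conical_singularity ?D g 0 \<theta>'" for \<theta> \<theta>'
    using tendsto_unique[OF at_neq_bot conical_singularity_asymptotics[OF that(1)] conical_singularity_asymptotics[OF that(2)]] by simp
  have excl: False if "conical_singularity ?D g 0 \<theta>" "cusp_singularity ?D g 0" "\<theta> > 0" for \<theta>
    using tendsto_unique[OF at_neq_bot conical_singularity_asymptotics[OF that(1)] cusp_singularity_asymptotics[OF that(2)]] that(3) by simp
  have con: "conical_singularity ?D g 0 \<beta>" if "\<beta> > 0" "conical_normal_coordinate ?D g \<beta> \<epsilon> z" for \<beta> \<epsilon> z
    using conical_singularity_of_normal_coordinate[OF pos that] .
  have cu: "cusp_singularity ?D g 0" if "cusp_normal_coordinate ?D g \<epsilon> z" for \<epsilon> z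
    using cusp_singularity_of_normal_coordinate[OF that] .
  \<comment> \<open>The coordinate that was constructed exhibits a singularity of its own kind; the
    asymptotics then force \<open>\<beta> = \<alpha>\<close> and rule out the cusp.\<close>
  have ex_cone: "\<exists>\<epsilon> z. conical_normal_coordinate ?D g \<alpha> \<epsilon> z" if "\<alpha> > 0" "conical_singularity ?D g 0 \<alpha>" for \<alpha>
    using normal
  proof
    assume "\<exists>\<beta>>0. \<exists>\<epsilon> z. conical_normal_coordinate ?D g \<beta> \<epsilon> z"
    then obtain \<beta> \<epsilon> z where z: "\<beta> > 0" "conical_normal_coordinate ?D g \<beta> \<epsilon> z" by blast
    then show ?thesis using angle[OF that(2) con[OF z]] by blast
  qed (use cu excl that in blast)
  have ex_cusp: "\<exists>\<epsilon> z. cusp_normal_coordinate ?D g \<epsilon> z" if "cusp_singularity ?D g 0"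
    using normal con excl that by blast
  show ?thesis
  proof (intro conjI allI impI)
    show "(\<exists>\<theta>>0. conical_singularity ?D g 0 \<theta>) \<or> cusp_singularity ?D g 0" using normal con cu by blast
    show "\<not> ((\<exists>\<theta>>0. conical_singularity ?D g 0 \<theta>) \<and> cusp_singularity ?D g 0)" using excl by blast
    fix \<alpha> :: real assume \<alpha>: "\<alpha> > 0" and cone: "conical_singularity ?D g 0 \<alpha>"
    show "\<exists>\<epsilon> z. conical_normal_coordinate ?D g \<alpha> \<epsilon> z" by (rule ex_cone[OF \<alpha> cone])
    show "\<exists>c. norm c = 1 \<and> (\<forall>\<^sub>F w in nhds 0. z' w = c * z w)"
      if "conical_normal_coordinate ?D g \<alpha> \<epsilon> z \<and> conical_normal_coordinate ?D g \<alpha> \<epsilon>' z'" for \<epsilon> z \<epsilon>' z'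
      using conical_normal_coordinate_unique[OF \<alpha>] that by blast
    show "conical_normal_coordinate ?D g \<alpha> \<epsilon> (\<lambda>w. c * z w)"
      if "conical_normal_coordinate ?D g \<alpha> \<epsilon> z \<and> norm c = 1" for \<epsilon> z c
      using conical_normal_coordinate_rotate that by blast
  next
    assume cusp: "cusp_singularity ?D g 0"
    show "\<exists>\<epsilon> z. cusp_normal_coordinate ?D g \<epsilon> z" by (rule ex_cusp[OF cusp])
    show "\<exists>c. norm c = 1 \<and> (\<forall>\<^sub>F w in nhds 0. z' w = c * z w)"
      if "cusp_normal_coordinate ?D g \<epsilon> z \<and> cusp_normal_coordinate ?D g \<epsilon>' z'" for \<epsilon> z \<epsilon>' z'
      using cusp_normal_coordinate_unique that by blast
    show "cusp_normal_coordinate ?D g \<epsilon> (\<lambda>w. c * z w)"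
      if "cusp_normal_coordinate ?D g \<epsilon> z \<and> norm c = 1" for \<epsilon> z c
      using cusp_normal_coordinate_rotate that by blast
  qed
qed

end
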